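(* Let $n\ge2$ and let $U:\mathbb{R}\to(-\infty,\infty]$ be measurable, symmetric ($U(x)=U(-x)$), with $\inf U>-\infty$, $0<\int e^{-U}<\infty$, such that $U$ restricted to $[-1,1]$ is twice continuously differentiable and, for some $0<\varepsilon\le1/2$, $U$ has $(1/8,1-\varepsilon)$-controlled gradients on $\mathbb{T}_n^2$. Let $\varphi\sim\mu_{\mathbb{T}_n^2,\mathbf 0,U}$. Then there are constants $C,c>0$ depending only on $U$ and $\varepsilon$ (not on $n$) such that for every $v\in V(\mathbb{T}_n^2)$ with $\|v\|_1\ge(\log n)^2$: \begin{align*} &\operatorname{Var}(\varphi_v)\ge c\log(1+\|v\|_1),\\ &\mathbb{P}(|\varphi_v|\le r)\le C\Big(\frac{r}{\sqrt{\log(1+\|v\|_1)}}\Big)^{2/3}\quad\text{for all } r\ge1,\\ &\mathbb{P}\big(|\varphi_v|\ge t\sqrt{\log(1+\|v\|_1)}\big)\ge c\,e^{-Ct^2}\quad\text{for all }1\le t\le\frac{1+\sqrt{\|v\|_1}}{1+\log n}. \end{align*}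
   Context: For $n\ge1$, $\mathbb{T}_n^2$ is the discrete torus with vertex set $\{-n+1,\dots,n\}^2$, where $(a,b),(c,d)$ are adjacent if they agree in one coordinate and differ by $1$ mod $2n$ in the other; $\mathbf 0=(0,0)$; $\|(v_1,v_2)\|_1=|v_1|+|v_2|$. $\mu_{\mathbb{T}_n^2,\mathbf 0,U}$ is the probability measure with density $Z^{-1}\exp(-\sum_{(v,w)\in E(\mathbb{T}_n^2)}U(\varphi_v-\varphi_w))$ with respect to $\delta_0(d\varphi_{\mathbf 0})\prod_{v\ne\mathbf 0}d\varphi_v$. For $0<L<\infty$, $0<\delta<1$, $U$ has $(\delta,L)$-controlled gradients on $\mathbb{T}_n^2$ if (1) there is $K>L$ with $U(x)<\infty$ for $|x|<K$, and (2) for $\varphi\sim\mu_{\mathbb{T}_n^2,\mathbf 0,U}$ and all $k\ge1$ and distinct edges $e_1,\dots,e_k$, $\mathbb{P}(|\varphi_v-\varphi_w|\ge L \text{ for every } e_i=(v,w))\le\delta^k$. *)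

theory Defs
  imports "HOL-Probability.Probability"
begin

type_synonym vertex = "int \<times> int"

definition torus_V :: "nat \<Rightarrow> vertex set" where
  "torus_V n = {- int n + 1 .. int n} \<times> {- int n + 1 .. int n}"

definition torus_adj :: "nat \<Rightarrow> vertex \<Rightarrow> vertex \<Rightarrow> bool" where
  "torus_adj n v w \<longleftrightarrow>
     (fst v = fst w \<and> ((snd v - snd w) mod (2 * int n) = 1 \<or> (snd w - snd v) mod (2 * int n) = 1)) \<or>
     (snd v = snd w \<and> ((fst v - fst w) mod (2 * int n) = 1 \<or> (fst w - fst v) mod (2 * int n) = 1))"

text \<open>Strict lexicographic order, only used to orient each (undirected) edge once.\<close>
definition lex_less :: "vertex \<Rightarrow> vertex \<Rightarrow> bool" where
  "lex_less v w \<longleftrightarrow> fst v < fst w \<or> (fst v = fst w \<and> snd v < snd w)"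

text \<open>Edge set E(T_n^2): every undirected edge {v,w} is represented exactly once,
  as the ordered pair (v,w) with v lexicographically smaller than w.\<close>
definition torus_E :: "nat \<Rightarrow> (vertex \<times> vertex) set" where
  "torus_E n = {(v, w). v \<in> torus_V n \<and> w \<in> torus_V n \<and> torus_adj n v w \<and> lex_less v w}"

definition l1norm :: "vertex \<Rightarrow> real" where
  "l1norm v = real_of_int (\<bar>fst v\<bar> + \<bar>snd v\<bar>)"

definition free_V :: "nat \<Rightarrow> vertex set" where
  "free_V n = torus_V n - {(0, 0)}"

text \<open>Reference measure: Lebesgue measure on the free coordinates
  (the coordinate at 0 is pinned to 0 via delta_0, see field).\<close>
definition ref_measure :: "nat \<Rightarrow> (vertex \<Rightarrow> real) measure" where
  "ref_measure n = PiM (free_V n) (\<lambda>_. lborel)"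

definition field :: "(vertex \<Rightarrow> real) \<Rightarrow> vertex \<Rightarrow> real" where
  "field \<psi> v = (if v = (0, 0) then 0 else \<psi> v)"

definition boltz :: "(real \<Rightarrow> ereal) \<Rightarrow> real \<Rightarrow> ennreal" where
  "boltz U x = (if U x = \<infinity> then 0 else ennreal (exp (- real_of_ereal (U x))))"

text \<open>Unnormalised density exp(-sum_{edges} U(phi_v - phi_w)) = prod_{edges} exp(-U(phi_v-phi_w)).\<close>
definition gibbs_weight :: "nat \<Rightarrow> (real \<Rightarrow> ereal) \<Rightarrow> (vertex \<Rightarrow> real) \<Rightarrow> ennreal" where
  "gibbs_weight n U \<psi> = (\<Prod>(v, w)\<in>torus_E n. boltz U (field \<psi> v - field \<psi> w))"

definition partition_fn :: "nat \<Rightarrow> (real \<Rightarrow> ereal) \<Rightarrow> ennreal" where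
  "partition_fn n U = (\<integral>\<^sup>+ \<psi>. gibbs_weight n U \<psi> \<partial>ref_measure n)"

definition gibbs :: "nat \<Rightarrow> (real \<Rightarrow> ereal) \<Rightarrow> (vertex \<Rightarrow> real) measure" where
  "gibbs n U = density (ref_measure n) (\<lambda>\<psi>. gibbs_weight n U \<psi> / partition_fn n U)"

text \<open>(delta, L)-controlled gradients on T_n^2. Distinct edges e_1..e_k (k >= 1) are
  exactly nonempty subsets S of the edge set with card S = k.\<close>
definition controlled_gradients :: "nat \<Rightarrow> (real \<Rightarrow> ereal) \<Rightarrow> real \<Rightarrow> real \<Rightarrow> bool" where
  "controlled_gradients n U \<delta> L \<longleftrightarrow>
     (\<exists>K>L. \<forall>x. \<bar>x\<bar> < K \<longrightarrow> U x < \<infinity>) \<and>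
     (\<forall>S. S \<subseteq> torus_E n \<longrightarrow> S \<noteq> {} \<longrightarrow>
        measure (gibbs n U) {\<psi> \<in> space (gibbs n U). \<forall>(v, w)\<in>S. \<bar>field \<psi> v - field \<psi> w\<bar> \<ge> L}
          \<le> \<delta> ^ card S)"

definition C2_on_unit :: "(real \<Rightarrow> ereal) \<Rightarrow> bool" where
  "C2_on_unit U \<longleftrightarrow>
     (\<forall>x\<in>{-1..1}. \<bar>U x\<bar> \<noteq> \<infinity>) \<and>
     (\<exists>u1 u2. (\<forall>x\<in>{-1..1}.
        ((\<lambda>y. real_of_ereal (U y)) has_real_derivative u1 x) (at x within {-1..1}) \<and>
        (u1 has_real_derivative u2 x) (at x within {-1..1})) \<and>
        continuous_on {-1..1} u2)"

definition ext_variance :: "'a measure \<Rightarrow> ('a \<Rightarrow> real) \<Rightarrow> ennreal" where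
  "ext_variance M X =
     (if integrable M X then (\<integral>\<^sup>+ x. ennreal ((X x - (\<integral> y. X y \<partial>M))\<^sup>2) \<partial>M) else \<infinity>)"

end

theory Submission
  imports Defs
begin

text \<open>
  The argument is of Mermin--Wagner type. Given a configuration, every edge is independently
  frozen with probability \<open>1 - free_prob \<epsilon> x\<close>, where \<open>x\<close> is its gradient; edges with
  \<open>\<bar>x\<bar> \<le> 1 - \<epsilon>\<close> are never frozen and edges with \<open>\<bar>x\<bar> \<ge> 1 - \<epsilon> / 2\<close> always are. Let \<open>s\<close> be the
  minimum of a deterministic profile \<open>\<tau>\<close> over the clusters of frozen edges. For a fixed set of frozen
  edges the two maps adding and subtracting \<open>s\<close> are translations, so they have Jacobian one and leave
  the gradients on frozen edges alone, while on all other edges both gradients stay in \<open>(-1, 1)\<close>.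
  There the potential is \<open>C\<^sup>2\<close>, so the first-order changes of the two densities cancel in their
  product and only a loss quadratic in the gradient of \<open>s\<close> remains.

  The freezing probabilities of the translated configuration differ from those of the original one.
  As \<open>free_prob\<close> is the square of a function with bounded second differences, the corresponding
  loss also has quadratic expectation, provided that the target kernel \<open>free_prob_target\<close> is lifted
  by the square of the local slope of \<open>\<tau>\<close>.

  Controlled gradients make the clusters of frozen edges subcritical (a path of length \<open>k\<close> is frozen
  with probability at most \<open>8\<^sup>-\<^sup>k\<close>, and there are at most \<open>4\<^sup>k\<close> of them), so the expected loss is
  of the order of the Dirichlet energy of \<open>\<tau>\<close>. In two dimensions a logarithmic profile of height
  \<open>h\<close> has energy of order \<open>h\<^sup>2 / ln (1 + l1norm v)\<close>.
\<close>

section \<open>One edge\<close>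

text \<open>The two translated densities enter through their geometric mean, so
  \<open>free_prob\<close> at \<open>x\<close> has to be compared with the geometric mean of its
  values at \<open>x + d\<close> and \<open>x - d\<close>. Hence the square: a product of two values
  of the root \<open>cutoff\<close> can be expanded to second order in \<open>d\<close>. Near the
  end of the support the relative error is of order \<open>d\<^sup>2\<close> divided by
  \<open>free_prob\<close>, which is unbounded, and a translated value may even vanish. The lift of
  the target removes the zero, and the division is harmless in expectation because the edge is free
  with exactly that probability. Clusters have to be short everywhere on the torus, which needs a
  length \<open>K\<close> of order ln n, and a shift is admissible only if \<open>K\<close> times
  the slope of \<open>\<tau>\<close> is small. The profile is therefore kept flat up to a radius of
  order sqrt(l1norm v), which the hypothesis on (ln n)^2 places above \<open>K\<close>; starting the
  logarithm there costs only a constant factor in the energy. Vertices too close to the origin for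
  these constants leave finitely many tori, where positive probabilities suffice.\<close>

definition cutoff :: "real \<Rightarrow> real \<Rightarrow> real" where
  "cutoff \<epsilon> x = max 0 (1 - (2 / \<epsilon> * max 0 (\<bar>x\<bar> - (1 - \<epsilon>)))\<^sup>2)"

definition free_prob :: "real \<Rightarrow> real \<Rightarrow> real" where
  "free_prob \<epsilon> x = (cutoff \<epsilon> x)\<^sup>2"

text \<open>For \<open>a\<close> in [0, 1] this is a convex combination of \<open>free_prob\<close>
  and an indicator, hence again a probability. The indicator reaches to
  \<open>1 - \<epsilon> / 4\<close> because an edge that can be free has
  \<open>\<bar>x\<bar> < 1 - \<epsilon> / 2\<close> and will be shifted by at most
  \<open>\<epsilon> / 4\<close>.\<close>

definition free_prob_target :: "real \<Rightarrow> real \<Rightarrow> real \<Rightarrow> real" where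
  "free_prob_target \<epsilon> a x = (1 - a\<^sup>2) * free_prob \<epsilon> x + (if \<bar>x\<bar> \<le> 1 - \<epsilon> / 4 then a\<^sup>2 else 0)"

lemma cutoff_bounds: "0 \<le> cutoff \<epsilon> x" "cutoff \<epsilon> x \<le> 1"
  by (auto simp: cutoff_def)

lemma cutoff_minus: "cutoff \<epsilon> (- x) = cutoff \<epsilon> x"
  by (simp add: cutoff_def)

lemma cutoff_eq_0:
  assumes "0 < \<epsilon>" "1 - \<epsilon> / 2 \<le> \<bar>x\<bar>"
  shows "cutoff \<epsilon> x = 0"
proof -
  have "1 \<le> 2 / \<epsilon> * max 0 (\<bar>x\<bar> - (1 - \<epsilon>))"
    using assms by (auto simp: field_simps max_def)
  then have "1 \<le> (2 / \<epsilon> * max 0 (\<bar>x\<bar> - (1 - \<epsilon>)))\<^sup>2"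
    using power_mono[of 1 _ 2] by fastforce
  then show ?thesis by (simp add: cutoff_def)
qed

lemma free_prob_bounds: "0 \<le> free_prob \<epsilon> x" "free_prob \<epsilon> x \<le> 1"
  using cutoff_bounds[of \<epsilon> x] by (auto simp: free_prob_def power_le_one)

lemma free_prob_eq_1: "\<bar>x\<bar> \<le> 1 - \<epsilon> \<Longrightarrow> free_prob \<epsilon> x = 1"
  by (simp add: cutoff_def free_prob_def)

lemma free_prob_target_bounds:
  assumes "0 \<le> a" "a \<le> 1"
  shows "0 \<le> free_prob_target \<epsilon> a x" "free_prob_target \<epsilon> a x \<le> 1"
proof -
  have a: "0 \<le> 1 - a\<^sup>2" using assms by (simp add: power_le_one)
  then show "0 \<le> free_prob_target \<epsilon> a x"
    using free_prob_bounds[of \<epsilon> x] by (simp add: free_prob_target_def)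
  have "(1 - a\<^sup>2) * free_prob \<epsilon> x \<le> 1 - a\<^sup>2"
    using a free_prob_bounds[of \<epsilon> x] by (simp add: mult_left_le)
  moreover from this have "(1 - a\<^sup>2) * free_prob \<epsilon> x \<le> 1" using zero_le_power2[of a] by linarith
  ultimately show "free_prob_target \<epsilon> a x \<le> 1" by (simp add: free_prob_target_def)
qed

lemma one_minus_ge_exp:
  fixes x :: real
  assumes "0 \<le> x" "x \<le> 1/2"
  shows "exp (- (2 * x)) \<le> 1 - x"
proof -
  have "1 \<le> (1 - x) * (1 + 2 * x)"
    using assms mult_nonneg_nonneg[of x "1 - 2 * x"] by (simp add: algebra_simps)
  also have "\<dots> \<le> (1 - x) * exp (2 * x)"
    using assms exp_ge_add_one_self[of "2 * x"] by (intro mult_left_mono) auto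
  finally show ?thesis by (simp add: exp_minus field_simps)
qed

text \<open>The target keeps weight \<open>1 - a\<^sup>2\<close> on the old kernel, so the
  probability of freezing drops at most by this factor; \<open>a \<le> 1/2\<close> allows it to be
  written as an exponential.\<close>

lemma frozen_edge_bound:
  assumes "0 \<le> a" "a \<le> 1/2"
  shows "1 - free_prob \<epsilon> x \<le> exp (2 * a\<^sup>2) * (1 - free_prob_target \<epsilon> a x)"
proof -
  have "a * a \<le> 1/2 * (1/2)" using assms by (intro mult_mono) auto
  then have a2: "a\<^sup>2 \<le> 1/2" by (simp add: power2_eq_square)
  have "exp (- (2 * a\<^sup>2)) * (1 - free_prob \<epsilon> x) \<le> (1 - a\<^sup>2) * (1 - free_prob \<epsilon> x)"
    using one_minus_ge_exp[of "a\<^sup>2"] a2 free_prob_bounds[of \<epsilon> x] by (intro mult_right_mono) auto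
  also have "\<dots> \<le> 1 - free_prob_target \<epsilon> a x"
    by (auto simp: free_prob_target_def algebra_simps)
  finally show ?thesis by (simp add: exp_minus field_simps)
qed

text \<open>With \<open>q\<close> the rescaled excess of the gradient over
  \<open>1 - \<epsilon>\<close>, the cutoff is the positive part of \<open>1 - q\<^sup>2\<close>,
  and the shift by \<open>d\<close> moves \<open>q\<close> by at most \<open>e\<close>. The product
  of \<open>1 - (q + e)\<^sup>2\<close> and \<open>1 - (q - e)\<^sup>2\<close> has no term of first
  order in \<open>e\<close>.\<close>

lemma cutoff_mult_aux:
  assumes "0 < \<epsilon>" "\<epsilon> \<le> 1/2" "0 \<le> d" "d \<le> \<epsilon> / 4" "0 \<le> x"
  shows "(cutoff \<epsilon> x)\<^sup>2 - 16 / \<epsilon>\<^sup>2 * d\<^sup>2 \<le> cutoff \<epsilon> (x + d) * cutoff \<epsilon> (x - d)"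
proof (cases "cutoff \<epsilon> x = 0")
  case True
  then have "(cutoff \<epsilon> x)\<^sup>2 - 16 / \<epsilon>\<^sup>2 * d\<^sup>2 \<le> 0" by simp
  also have "0 \<le> cutoff \<epsilon> (x + d) * cutoff \<epsilon> (x - d)" by (intro mult_nonneg_nonneg cutoff_bounds)
  finally show ?thesis .
next
  case False
  define q where "q y = 2 / \<epsilon> * max 0 (\<bar>y\<bar> - (1 - \<epsilon>))" for y
  define e where "e = 2 / \<epsilon> * d"
  have e0: "0 \<le> e" using assms by (simp add: e_def)
  have q0: "0 \<le> q y" for y using assms by (simp add: q_def)
  have c: "cutoff \<epsilon> y = max 0 (1 - (q y)\<^sup>2)" for y by (simp add: cutoff_def q_def)
  have q1: "q x < 1"
  proof (rule ccontr)
    assume "\<not> q x < 1"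
    then have "1 \<le> (q x)\<^sup>2" using power_mono[of 1 "q x" 2] by auto
    then show False using False by (simp add: c)
  qed
  then have q2: "(q x)\<^sup>2 \<le> 1" using q0[of x] by (simp add: power_le_one)
  have up: "q (x + d) \<le> q x + e"
  proof -
    have "max 0 (\<bar>x + d\<bar> - (1 - \<epsilon>)) \<le> max 0 (\<bar>x\<bar> - (1 - \<epsilon>)) + d" using assms by linarith
    then have "2 / \<epsilon> * max 0 (\<bar>x + d\<bar> - (1 - \<epsilon>)) \<le> 2 / \<epsilon> * (max 0 (\<bar>x\<bar> - (1 - \<epsilon>)) + d)"
      using assms by (intro mult_left_mono) auto
    then show ?thesis unfolding q_def e_def by (simp only: distrib_left)
  qed
  have lo: "q (x - d) \<le> max 0 (q x - e)"
  proof -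
    have "max 0 (\<bar>x - d\<bar> - (1 - \<epsilon>)) \<le> max 0 (max 0 (\<bar>x\<bar> - (1 - \<epsilon>)) - d)" using assms by linarith
    then have "q (x - d) \<le> 2 / \<epsilon> * max 0 (max 0 (\<bar>x\<bar> - (1 - \<epsilon>)) - d)"
      unfolding q_def using assms by (intro mult_left_mono) auto
    also have "\<dots> = max 0 (q x - e)"
      unfolding q_def e_def using assms by (auto simp: max_def field_simps)
    finally show ?thesis .
  qed
  have "(1 - (q x)\<^sup>2)\<^sup>2 - 4 * e\<^sup>2 \<le> cutoff \<epsilon> (x + d) * cutoff \<epsilon> (x - d)"
  proof (cases "e \<le> q x")
    case True
    define A where "A = 1 - (q x + e)\<^sup>2"
    define B where "B = 1 - (q x - e)\<^sup>2"
    have B: "0 \<le> B" using True q1 e0 by (simp add: B_def power_le_one)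
    have "(q (x + d))\<^sup>2 \<le> (q x + e)\<^sup>2" using up q0 by (intro power_mono) auto
    then have A1: "max 0 A \<le> cutoff \<epsilon> (x + d)" by (auto simp: A_def c)
    have "(q (x - d))\<^sup>2 \<le> (q x - e)\<^sup>2" using lo q0 True by (intro power_mono) auto
    then have B1: "B \<le> cutoff \<epsilon> (x - d)" by (auto simp: B_def c)
    have "A * B = (1 - (q x)\<^sup>2)\<^sup>2 - 2 * e\<^sup>2 - 2 * (e\<^sup>2 * (q x)\<^sup>2) + (e\<^sup>2)\<^sup>2"
      by (simp add: A_def B_def power2_eq_square algebra_simps)
    moreover have "e\<^sup>2 * (q x)\<^sup>2 \<le> e\<^sup>2" using q2 by (simp add: mult_left_le)
    moreover have "0 \<le> (e\<^sup>2)\<^sup>2" by simp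
    ultimately have "(1 - (q x)\<^sup>2)\<^sup>2 - 4 * e\<^sup>2 \<le> A * B" by linarith
    also have "\<dots> \<le> max 0 A * B" using B by (intro mult_right_mono) auto
    also have "\<dots> \<le> cutoff \<epsilon> (x + d) * cutoff \<epsilon> (x - d)"
      using A1 B1 B by (intro mult_mono) auto
    finally show ?thesis .
  next
    case False
    \<comment> \<open>The inner point has reached the plateau, so only the outer factor loses, and
      there \<open>q\<close> is below \<open>2 * e\<close>.\<close>
    then have "q (x - d) = 0" using lo q0[of "x - d"] by auto
    then have 1: "cutoff \<epsilon> (x - d) = 1" by (simp add: c)
    have "(q (x + d))\<^sup>2 \<le> (2 * e)\<^sup>2" using up q0 False by (intro power_mono) auto
    then have "1 - 4 * e\<^sup>2 \<le> cutoff \<epsilon> (x + d)" by (auto simp: c power_mult_distrib)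
    moreover have "(1 - (q x)\<^sup>2)\<^sup>2 \<le> 1" using q2 by (intro power_le_one) auto
    ultimately show ?thesis using 1 by simp
  qed
  moreover have "cutoff \<epsilon> x = 1 - (q x)\<^sup>2" using q2 by (simp add: c)
  moreover have "4 * e\<^sup>2 = 16 / \<epsilon>\<^sup>2 * d\<^sup>2" by (simp add: e_def power2_eq_square)
  ultimately show ?thesis by simp
qed

lemma cutoff_mult:
  assumes "0 < \<epsilon>" "\<epsilon> \<le> 1/2" "\<bar>d\<bar> \<le> \<epsilon> / 4"
  shows "(cutoff \<epsilon> x)\<^sup>2 - 16 / \<epsilon>\<^sup>2 * d\<^sup>2 \<le> cutoff \<epsilon> (x + d) * cutoff \<epsilon> (x - d)"
proof -
  have *: "(cutoff \<epsilon> \<bar>x\<bar>)\<^sup>2 - 16 / \<epsilon>\<^sup>2 * \<bar>d\<bar>\<^sup>2 \<le> cutoff \<epsilon> (\<bar>x\<bar> + \<bar>d\<bar>) * cutoff \<epsilon> (\<bar>x\<bar> - \<bar>d\<bar>)"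
    using assms by (intro cutoff_mult_aux) auto
  have "cutoff \<epsilon> (d - x) = cutoff \<epsilon> (x - d)" "cutoff \<epsilon> (- x - d) = cutoff \<epsilon> (x + d)"
    using cutoff_minus[of \<epsilon> "x - d"] cutoff_minus[of \<epsilon> "x + d"] by simp_all
  with * show ?thesis
    by (cases "0 \<le> x"; cases "0 \<le> d") (simp_all add: cutoff_minus mult.commute)
qed

text \<open>The defect \<open>D\<close> of the cutoffs is measured against the lifted product
  \<open>T\<close>, which is at least \<open>a\<^sup>2\<close>. Since \<open>D\<close> is of order
  \<open>(a * y)\<^sup>2\<close>, its square is at most a multiple of
  \<open>a\<^sup>2 * y ^ 4 * T\<close>; this is where fourth powers of cluster lengths enter.
  Multiplying \<open>G - T \<le> D\<close> by \<open>G \<le> T + D\<close> produces the quotient by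
  \<open>free_prob \<epsilon> x\<close>.\<close>

lemma free_prob_target_mult:
  assumes \<epsilon>: "0 < \<epsilon>" "\<epsilon> \<le> 1/2" and d: "\<bar>d\<bar> \<le> \<epsilon> / 4" "\<bar>d\<bar> \<le> a * y"
    and a: "0 \<le> a" "a \<le> 1/2" and y: "1 \<le> y" "y ^ 4 \<le> Y"
    and pos: "free_prob \<epsilon> x > 0"
  defines "K \<equiv> 16 / \<epsilon>\<^sup>2 + (16 / \<epsilon>\<^sup>2)\<^sup>2"
  shows "(free_prob \<epsilon> x)\<^sup>2 \<le> exp (2 * ((2 + K) * a\<^sup>2 * Y / free_prob \<epsilon> x))
    * (free_prob_target \<epsilon> a (x + d) * free_prob_target \<epsilon> a (x - d))"
proof -
  define G where "G = free_prob \<epsilon> x"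
  define c where "c = 16 / \<epsilon>\<^sup>2"
  define th where "th = a\<^sup>2"
  define u where "u = cutoff \<epsilon> (x + d)"
  define w where "w = cutoff \<epsilon> (x - d)"
  define T where "T = u * w + th"
  have G: "0 < G" "G \<le> 1" using pos free_prob_bounds by (auto simp: G_def)
  have c0: "0 \<le> c" by (simp add: c_def)
  have K0: "0 \<le> K" by (simp add: K_def)
  have uw: "0 \<le> u" "0 \<le> w" using cutoff_bounds by (auto simp: u_def w_def)
  have "a * a \<le> 1/2 * (1/2)" using a by (intro mult_mono) auto
  then have th: "0 \<le> th" "th \<le> 1/2" by (simp_all add: th_def power2_eq_square)
  have Y1: "1 \<le> Y" using y one_le_power[of y 4] by linarith
  have x: "\<bar>x\<bar> < 1 - \<epsilon> / 2"
    using pos cutoff_eq_0[OF \<epsilon>(1), of x] by (force simp: free_prob_def)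
  have "\<bar>d\<bar>\<^sup>2 \<le> (a * y)\<^sup>2" using d by (intro power_mono) auto
  then have d2: "d\<^sup>2 \<le> th * y\<^sup>2" by (simp add: th_def power_mult_distrib)
  have GT: "G - c * d\<^sup>2 + th \<le> T"
    using cutoff_mult[OF \<epsilon> d(1), of x] by (simp add: T_def G_def u_def w_def free_prob_def c_def)
  have T0: "th \<le> T" using uw by (simp add: T_def)
  have main: "G \<le> exp (K * th * Y / G) * T"
  proof (cases "G \<le> T")
    case True
    have "1 * T \<le> exp (K * th * Y / G) * T"
      using K0 th Y1 G T0 by (intro mult_right_mono) auto
    then show ?thesis using True by linarith
  next
    case False
    \<comment> \<open>With slope zero the edge is not moved at all, and then
      \<open>G \<le> T\<close>.\<close>
    have thp: "0 < th"
    proof (rule ccontr)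
      assume "\<not> 0 < th"
      then have "th = 0" using th by auto
      then have "d\<^sup>2 \<le> 0" using d2 by simp
      then show False using GT False \<open>th = 0\<close> by simp
    qed
    define D where "D = c * d\<^sup>2"
    have D0: "0 \<le> D" using c0 by (simp add: D_def)
    have D1: "D \<le> c * (th * y\<^sup>2)" unfolding D_def using d2 c0 by (intro mult_left_mono)
    have "y\<^sup>2 \<le> y ^ 4" using y by (intro power_increasing) auto
    then have y2: "y\<^sup>2 \<le> Y" using y by simp
    have D2: "D \<le> c * th * Y"
      using D1 y2 c0 th mult_left_mono[OF y2, of "c * th"] by (simp add: mult.assoc)
    have "D * D \<le> (c * (th * y\<^sup>2)) * (c * (th * y\<^sup>2))" using D0 D1 c0 th by (intro mult_mono) auto
    also have "\<dots> = c\<^sup>2 * th * th * y ^ 4" by (simp add: power2_eq_square power4_eq_xxxx)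
    also have "\<dots> \<le> c\<^sup>2 * th * th * Y" using y th by (intro mult_left_mono) auto
    finally have DD: "D * D \<le> c\<^sup>2 * th * Y * th" by (simp add: mult_ac)
    have GD: "G - T \<le> D" using GT th by (simp add: D_def)
    have "G * (G - T) \<le> (T + D) * D"
      using GD False G T0 thp by (intro mult_mono) auto
    also have "\<dots> = D * T + D * D" by (simp add: algebra_simps)
    also have "\<dots> \<le> (c * th * Y) * T + (c\<^sup>2 * th * Y) * T"
    proof (intro add_mono)
      show "D * T \<le> (c * th * Y) * T" using D2 T0 th by (intro mult_right_mono) auto
      have "D * D \<le> (c\<^sup>2 * th * Y) * th" by (rule DD)
      also have "\<dots> \<le> (c\<^sup>2 * th * Y) * T" using T0 th Y1 by (intro mult_left_mono) auto
      finally show "D * D \<le> (c\<^sup>2 * th * Y) * T" .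
    qed
    also have "\<dots> = K * th * Y * T" by (simp add: K_def c_def algebra_simps)
    finally have "(G - T) * G \<le> K * th * Y * T" by (simp add: mult.commute)
    then have "(G - T) / T \<le> K * th * Y / G"
      using G T0 thp by (simp add: divide_le_eq le_divide_eq mult_ac)
    moreover have "G / T = 1 + (G - T) / T" using T0 thp by (simp add: field_simps)
    ultimately have "G / T \<le> exp (K * th * Y / G)"
      using exp_ge_add_one_self[of "K * th * Y / G"] by linarith
    then show ?thesis using T0 thp by (simp add: field_simps)
  qed
  have ft: "(1 - th) * (u\<^sup>2 + th) \<le> free_prob_target \<epsilon> a (x + d)"
    "(1 - th) * (w\<^sup>2 + th) \<le> free_prob_target \<epsilon> a (x - d)"
    using x d \<epsilon> th by (auto simp: free_prob_target_def free_prob_def u_def w_def th_def[symmetric] algebra_simps)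
  \<comment> \<open>Cauchy-Schwarz for the vectors (u, sqrt th) and (w, sqrt th): lifting both
    squares by \<open>th\<close> lifts the product of the roots by \<open>th\<close>.\<close>
  have "T\<^sup>2 \<le> (u\<^sup>2 + th) * (w\<^sup>2 + th)"
  proof -
    have "0 \<le> th * (u - w)\<^sup>2" using th by simp
    then show ?thesis by (simp add: T_def power2_eq_square algebra_simps)
  qed
  then have "(1 - th)\<^sup>2 * T\<^sup>2 \<le> (1 - th)\<^sup>2 * ((u\<^sup>2 + th) * (w\<^sup>2 + th))" by (intro mult_left_mono) auto
  also have "\<dots> = ((1 - th) * (u\<^sup>2 + th)) * ((1 - th) * (w\<^sup>2 + th))" by (simp add: power2_eq_square mult_ac)
  also have "\<dots> \<le> free_prob_target \<epsilon> a (x + d) * free_prob_target \<epsilon> a (x - d)"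
    using ft th by (intro mult_mono) (auto intro: order_trans[OF _ ft(1)])
  finally have P: "((1 - th) * T)\<^sup>2 \<le> free_prob_target \<epsilon> a (x + d) * free_prob_target \<epsilon> a (x - d)"
    by (simp add: power_mult_distrib)
  have "exp (- (2 * th)) * T \<le> (1 - th) * T"
    using one_minus_ge_exp[OF th] T0 th by (intro mult_right_mono) auto
  then have "T \<le> exp (2 * th) * ((1 - th) * T)" by (simp add: exp_minus field_simps)
  then have "exp (K * th * Y / G) * T \<le> exp (K * th * Y / G) * (exp (2 * th) * ((1 - th) * T))"
    by (intro mult_left_mono) auto
  with main have "G \<le> exp (K * th * Y / G + 2 * th) * ((1 - th) * T)" by (simp add: exp_add mult_ac)
  also have "\<dots> \<le> exp ((2 + K) * th * Y / G) * ((1 - th) * T)"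
  proof -
    have "G \<le> Y" using G Y1 by linarith
    then have "2 * th * G \<le> 2 * th * Y" using th by (intro mult_left_mono) auto
    then have "2 * th \<le> 2 * th * Y / G" using G by (simp add: field_simps)
    then have "K * th * Y / G + 2 * th \<le> (2 + K) * th * Y / G"
      by (simp add: algebra_simps add_divide_distrib)
    then show ?thesis using th T0 by (intro mult_right_mono) auto
  qed
  finally have "G\<^sup>2 \<le> (exp ((2 + K) * th * Y / G) * ((1 - th) * T))\<^sup>2"
    using G by (intro power_mono) auto
  also have "\<dots> = exp (2 * ((2 + K) * th * Y / G)) * ((1 - th) * T)\<^sup>2"
    by (simp only: power_mult_distrib exp_double)
  also have "\<dots> \<le> exp (2 * ((2 + K) * th * Y / G)) * (free_prob_target \<epsilon> a (x + d) * free_prob_target \<epsilon> a (x - d))"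
    using P by (intro mult_left_mono) auto
  finally show ?thesis by (simp add: G_def th_def)
qed

text \<open>The derivatives are one-sided at the ends of the interval; the strict bound on
  \<open>\<bar>x\<bar> + \<bar>d\<bar>\<close> stays in the interior, where they are ordinary ones.
  The auxiliary \<open>f\<close> is nondecreasing because \<open>u1 (x + t) - u1 (x - t)\<close> is
  \<open>2 * t\<close> times a value of \<open>u2\<close>.\<close>

lemma second_difference_bound:
  fixes u u1 u2 :: "real \<Rightarrow> real"
  assumes u1: "\<And>x. x \<in> {-1..1} \<Longrightarrow> (u has_real_derivative u1 x) (at x within {-1..1})"
    and u2: "\<And>x. x \<in> {-1..1} \<Longrightarrow> (u1 has_real_derivative u2 x) (at x within {-1..1})"
    and Q: "\<And>x. x \<in> {-1..1} \<Longrightarrow> u2 x \<le> Q"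
    and d: "\<bar>x\<bar> + \<bar>d\<bar> < 1"
  shows "u (x + d) + u (x - d) - 2 * u x \<le> Q * d\<^sup>2"
proof -
  have at: "at y within {-1..1} = at y" if "\<bar>y\<bar> < 1" for y :: real
    using that by (intro at_within_interior) (simp add: abs_less_iff)
  have v1: "(u has_real_derivative u1 y) (at y)" "(u1 has_real_derivative u2 y) (at y)" if "\<bar>y\<bar> < 1" for y
    using u1[of y] u2[of y] that at[of y] by (auto simp: abs_less_iff)
  have pos: "u (x + e) + u (x - e) - 2 * u x \<le> Q * e\<^sup>2" if e: "0 \<le> e" "\<bar>x\<bar> + e < 1" for e
  proof -
    define f where "f t = Q * t\<^sup>2 - (u (x + t) + u (x - t))" for t
    have "f 0 \<le> f e"
    proof (rule DERIV_nonneg_imp_nondecreasing[OF e(1)])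
      fix t assume t: "0 \<le> t" "t \<le> e"
      have *: "\<bar>x + t\<bar> < 1" "\<bar>x - t\<bar> < 1" using t e by auto
      have 1: "((\<lambda>t. u (x + t)) has_real_derivative u1 (x + t)) (at t)"
      proof -
        have "((\<lambda>t. x + t) has_real_derivative 1) (at t)" by (auto intro!: derivative_eq_intros)
        from DERIV_chain2[of u "u1 (x + t)" "\<lambda>t. x + t", OF v1(1)[OF *(1)] this] show ?thesis by simp
      qed
      have 2: "((\<lambda>t. u (x - t)) has_real_derivative - u1 (x - t)) (at t)"
      proof -
        have "((\<lambda>t. x - t) has_real_derivative - 1) (at t)" by (auto intro!: derivative_eq_intros)
        from DERIV_chain2[of u "u1 (x - t)" "\<lambda>t. x - t", OF v1(1)[OF *(2)] this] show ?thesis by simp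
      qed
      have D: "(f has_real_derivative 2 * Q * t - (u1 (x + t) - u1 (x - t))) (at t)"
        unfolding f_def by (auto intro!: derivative_eq_intros 1 2)
      have "u1 (x + t) - u1 (x - t) \<le> 2 * Q * t"
      proof (cases "t = 0")
        case False
        then have "x - t < x + t" using t by simp
        then obtain z where z: "x - t < z" "z < x + t" "u1 (x + t) - u1 (x - t) = (x + t - (x - t)) * u2 z"
          using MVT2[of "x - t" "x + t" u1 u2] v1(2) * by (auto simp: abs_less_iff)
        have "u2 z \<le> Q" using z * by (intro Q) auto
        then have "2 * t * u2 z \<le> 2 * t * Q" using t by (intro mult_left_mono) auto
        then show ?thesis using z(3) by (simp add: mult_ac)
      qed simp
      then show "\<exists>y. (f has_real_derivative y) (at t) \<and> 0 \<le> y" using D by force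
    qed
    then show ?thesis by (simp add: f_def)
  qed
  show ?thesis
    using pos[of "\<bar>d\<bar>"] d by (cases "0 \<le> d") auto
qed

section \<open>Clusters of frozen edges\<close>

definition adj_rel :: "('v \<times> 'v) set \<Rightarrow> ('v \<times> 'v) set" where
  "adj_rel \<omega> = \<omega> \<union> \<omega>\<inverse>"

lemma adj_rel_iff: "(v, w) \<in> adj_rel \<omega> \<longleftrightarrow> (v, w) \<in> \<omega> \<or> (w, v) \<in> \<omega>"
  by (auto simp: adj_rel_def)

definition cluster :: "('v \<times> 'v) set \<Rightarrow> 'v \<Rightarrow> 'v set" where
  "cluster \<omega> v = (adj_rel \<omega>)\<^sup>* `` {v}"

definition cluster_min :: "('v \<Rightarrow> real) \<Rightarrow> ('v \<times> 'v) set \<Rightarrow> 'v \<Rightarrow> real" where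
  "cluster_min \<tau> \<omega> v = Min (\<tau> ` cluster \<omega> v)"

text \<open>Edge sets of walks of length \<open>k\<close> from \<open>v\<close>; the two unions
  traverse a stored edge forwards and backwards. Only the set is kept, since the gradient hypothesis
  speaks of sets of distinct edges. A walk that repeats an edge has fewer than \<open>k\<close> of
  them and is discarded by \<open>has_path\<close>.\<close>

fun paths :: "('v \<times> 'v) set \<Rightarrow> nat \<Rightarrow> 'v \<Rightarrow> ('v \<times> 'v) set set" where
  "paths E 0 v = {{}}"
| "paths E (Suc k) v =
    (\<Union>e\<in>{e \<in> E. fst e = v}. insert e ` paths E k (snd e)) \<union>
    (\<Union>e\<in>{e \<in> E. snd e = v}. insert e ` paths E k (fst e))"

definition has_path :: "('v \<times> 'v) set \<Rightarrow> ('v \<times> 'v) set \<Rightarrow> nat \<Rightarrow> 'v \<Rightarrow> bool" where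
  "has_path E \<omega> k v \<longleftrightarrow> (\<exists>S\<in>paths E k v. card S = k \<and> S \<subseteq> \<omega>)"

lemma has_path_mono: "has_path E \<omega> k v \<Longrightarrow> \<omega> \<subseteq> \<omega>' \<Longrightarrow> has_path E \<omega>' k v"
  by (auto simp: has_path_def)

lemma paths_subset: "S \<in> paths E k v \<Longrightarrow> S \<subseteq> E"
  by (induction k arbitrary: v S) auto

lemma finite_paths: "finite E \<Longrightarrow> finite (paths E k v)"
  by (rule finite_subset[of _ "Pow E"]) (auto dest: paths_subset)

lemma card_paths:
  assumes fin: "finite E"
    and deg: "\<And>v. card {e \<in> E. fst e = v} + card {e \<in> E. snd e = v} \<le> d"
  shows "card (paths E k v) \<le> d ^ k"
proof (induction k arbitrary: v)
  case (Suc k)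
  have UN: "card (\<Union>e\<in>A. insert e ` paths E k (f e)) \<le> card A * d ^ k" if "A \<subseteq> E" for A f
  proof -
    have A: "finite A" using that fin finite_subset by auto
    have "card (\<Union>e\<in>A. insert e ` paths E k (f e)) \<le> (\<Sum>e\<in>A. card (insert e ` paths E k (f e)))"
      by (rule card_UN_le[OF A])
    also have "\<dots> \<le> (\<Sum>e\<in>A. d ^ k)"
      by (intro sum_mono order_trans[OF card_image_le Suc.IH] finite_paths fin)
    finally show ?thesis by simp
  qed
  have "card (paths E (Suc k) v) \<le> card {e \<in> E. fst e = v} * d ^ k + card {e \<in> E. snd e = v} * d ^ k"
    unfolding paths.simps by (intro order_trans[OF card_Un_le] add_mono UN) auto
  also have "\<dots> = (card {e \<in> E. fst e = v} + card {e \<in> E. snd e = v}) * d ^ k"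
    by (simp only: add_mult_distrib)
  also have "\<dots> \<le> d * d ^ k"
    by (rule mult_le_mono1[OF deg])
  finally show ?case by simp
qed simp

text \<open>A geodesic repeats no edge. The clause on end points is carried through the induction
  for this purpose: all edges of the tail stay within distance \<open>k\<close> of \<open>u\<close>,
  whereas the new edge contains \<open>v\<close>, which is at distance \<open>Suc k\<close>.\<close>

lemma has_path_of_distance_aux:
  assumes "\<omega> \<subseteq> E" "finite E"
    and "(v, u) \<in> adj_rel \<omega> ^^ k" "\<And>j. j < k \<Longrightarrow> (v, u) \<notin> adj_rel \<omega> ^^ j"
  shows "\<exists>S\<in>paths E k v. card S = k \<and> S \<subseteq> \<omega> \<and>
    (\<forall>e\<in>S. (\<exists>i\<le>k. (fst e, u) \<in> adj_rel \<omega> ^^ i) \<and> (\<exists>i\<le>k. (snd e, u) \<in> adj_rel \<omega> ^^ i))"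
  using assms(3,4)
proof (induction k arbitrary: v)
  case (Suc k)
  let ?R = "adj_rel \<omega>"
  obtain w where w: "(v, w) \<in> ?R" "(w, u) \<in> ?R ^^ k"
    using relpow_Suc_D2[OF Suc.prems(1)] by blast
  have min: "(w, u) \<notin> ?R ^^ j" if "j < k" for j
  proof
    assume "(w, u) \<in> ?R ^^ j"
    from relpow_Suc_I2[OF w(1) this] show False using Suc.prems(2) that Suc_mono by blast
  qed
  obtain S where S: "S \<in> paths E k w" "card S = k" "S \<subseteq> \<omega>"
    "\<And>e. e \<in> S \<Longrightarrow> (\<exists>i\<le>k. (fst e, u) \<in> ?R ^^ i) \<and> (\<exists>i\<le>k. (snd e, u) \<in> ?R ^^ i)"
    using Suc.IH[OF w(2) min] by blast
  define e where "e = (if (v, w) \<in> \<omega> then (v, w) else (w, v))"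
  have e: "e \<in> \<omega>" using w(1) by (auto simp: e_def adj_rel_iff)
  have "e \<notin> S"
  proof
    assume "e \<in> S"
    from S(4)[OF this] have "\<exists>i\<le>k. (v, u) \<in> ?R ^^ i" by (simp add: e_def split: if_splits)
    then show False using Suc.prems(2) by (meson le_imp_less_Suc)
  qed
  moreover have "finite S" using S(3) assms(1,2) by (meson finite_subset subset_trans)
  ultimately have card: "card (insert e S) = Suc k" using S(2) by simp
  have path: "insert e S \<in> paths E (Suc k) v"
  proof (cases "(v, w) \<in> \<omega>")
    case True
    then have "e = (v, w)" "(v, w) \<in> E" using assms(1) by (auto simp: e_def)
    then show ?thesis unfolding paths.simps using S(1) by (intro UnI1 UN_I[of "(v, w)"]) simp_all
  next
    case False
    then have "e = (w, v)" "(w, v) \<in> E" using assms(1) e by (auto simp: e_def)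
    then show ?thesis unfolding paths.simps using S(1) by (intro UnI2 UN_I[of "(w, v)"]) simp_all
  qed
  have ends: "(\<exists>i\<le>Suc k. (fst e', u) \<in> ?R ^^ i) \<and> (\<exists>i\<le>Suc k. (snd e', u) \<in> ?R ^^ i)"
    if "e' \<in> insert e S" for e'
  proof (cases "e' = e")
    case True
    have "\<exists>i\<le>Suc k. (v, u) \<in> ?R ^^ i"
      by (intro exI[of _ "Suc k"] conjI order_refl Suc.prems(1))
    moreover have "\<exists>i\<le>Suc k. (w, u) \<in> ?R ^^ i"
      by (intro exI[of _ k] conjI le_SucI order_refl w(2))
    ultimately show ?thesis unfolding True by (cases "(v, w) \<in> \<omega>") (simp_all only: e_def if_True if_False fst_conv snd_conv)
  next
    case False
    then show ?thesis using S(4)[of e'] that by (meson insertE le_SucI)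
  qed
  show ?case using e S(3) by (intro bexI[OF _ path] conjI ballI card ends) auto
qed simp

text \<open>If a point of the cluster had distance at least \<open>K\<close>, the first
  \<open>K\<close> steps of a geodesic towards it would themselves form a geodesic and give a path
  of length \<open>K\<close>.\<close>

lemma cluster_path:
  assumes "\<omega> \<subseteq> E" "finite E" "u \<in> cluster \<omega> v" "\<not> has_path E \<omega> K v"
  obtains k where "k < K" "(v, u) \<in> adj_rel \<omega> ^^ k" "has_path E \<omega> k v"
proof -
  let ?R = "adj_rel \<omega>"
  have hp: "has_path E \<omega> k v" if "(v, u) \<in> ?R ^^ k" "\<And>j. j < k \<Longrightarrow> (v, u) \<notin> ?R ^^ j" for k u
    using has_path_of_distance_aux[OF assms(1,2) that] by (auto simp: has_path_def)
  have "\<exists>k. (v, u) \<in> ?R ^^ k" using assms(3) by (auto simp: cluster_def rtrancl_is_UN_relpow)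
  define k where "k = (LEAST k. (v, u) \<in> ?R ^^ k)"
  have k: "(v, u) \<in> ?R ^^ k" unfolding k_def by (rule LeastI_ex) fact
  have min: "(v, u) \<notin> ?R ^^ j" if "j < k" for j using that not_less_Least unfolding k_def by blast
  have "k < K"
  proof (rule ccontr)
    assume "\<not> k < K"
    then have "k = K + (k - K)" by simp
    then have "(v, u) \<in> ?R ^^ K O ?R ^^ (k - K)" using k by (metis relpow_add)
    then obtain u' where u': "(v, u') \<in> ?R ^^ K" "(u', u) \<in> ?R ^^ (k - K)" by blast
    have "(v, u') \<notin> ?R ^^ j" if "j < K" for j
    proof
      assume "(v, u') \<in> ?R ^^ j"
      then have "(v, u) \<in> ?R ^^ (j + (k - K))" using u'(2) by (auto simp: relpow_add)
      moreover have "j + (k - K) < k" using that \<open>\<not> k < K\<close> by linarith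
      ultimately show False using min by blast
    qed
    then show False using hp[OF u'(1)] assms(4) by blast
  qed
  then show ?thesis using that k hp[OF k min] by blast
qed

lemma finite_cluster: "finite \<omega> \<Longrightarrow> finite (cluster \<omega> v)"
proof -
  assume "finite \<omega>"
  then have "finite (insert v (Range (adj_rel \<omega>)))" by (simp add: finite_Range adj_rel_def)
  moreover have "cluster \<omega> v \<subseteq> insert v (Range (adj_rel \<omega>))"
    by (auto simp: cluster_def elim: rtranclE)
  ultimately show ?thesis by (rule finite_subset[rotated])
qed

lemma cluster_self: "v \<in> cluster \<omega> v"
  by (simp add: cluster_def)

lemma cluster_min_le: "finite \<omega> \<Longrightarrow> u \<in> cluster \<omega> v \<Longrightarrow> cluster_min \<tau> \<omega> v \<le> \<tau> u"
  by (simp add: cluster_min_def finite_cluster)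

lemma cluster_min_attained:
  assumes "finite \<omega>"
  obtains u where "u \<in> cluster \<omega> v" "cluster_min \<tau> \<omega> v = \<tau> u"
proof -
  have "cluster_min \<tau> \<omega> v \<in> \<tau> ` cluster \<omega> v"
    unfolding cluster_min_def using assms cluster_self[of v \<omega>] by (intro Min_in) (auto simp: finite_cluster)
  then show ?thesis using that by blast
qed

lemma cluster_min_edge:
  assumes "(v, w) \<in> \<omega>"
  shows "cluster_min \<tau> \<omega> v = cluster_min \<tau> \<omega> w"
proof -
  have "(v, w) \<in> (adj_rel \<omega>)\<^sup>*" "(w, v) \<in> (adj_rel \<omega>)\<^sup>*"
    using assms by (auto simp: adj_rel_iff)
  then have "cluster \<omega> v = cluster \<omega> w"
    unfolding cluster_def Image_singleton by (metis rtrancl_trans)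
  then show ?thesis by (simp add: cluster_min_def)
qed

section \<open>Independent freezing of edges\<close>

definition edge_kernel :: "'e set \<Rightarrow> ('e \<Rightarrow> real) \<Rightarrow> 'e set \<Rightarrow> real" where
  "edge_kernel E G \<omega> = (\<Prod>e\<in>E. if e \<in> \<omega> then 1 - G e else G e)"

lemma edge_kernel_nonneg:
  "(\<And>e. e \<in> E \<Longrightarrow> 0 \<le> G e \<and> G e \<le> 1) \<Longrightarrow> 0 \<le> edge_kernel E G \<omega>"
  unfolding edge_kernel_def by (intro prod_nonneg) auto

lemma sum_edge_kernel:
  assumes "finite E"
  shows "(\<Sum>\<omega>\<in>Pow E. edge_kernel E G \<omega>) = 1"
proof -
  have "edge_kernel E G \<omega> = (\<Prod>e\<in>\<omega>. 1 - G e) * (\<Prod>e\<in>E - \<omega>. G e)" if "\<omega> \<in> Pow E" for \<omega>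
  proof -
    have "E \<inter> \<omega> = \<omega>" "E \<inter> - \<omega> = E - \<omega>" using that by auto
    then show ?thesis using assms prod.If_cases[of E "\<lambda>e. e \<in> \<omega>" "\<lambda>e. 1 - G e" G]
      by (simp add: edge_kernel_def)
  qed
  then have "(\<Sum>\<omega>\<in>Pow E. edge_kernel E G \<omega>) = (\<Sum>\<omega>\<in>Pow E. (\<Prod>e\<in>\<omega>. 1 - G e) * (\<Prod>e\<in>E - \<omega>. G e))"
    by (intro sum.cong) auto
  also have "\<dots> = (\<Prod>e\<in>E. (1 - G e) + G e)" using prod_add[OF assms, of "\<lambda>e. 1 - G e" G] by simp
  finally show ?thesis by simp
qed

lemma sum_Pow_insert:
  fixes f :: "'e set \<Rightarrow> real"
  assumes "finite E" "e \<notin> E"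
  shows "sum f (Pow (insert e E)) = (\<Sum>\<omega>\<in>Pow E. f \<omega> + f (insert e \<omega>))"
proof -
  have "inj_on (insert e) (Pow E)" using assms(2) by (auto simp: inj_on_def)
  then show ?thesis
    unfolding Pow_insert using assms
    by (subst sum.union_disjoint) (auto simp: sum.reindex sum.distrib)
qed

text \<open>Conditionally on the configuration, the status of one edge is independent of all others;
  monotonicity of the functional absorbs the dependence on that edge.\<close>
lemma edge_kernel_free_edge:
  fixes X :: "'e set \<Rightarrow> real"
  assumes "finite E" "e \<in> E" and G: "\<And>e. e \<in> E \<Longrightarrow> 0 \<le> G e \<and> G e \<le> 1"
    and X: "\<And>\<omega>. 0 \<le> X \<omega>" "\<And>\<omega> \<omega>'. \<omega> \<subseteq> \<omega>' \<Longrightarrow> X \<omega> \<le> X \<omega>'"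
  shows "(\<Sum>\<omega>\<in>Pow E. edge_kernel E G \<omega> * (if e \<in> \<omega> then 0 else X \<omega> / G e))
    \<le> (\<Sum>\<omega>\<in>Pow E. edge_kernel E G \<omega> * X \<omega>)"
proof -
  define F where "F = E - {e}"
  have F: "finite F" "e \<notin> F" "E = insert e F" using assms by (auto simp: F_def)
  have k: "edge_kernel E G \<omega> = G e * edge_kernel F G \<omega>"
    "edge_kernel E G (insert e \<omega>) = (1 - G e) * edge_kernel F G \<omega>" if "\<omega> \<in> Pow F" for \<omega>
  proof -
    have "e \<notin> \<omega>" using that F by auto
    moreover have "(\<Prod>x\<in>F. if x = e \<or> x \<in> \<omega> then 1 - G x else G x) = (\<Prod>x\<in>F. if x \<in> \<omega> then 1 - G x else G x)"
      using F(2) by (intro prod.cong) auto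
    ultimately show "edge_kernel E G \<omega> = G e * edge_kernel F G \<omega>"
      "edge_kernel E G (insert e \<omega>) = (1 - G e) * edge_kernel F G \<omega>"
      using F by (simp_all add: edge_kernel_def)
  qed
  have e\<omega>: "e \<notin> \<omega>" if "\<omega> \<in> Pow F" for \<omega> using that F by auto
  have kF: "0 \<le> edge_kernel F G \<omega>" for \<omega> using G F by (intro edge_kernel_nonneg) auto
  have Ge: "0 \<le> G e" "G e \<le> 1" using G assms(2) by auto
  have "(\<Sum>\<omega>\<in>Pow E. edge_kernel E G \<omega> * (if e \<in> \<omega> then 0 else X \<omega> / G e))
      = (\<Sum>\<omega>\<in>Pow F. G e * edge_kernel F G \<omega> * (X \<omega> / G e))"
    unfolding F(3) sum_Pow_insert[OF F(1,2)] using k e\<omega> by (intro sum.cong) (auto simp flip: F(3))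
  \<comment> \<open>The probability \<open>G e\<close> of being free cancels the division. If
    \<open>G e = 0\<close>, the quotient is 0 by convention and the term only drops.\<close>
  also have "\<dots> \<le> (\<Sum>\<omega>\<in>Pow F. edge_kernel F G \<omega> * X \<omega>)"
    using kF X(1) by (intro sum_mono) (cases "G e = 0"; simp)
  also have "\<dots> \<le> (\<Sum>\<omega>\<in>Pow F. G e * edge_kernel F G \<omega> * X \<omega> + (1 - G e) * edge_kernel F G \<omega> * X (insert e \<omega>))"
  proof (intro sum_mono)
    fix \<omega>
    have "(1 - G e) * edge_kernel F G \<omega> * X \<omega> \<le> (1 - G e) * edge_kernel F G \<omega> * X (insert e \<omega>)"
      using Ge kF X(2)[of \<omega> "insert e \<omega>"] by (intro mult_left_mono) auto
    then show "edge_kernel F G \<omega> * X \<omega> \<le> G e * edge_kernel F G \<omega> * X \<omega> + (1 - G e) * edge_kernel F G \<omega> * X (insert e \<omega>)"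
      by (simp add: algebra_simps)
  qed
  also have "\<dots> = (\<Sum>\<omega>\<in>Pow E. edge_kernel E G \<omega> * X \<omega>)"
    unfolding F(3) sum_Pow_insert[OF F(1,2)] using k by (intro sum.cong) (auto simp flip: F(3))
  finally show ?thesis .
qed

section \<open>Product Lebesgue measure under coordinatewise maps, for translations and for the
  reflection\<close>

lemma distr_PiM_coordinatewise:
  fixes T :: "'i \<Rightarrow> real \<Rightarrow> real"
  assumes I: "finite I" and T: "\<And>i. i \<in> I \<Longrightarrow> distr lborel borel (T i) = lborel"
    and [measurable]: "\<And>i. T i \<in> borel_measurable borel"
  shows "distr (PiM I (\<lambda>_. lborel)) (PiM I (\<lambda>_. lborel)) (\<lambda>x. \<lambda>i\<in>I. T i (x i)) = PiM I (\<lambda>_. lborel)"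
proof -
  interpret product_sigma_finite "\<lambda>_::'i. lborel :: real measure" by standard
  have m [measurable]: "(\<lambda>x. \<lambda>i\<in>I. T i (x i)) \<in> measurable (PiM I (\<lambda>_. lborel)) (PiM I (\<lambda>_. lborel))"
    by measurable
  show ?thesis
  proof (rule PiM_eqI[OF I])
    fix A :: "'i \<Rightarrow> real set" assume A: "\<And>i. i \<in> I \<Longrightarrow> A i \<in> sets lborel"
    have TA: "T i -` A i \<in> sets lborel" if "i \<in> I" for i
      using measurable_sets[of "T i" borel borel "A i"] A[OF that] by simp
    have "emeasure (distr (PiM I (\<lambda>_. lborel)) (PiM I (\<lambda>_. lborel)) (\<lambda>x. \<lambda>i\<in>I. T i (x i))) (Pi\<^sub>E I A)
        = emeasure (PiM I (\<lambda>_. lborel)) ((\<lambda>x. \<lambda>i\<in>I. T i (x i)) -` Pi\<^sub>E I A \<inter> space (PiM I (\<lambda>_. lborel)))"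
      using A I by (intro emeasure_distr m sets_PiM_I_finite) auto
    also have "(\<lambda>x. \<lambda>i\<in>I. T i (x i)) -` Pi\<^sub>E I A \<inter> space (PiM I (\<lambda>_. lborel)) = Pi\<^sub>E I (\<lambda>i. T i -` A i)"
      by (auto simp: space_PiM PiE_iff)
    also have "emeasure (PiM I (\<lambda>_. lborel)) (Pi\<^sub>E I (\<lambda>i. T i -` A i)) = (\<Prod>i\<in>I. emeasure lborel (T i -` A i))"
      using TA by (intro emeasure_PiM[OF I]) auto
    also have "\<dots> = (\<Prod>i\<in>I. emeasure lborel (A i))"
    proof (intro prod.cong refl)
      fix i assume i: "i \<in> I"
      have "emeasure (distr lborel borel (T i)) (A i) = emeasure lborel (T i -` A i)"
        using A[OF i] by (subst emeasure_distr) auto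
      then show "emeasure lborel (T i -` A i) = emeasure lborel (A i)" using T[OF i] by simp
    qed
    finally show "emeasure (distr (PiM I (\<lambda>_. lborel)) (PiM I (\<lambda>_. lborel)) (\<lambda>x. \<lambda>i\<in>I. T i (x i))) (Pi\<^sub>E I A)
      = (\<Prod>i\<in>I. emeasure lborel (A i))" .
  qed simp
qed

lemma nn_integral_PiM_translate:
  fixes s :: "'i \<Rightarrow> real"
  assumes I: "finite I" and F: "F \<in> borel_measurable (PiM I (\<lambda>_. lborel))"
  shows "(\<integral>\<^sup>+x. F (\<lambda>i\<in>I. s i + x i) \<partial>PiM I (\<lambda>_. lborel)) = (\<integral>\<^sup>+x. F x \<partial>PiM I (\<lambda>_. lborel))"
proof -
  have m: "(\<lambda>x. \<lambda>i\<in>I. s i + x i) \<in> measurable (PiM I (\<lambda>_. lborel)) (PiM I (\<lambda>_. lborel :: real measure))"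
    by measurable
  have "distr (PiM I (\<lambda>_. lborel)) (PiM I (\<lambda>_. lborel)) (\<lambda>x. \<lambda>i\<in>I. s i + x i) = PiM I (\<lambda>_. lborel :: real measure)"
    by (rule distr_PiM_coordinatewise[OF I]) (auto simp: lborel_distr_plus)
  then show ?thesis using nn_integral_distr[OF m, of F] F by simp
qed

section \<open>The torus\<close>

lemma finite_torus_V: "finite (torus_V n)"
  by (simp add: torus_V_def)

lemma torus_E_subset: "torus_E n \<subseteq> torus_V n \<times> torus_V n"
  by (auto simp: torus_E_def)

lemma finite_torus_E: "finite (torus_E n)"
  using finite_subset[OF torus_E_subset] finite_torus_V by blast

lemma card_torus_V: "card (torus_V n) = 4 * n\<^sup>2"
  by (simp add: torus_V_def card_cartesian_product power2_eq_square nat_mult_distrib)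

lemma finite_free_V: "finite (free_V n)"
  by (simp add: free_V_def finite_torus_V)

lemma torus_adj_sym: "torus_adj n v w \<longleftrightarrow> torus_adj n w v"
  by (auto simp: torus_adj_def)

lemma lex_less_linear: "v \<noteq> w \<Longrightarrow> lex_less v w \<or> lex_less w v"
  by (auto simp: lex_less_def prod_eq_iff)

lemma lex_less_asym: "lex_less v w \<Longrightarrow> \<not> lex_less w v"
  by (auto simp: lex_less_def)

text \<open>Both numbers lie in one period, so the quotient of \<open>a - b\<close> by
  \<open>2 * n\<close> can only be 0 or -1; the second value is the wrap-around step.\<close>

lemma diff_mod_eq_1_cases:
  fixes a b n :: int
  assumes "a \<in> {- n + 1..n}" "b \<in> {- n + 1..n}" "(a - b) mod (2 * n) = 1"
  shows "a = b + 1 \<or> (a = - n + 1 \<and> b = n)"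
proof -
  define q where "q = (a - b) div (2 * n)"
  have ab: "a - b = 2 * n * q + 1" using mult_div_mod_eq[of "2 * n" "a - b"] assms(3) unfolding q_def by linarith
  have n: "0 < n" using assms by auto
  have "q < 1"
  proof (rule ccontr)
    assume "\<not> q < 1"
    then have "2 * n * 1 \<le> 2 * n * q" using n by (intro mult_left_mono) auto
    then show False using ab assms by auto
  qed
  moreover have "- 2 < q"
  proof (rule ccontr)
    assume "\<not> - 2 < q"
    then have "2 * n * q \<le> 2 * n * (- 2)" using n by (intro mult_left_mono) auto
    then show False using ab assms by auto
  qed
  ultimately have "q = 0 \<or> q = - 1" by auto
  then show ?thesis using ab assms by auto
qed

lemma card_diff_mod_eq_1:
  fixes a n :: int
  assumes "a \<in> {- n + 1..n}"
  shows "card {b \<in> {- n + 1..n}. (a - b) mod (2 * n) = 1} \<le> 1"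
    "card {b \<in> {- n + 1..n}. (b - a) mod (2 * n) = 1} \<le> 1"
proof -
  have "b = (if a = - n + 1 then n else a - 1)" if "b \<in> {- n + 1..n}" "(a - b) mod (2 * n) = 1" for b
    using diff_mod_eq_1_cases[OF assms that] that(1) assms by auto
  then have "{b \<in> {- n + 1..n}. (a - b) mod (2 * n) = 1} \<subseteq> {if a = - n + 1 then n else a - 1}"
    by blast
  from card_mono[OF _ this] show "card {b \<in> {- n + 1..n}. (a - b) mod (2 * n) = 1} \<le> 1" by simp
  have "b = (if a = n then - n + 1 else a + 1)" if "b \<in> {- n + 1..n}" "(b - a) mod (2 * n) = 1" for b
    using diff_mod_eq_1_cases[OF that(1) assms that(2)] that(1) assms by auto
  then have "{b \<in> {- n + 1..n}. (b - a) mod (2 * n) = 1} \<subseteq> {if a = n then - n + 1 else a + 1}"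
    by blast
  from card_mono[OF _ this] show "card {b \<in> {- n + 1..n}. (b - a) mod (2 * n) = 1} \<le> 1" by simp
qed

lemma card_neighbours:
  assumes v: "v \<in> torus_V n"
  shows "card {w \<in> torus_V n. torus_adj n v w} \<le> 4"
proof -
  obtain a b where ab: "v = (a, b)" by (cases v)
  let ?I = "{- int n + 1..int n}"
  have a: "a \<in> ?I" and b: "b \<in> ?I" using v by (auto simp: ab torus_V_def)
  define D where "D x = {y \<in> ?I. (x - y) mod (2 * int n) = 1}" for x
  define U where "U x = {y \<in> ?I. (y - x) mod (2 * int n) = 1}" for x
  have sub: "{w \<in> torus_V n. torus_adj n v w} \<subseteq>
    (Pair a ` D b \<union> Pair a ` U b) \<union> ((\<lambda>x. (x, b)) ` D a \<union> (\<lambda>x. (x, b)) ` U a)"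
    by (auto simp: ab torus_V_def torus_adj_def D_def U_def)
  have fin: "finite (D x)" "finite (U x)" for x
    unfolding D_def U_def by (rule finite_subset[of _ ?I]; auto)+
  have c: "card (f ` D x) \<le> 1" "card (f ` U x) \<le> 1" if "x \<in> ?I" for x and f :: "int \<Rightarrow> vertex"
    using card_image_le[OF fin(1), of f x] card_image_le[OF fin(2), of f x] card_diff_mod_eq_1[OF that]
    by (simp_all add: D_def U_def)
  have "card {w \<in> torus_V n. torus_adj n v w} \<le>
    card ((Pair a ` D b \<union> Pair a ` U b) \<union> ((\<lambda>x. (x, b)) ` D a \<union> (\<lambda>x. (x, b)) ` U a))"
    using fin by (intro card_mono sub) auto
  also have "\<dots> \<le> (1 + 1) + (1 + 1)"
    by (intro order_trans[OF card_Un_le] add_mono c a b)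
  finally show ?thesis by simp
qed

text \<open>An incident edge determines the neighbour at its other end, and the lexicographic
  orientation makes the neighbours reached by outgoing and by incoming edges disjoint, so the four
  neighbours bound both counts together.\<close>

lemma torus_degree:
  "card {e \<in> torus_E n. fst e = v} + card {e \<in> torus_E n. snd e = v} \<le> 4"
proof (cases "v \<in> torus_V n")
  case True
  let ?N = "{w \<in> torus_V n. torus_adj n v w}"
  let ?A = "{w \<in> ?N. lex_less v w}" and ?B = "{w \<in> ?N. lex_less w v}"
  have fin: "finite ?N" "finite ?A" "finite ?B" using finite_torus_V[of n] by simp_all
  have "{e \<in> torus_E n. fst e = v} \<subseteq> Pair v ` ?A" by (auto simp: torus_E_def)
  then have 1: "card {e \<in> torus_E n. fst e = v} \<le> card ?A"
    by (rule order_trans[OF card_mono[OF finite_imageI[OF fin(2)]] card_image_le[OF fin(2)]])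
  have "{e \<in> torus_E n. snd e = v} \<subseteq> (\<lambda>w. (w, v)) ` ?B"
    using torus_adj_sym[of n _ v] by (auto simp: torus_E_def)
  then have 2: "card {e \<in> torus_E n. snd e = v} \<le> card ?B"
    by (rule order_trans[OF card_mono[OF finite_imageI[OF fin(3)]] card_image_le[OF fin(3)]])
  have "card ?A + card ?B = card (?A \<union> ?B)"
    using lex_less_asym by (intro card_Un_disjoint[symmetric] fin) blast
  also have "\<dots> \<le> card ?N" using fin by (intro card_mono) auto
  finally show ?thesis using 1 2 card_neighbours[OF True] by linarith
next
  case False
  then have "{e \<in> torus_E n. fst e = v} = {}" "{e \<in> torus_E n. snd e = v} = {}"
    by (auto simp: torus_E_def)
  then show ?thesis by (simp only: card.empty)
qed

section \<open>Edge sums and the distance to the origin\<close>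

lemma sum_over_edges_le:
  fixes f :: "vertex \<Rightarrow> real"
  assumes "\<And>v. v \<in> torus_V n \<Longrightarrow> 0 \<le> f v"
  shows "(\<Sum>e\<in>torus_E n. f (fst e) + f (snd e)) \<le> 4 * (\<Sum>v\<in>torus_V n. f v)"
proof -
  have part: "(\<Sum>e\<in>torus_E n. f (h e)) = (\<Sum>v\<in>torus_V n. real (card {e \<in> torus_E n. h e = v}) * f v)"
    if "h ` torus_E n \<subseteq> torus_V n" for h
  proof -
    have "(\<Sum>e\<in>torus_E n. f (h e)) = (\<Sum>v\<in>torus_V n. \<Sum>e\<in>{e \<in> torus_E n. h e = v}. f (h e))"
      by (rule sum.group[symmetric, OF finite_torus_E finite_torus_V that])
    also have "\<dots> = (\<Sum>v\<in>torus_V n. real (card {e \<in> torus_E n. h e = v}) * f v)"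
      by (intro sum.cong) auto
    finally show ?thesis .
  qed
  have "(\<Sum>e\<in>torus_E n. f (fst e) + f (snd e))
    = (\<Sum>v\<in>torus_V n. real (card {e \<in> torus_E n. fst e = v} + card {e \<in> torus_E n. snd e = v}) * f v)"
    using part[of fst] part[of snd] torus_E_subset[of n] by (force simp: sum.distrib algebra_simps)
  also have "\<dots> \<le> (\<Sum>v\<in>torus_V n. 4 * f v)"
    using assms of_nat_mono[OF torus_degree, where 'a = real] by (intro sum_mono mult_right_mono) auto
  finally show ?thesis by (simp add: sum_distrib_left)
qed

text \<open>The wrap-around step joins \<open>- n + 1\<close> and \<open>n\<close>, whose absolute
  values also differ by one; with these representatives the norm is Lipschitz along every edge of
  the torus.\<close>

lemma l1norm_adj:
  assumes "v \<in> torus_V n" "w \<in> torus_V n" "torus_adj n v w"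
  shows "\<bar>l1norm v - l1norm w\<bar> \<le> 1"
proof -
  have *: "\<bar>\<bar>a\<bar> - \<bar>b\<bar>\<bar> \<le> 1"
    if "a \<in> {- int n + 1..int n}" "b \<in> {- int n + 1..int n}"
      "(a - b) mod (2 * int n) = 1 \<or> (b - a) mod (2 * int n) = 1" for a b
    using that diff_mod_eq_1_cases[of a "int n" b] diff_mod_eq_1_cases[of b "int n" a] by auto
  have "\<bar>(\<bar>fst v\<bar> + \<bar>snd v\<bar>) - (\<bar>fst w\<bar> + \<bar>snd w\<bar>)\<bar> \<le> 1"
    using assms *[of "fst v" "fst w"] *[of "snd v" "snd w"]
    by (auto simp: torus_V_def torus_adj_def)
  then show ?thesis unfolding l1norm_def of_int_diff[symmetric] of_int_abs[symmetric] by linarith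
qed

lemma l1norm_edge: "e \<in> torus_E n \<Longrightarrow> \<bar>l1norm (fst e) - l1norm (snd e)\<bar> \<le> 1"
  by (auto simp: torus_E_def intro!: l1norm_adj)

lemma l1norm_le: "v \<in> torus_V n \<Longrightarrow> l1norm v \<le> 2 * real n"
  by (auto simp: torus_V_def l1norm_def)

lemma l1norm_relpow:
  assumes "\<omega> \<subseteq> torus_E n" "(v, u) \<in> adj_rel \<omega> ^^ k"
  shows "\<bar>l1norm v - l1norm u\<bar> \<le> real k"
  using assms(2)
proof (induction k arbitrary: u)
  case (Suc k)
  then obtain w where w: "(v, w) \<in> adj_rel \<omega> ^^ k" "(w, u) \<in> adj_rel \<omega>" by (auto elim: relpow_Suc_E)
  have "\<bar>l1norm w - l1norm u\<bar> \<le> 1"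
    using w(2) assms(1) l1norm_edge[of "(w, u)" n] l1norm_edge[of "(u, w)" n]
    by (auto simp: adj_rel_iff abs_minus_commute)
  then show ?case using Suc.IH[OF w(1)] by simp
qed simp

lemma card_l1_sphere: "card {v :: vertex. nat (\<bar>fst v\<bar> + \<bar>snd v\<bar>) = k} \<le> 4 * k + 2"
  and finite_l1_sphere: "finite {v :: vertex. nat (\<bar>fst v\<bar> + \<bar>snd v\<bar>) = k}"
proof -
  let ?f = "\<lambda>a. (a, int k - \<bar>a\<bar>)" and ?g = "\<lambda>a. (a, \<bar>a\<bar> - int k)"
  have sub: "{v :: vertex. nat (\<bar>fst v\<bar> + \<bar>snd v\<bar>) = k} \<subseteq> ?f ` {- int k..int k} \<union> ?g ` {- int k..int k}"
  proof
    fix v :: vertex assume "v \<in> {v. nat (\<bar>fst v\<bar> + \<bar>snd v\<bar>) = k}"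
    then have "\<bar>fst v\<bar> + \<bar>snd v\<bar> = int k" by auto
    then have "fst v \<in> {- int k..int k}" "snd v = int k - \<bar>fst v\<bar> \<or> snd v = \<bar>fst v\<bar> - int k" by auto
    then show "v \<in> ?f ` {- int k..int k} \<union> ?g ` {- int k..int k}" by (cases v) auto
  qed
  then show "finite {v :: vertex. nat (\<bar>fst v\<bar> + \<bar>snd v\<bar>) = k}" by (rule finite_subset) auto
  have c: "card (h ` {- int k..int k}) \<le> 2 * k + 1" for h :: "int \<Rightarrow> vertex"
    using card_image_le[of "{- int k..int k}" h] by simp
  have "card {v :: vertex. nat (\<bar>fst v\<bar> + \<bar>snd v\<bar>) = k} \<le> card (?f ` {- int k..int k} \<union> ?g ` {- int k..int k})"
    by (intro card_mono sub) auto
  also have "\<dots> \<le> (2 * k + 1) + (2 * k + 1)"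
    by (intro order_trans[OF card_Un_le] add_mono c)
  finally show "card {v :: vertex. nat (\<bar>fst v\<bar> + \<bar>snd v\<bar>) = k} \<le> 4 * k + 2" by simp
qed

text \<open>This is where dimension two enters: a sphere of radius \<open>k\<close> has at most
  \<open>6 * max 1 k\<close> points, so the inverse squares sum up like a harmonic series.\<close>

lemma sum_inverse_square_l1norm:
  assumes "1 \<le> m"
  shows "(\<Sum>v | v \<in> torus_V n \<and> l1norm v \<le> real m. 1 / (max 1 (l1norm v))\<^sup>2) \<le> 6 * (2 + ln (real m))"
proof -
  define N where "N v = nat (\<bar>fst v\<bar> + \<bar>snd v\<bar>)" for v :: vertex
  have N: "l1norm v = real (N v)" for v by (simp add: l1norm_def N_def)
  let ?A = "{v. v \<in> torus_V n \<and> l1norm v \<le> real m}"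
  have finA: "finite ?A" using finite_torus_V by simp
  have "(\<Sum>v\<in>?A. 1 / (max 1 (l1norm v))\<^sup>2) = (\<Sum>k\<in>{..m}. \<Sum>v\<in>{v \<in> ?A. N v = k}. 1 / (max 1 (l1norm v))\<^sup>2)"
    by (rule sum.group[symmetric, OF finA]) (auto simp: N)
  also have "\<dots> \<le> (\<Sum>k\<in>{..m}. 6 / max 1 (real k))"
  proof (intro sum_mono)
    fix k
    have "card {v \<in> ?A. N v = k} \<le> card {v :: vertex. nat (\<bar>fst v\<bar> + \<bar>snd v\<bar>) = k}"
      by (intro card_mono finite_l1_sphere) (auto simp: N_def)
    then have "real (card {v \<in> ?A. N v = k}) \<le> real (4 * k + 2)"
      using card_l1_sphere[of k] by (intro of_nat_mono) linarith
    also have "\<dots> \<le> 6 * max 1 (real k)" by simp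
    finally have c: "real (card {v \<in> ?A. N v = k}) \<le> 6 * max 1 (real k)" .
    have "(\<Sum>v\<in>{v \<in> ?A. N v = k}. 1 / (max 1 (l1norm v))\<^sup>2) = (\<Sum>v\<in>{v \<in> ?A. N v = k}. 1 / (max 1 (real k))\<^sup>2)"
      by (intro sum.cong) (auto simp: N)
    also have "\<dots> = real (card {v \<in> ?A. N v = k}) / (max 1 (real k))\<^sup>2" by simp
    also have "\<dots> \<le> 6 * max 1 (real k) / (max 1 (real k))\<^sup>2" using c by (intro divide_right_mono) auto
    also have "\<dots> = 6 / max 1 (real k)" by (simp add: power2_eq_square)
    finally show "(\<Sum>v\<in>{v \<in> ?A. N v = k}. 1 / (max 1 (l1norm v))\<^sup>2) \<le> 6 / max 1 (real k)" .
  qed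
  also have "{..m} = insert 0 {1..m}" by auto
  also have "(\<Sum>k\<in>insert 0 {1..m}. 6 / max 1 (real k)) = 6 + (\<Sum>k\<in>{1..m}. 6 / max 1 (real k))"
    by (subst sum.insert) auto
  also have "(\<Sum>k\<in>{1..m}. 6 / max 1 (real k)) = (\<Sum>k\<in>{1..m}. 6 * inverse (real k))"
    by (intro sum.cong) (auto simp: divide_inverse max_def)
  also have "\<dots> = 6 * harm m" by (simp add: harm_def sum_distrib_left)
  \<comment> \<open>The difference \<open>harm k - ln k\<close> decreases in \<open>k\<close> and
    equals 1 at \<open>k = 1\<close>.\<close>
  also have "harm m \<le> ln (real m) + 1"
    using decseqD[OF decseq_harm_diff_ln, of 0 "m - 1"] assms by (simp add: harm_expand)
  finally show ?thesis by simp
qed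

text \<open>Moving one step towards the origin defines a spanning tree of the torus.\<close>
definition parent :: "vertex \<Rightarrow> vertex" where
  "parent v = (if fst v \<noteq> 0 then (fst v - sgn (fst v), snd v) else (0, snd v - sgn (snd v)))"

definition tree_edge :: "vertex \<Rightarrow> vertex \<times> vertex" where
  "tree_edge v = (if lex_less v (parent v) then (v, parent v) else (parent v, v))"

lemma l1norm_parent: "v \<noteq> (0, 0) \<Longrightarrow> l1norm (parent v) = l1norm v - 1"
  by (auto simp: parent_def l1norm_def sgn_if prod_eq_iff split: if_splits)

lemma parent_in_torus: "v \<in> free_V n \<Longrightarrow> parent v \<in> torus_V n"
  by (auto simp: parent_def free_V_def torus_V_def sgn_if)

lemma torus_adj_parent:
  assumes "v \<in> free_V n"
  shows "torus_adj n v (parent v)"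
proof -
  have "1 \<le> n" using assms by (auto simp: free_V_def torus_V_def)
  then have "1 mod (2 * int n) = 1" by simp
  then show ?thesis using assms
    by (auto simp: parent_def free_V_def torus_adj_def sgn_if prod_eq_iff split: if_splits)
qed

lemma tree_edge_in_torus_E: "v \<in> free_V n \<Longrightarrow> tree_edge v \<in> torus_E n"
proof -
  assume v: "v \<in> free_V n"
  then have "v \<noteq> parent v" using l1norm_parent[of v] by (auto simp: free_V_def)
  then show ?thesis
    using v lex_less_linear[of v "parent v"] parent_in_torus[OF v] torus_adj_parent[OF v]
    by (auto simp: tree_edge_def torus_E_def free_V_def torus_adj_sym)
qed

text \<open>Two vertices cannot be each other's parent, since the norm drops by one along
  \<open>parent\<close>.\<close>

lemma inj_on_tree_edge: "inj_on tree_edge (free_V n)"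
proof (rule inj_onI)
  fix v w assume vw: "v \<in> free_V n" "w \<in> free_V n" "tree_edge v = tree_edge w"
  have "v = w \<or> (v = parent w \<and> w = parent v)"
    using vw(3) by (auto simp: tree_edge_def split: if_splits)
  moreover have "l1norm (parent v) = l1norm v - 1" "l1norm (parent w) = l1norm w - 1"
    using vw by (auto intro!: l1norm_parent simp: free_V_def)
  ultimately show "v = w" by auto
qed

section \<open>The Gibbs measure\<close>

text \<open>Real-valued version of the extended weight, so that the comparison of densities can use
  real squares, products and exponentials.\<close>

definition edge_weight :: "(real \<Rightarrow> ereal) \<Rightarrow> real \<Rightarrow> real" where
  "edge_weight U x = enn2real (boltz U x)"

definition gradient :: "(vertex \<Rightarrow> real) \<Rightarrow> vertex \<times> vertex \<Rightarrow> real" where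
  "gradient \<psi> e = field \<psi> (fst e) - field \<psi> (snd e)"

definition total_weight :: "nat \<Rightarrow> (real \<Rightarrow> ereal) \<Rightarrow> (vertex \<Rightarrow> real) \<Rightarrow> real" where
  "total_weight n U \<psi> = (\<Prod>e\<in>torus_E n. edge_weight U (gradient \<psi> e))"

definition gibbs_density :: "nat \<Rightarrow> (real \<Rightarrow> ereal) \<Rightarrow> (vertex \<Rightarrow> real) \<Rightarrow> real" where
  "gibbs_density n U \<psi> = total_weight n U \<psi> / enn2real (partition_fn n U)"

lemma boltz_eq_edge_weight: "boltz U x = ennreal (edge_weight U x)"
  by (simp add: edge_weight_def boltz_def)

lemma edge_weight_nonneg: "0 \<le> edge_weight U x"
  by (simp add: edge_weight_def)

lemma total_weight_nonneg: "0 \<le> total_weight n U \<psi>"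
  unfolding total_weight_def by (intro prod_nonneg) (simp add: edge_weight_nonneg)

lemma gibbs_weight_eq: "gibbs_weight n U \<psi> = ennreal (total_weight n U \<psi>)"
  unfolding gibbs_weight_def total_weight_def gradient_def
  by (simp add: boltz_eq_edge_weight case_prod_unfold prod_ennreal edge_weight_nonneg)

section \<open>Measurability and translations of the pinned field\<close>

lemma measurable_field [measurable]:
  assumes "v \<in> torus_V n"
  shows "(\<lambda>\<psi>. field \<psi> v) \<in> borel_measurable (ref_measure n)"
proof (cases "v = (0, 0)")
  case False
  then have "v \<in> free_V n" using assms by (simp add: free_V_def)
  then have "(\<lambda>\<psi>. \<psi> v) \<in> measurable (ref_measure n) lborel"
    unfolding ref_measure_def by (rule measurable_component_singleton)
  then show ?thesis using False by (simp add: field_def)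
qed (simp add: field_def)

lemma measurable_gradient [measurable]:
  "e \<in> torus_E n \<Longrightarrow> (\<lambda>\<psi>. gradient \<psi> e) \<in> borel_measurable (ref_measure n)"
  unfolding gradient_def using torus_E_subset[of n] by (intro borel_measurable_diff measurable_field) auto

definition translate :: "nat \<Rightarrow> (vertex \<Rightarrow> real) \<Rightarrow> (vertex \<Rightarrow> real) \<Rightarrow> vertex \<Rightarrow> real" where
  "translate n s \<psi> = (\<lambda>v\<in>free_V n. s v + \<psi> v)"

lemma field_translate: "v \<in> torus_V n \<Longrightarrow> s (0, 0) = 0 \<Longrightarrow> field (translate n s \<psi>) v = field \<psi> v + s v"
  by (simp add: field_def translate_def free_V_def)

lemma gradient_translate:
  assumes "e \<in> torus_E n" "s (0, 0) = 0"
  shows "gradient (translate n s \<psi>) e = gradient \<psi> e + (s (fst e) - s (snd e))"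
  using assms torus_E_subset[of n] by (cases e) (auto simp: gradient_def field_translate)

lemma measurable_translate [measurable]: "translate n s \<in> measurable (ref_measure n) (ref_measure n)"
  unfolding translate_def ref_measure_def by measurable

lemma nn_integral_translate:
  "F \<in> borel_measurable (ref_measure n) \<Longrightarrow>
    (\<integral>\<^sup>+\<psi>. F (translate n s \<psi>) \<partial>ref_measure n) = (\<integral>\<^sup>+\<psi>. F \<psi> \<partial>ref_measure n)"
  unfolding translate_def ref_measure_def by (intro nn_integral_PiM_translate finite_free_V)

text \<open>A vertex of largest norm is nobody's parent, so it occurs in a single factor and
  integrating it out yields the integral of \<open>b\<close> by translation invariance. Closure of
  \<open>F\<close> under \<open>parent\<close> survives its removal.\<close>

lemma nn_integral_tree_weight:
  fixes b :: "real \<Rightarrow> ennreal"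
  assumes [measurable]: "b \<in> borel_measurable borel"
    and "finite F" "(0, 0) \<notin> F" "\<And>v. v \<in> F \<Longrightarrow> parent v \<in> insert (0, 0) F"
  shows "(\<integral>\<^sup>+\<psi>. (\<Prod>v\<in>F. b (field \<psi> v - field \<psi> (parent v))) \<partial>PiM F (\<lambda>_. lborel)) = (\<integral>\<^sup>+x. b x \<partial>lborel) ^ card F"
  using assms(2-)
proof (induction "card F" arbitrary: F)
  case 0
  then have "F = {}" by simp
  then show ?case by (simp add: PiM_empty nn_integral_count_space_finite)
next
  case (Suc k)
  interpret product_sigma_finite "\<lambda>_::vertex. lborel :: real measure" by standard
  have ne: "F \<noteq> {}" "finite F" using Suc by auto
  define N where "N = Max (l1norm ` F)"
  have "N \<in> l1norm ` F" unfolding N_def using ne by (intro Max_in) auto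
  then obtain i where i: "i \<in> F" "l1norm i = N" by auto
  have max: "l1norm v \<le> l1norm i" if "v \<in> F" for v unfolding i(2) N_def using that ne by simp
  define H where "H = F - {i}"
  have H: "F = insert i H" "i \<notin> H" "finite H" using i ne by (auto simp: H_def)
  have i0: "i \<noteq> (0, 0)" using Suc.prems i by auto
  have parent_ne: "parent v \<noteq> i" if "v \<in> F" for v
  proof
    assume "parent v = i"
    moreover have "v \<noteq> (0, 0)" using that Suc.prems(2) by blast
    ultimately show False using l1norm_parent[of v] max[OF that] by simp
  qed
  have closed: "parent v \<in> insert (0, 0) H" if "v \<in> F" for v
    using Suc.prems(3)[OF that] parent_ne[OF that] by (auto simp: H_def)
  have m: "(\<lambda>\<psi>. field \<psi> v) \<in> borel_measurable (PiM G (\<lambda>_. lborel))" if "v \<in> insert (0, 0) G" for v and G :: "vertex set"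
  proof (cases "v = (0, 0)")
    case False
    then have "(\<lambda>\<psi>. \<psi> v) \<in> measurable (PiM G (\<lambda>_. lborel)) (lborel :: real measure)"
      using that by (intro measurable_component_singleton) auto
    then show ?thesis using False by (simp add: field_def)
  qed (simp add: field_def)
  have mF [measurable]: "(\<lambda>\<psi>. \<Prod>v\<in>F. b (field \<psi> v - field \<psi> (parent v))) \<in> borel_measurable (PiM F (\<lambda>_. lborel))"
    using Suc.prems
    by (intro borel_measurable_prod_ennreal measurable_compose[OF borel_measurable_diff assms(1)] m) auto
  have mH [measurable]: "(\<lambda>\<psi>. \<Prod>v\<in>H. b (field \<psi> v - field \<psi> (parent v))) \<in> borel_measurable (PiM H (\<lambda>_. lborel))"
    using closed H(1)
    by (intro borel_measurable_prod_ennreal measurable_compose[OF borel_measurable_diff assms(1)] m) auto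
  have split: "(\<Prod>v\<in>F. b (field (\<psi>(i := y)) v - field (\<psi>(i := y)) (parent v)))
      = b (y - field \<psi> (parent i)) * (\<Prod>v\<in>H. b (field \<psi> v - field \<psi> (parent v)))" for \<psi> y
  proof -
    have f: "field (\<psi>(i := y)) v = field \<psi> v" if "v \<noteq> i" for v using that by (simp add: field_def)
    have "(\<Prod>v\<in>H. b (field (\<psi>(i := y)) v - field (\<psi>(i := y)) (parent v))) = (\<Prod>v\<in>H. b (field \<psi> v - field \<psi> (parent v)))"
    proof (intro prod.cong refl)
      fix v assume v: "v \<in> H"
      then have "v \<noteq> i" "parent v \<noteq> i" using parent_ne[of v] H(1,2) by blast+
      then show "b (field (\<psi>(i := y)) v - field (\<psi>(i := y)) (parent v)) = b (field \<psi> v - field \<psi> (parent v))"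
        by (simp add: f)
    qed
    moreover have "field (\<psi>(i := y)) i = y" using i0 by (simp add: field_def)
    ultimately show ?thesis using H parent_ne[OF i(1)] by (simp add: f)
  qed
  have shift: "(\<integral>\<^sup>+y. b (y - t) \<partial>lborel) = (\<integral>\<^sup>+x. b x \<partial>lborel)" for t
    using nn_integral_real_affine[of b 1 "- t"] by simp
  have "(\<integral>\<^sup>+\<psi>. (\<Prod>v\<in>F. b (field \<psi> v - field \<psi> (parent v))) \<partial>PiM F (\<lambda>_. lborel))
    = (\<integral>\<^sup>+\<psi>. (\<integral>\<^sup>+y. (\<Prod>v\<in>F. b (field (\<psi>(i := y)) v - field (\<psi>(i := y)) (parent v))) \<partial>lborel) \<partial>PiM H (\<lambda>_. lborel))"
    using mF unfolding H(1) by (intro product_nn_integral_insert H) auto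
  also have "\<dots> = (\<integral>\<^sup>+\<psi>. (\<integral>\<^sup>+x. b x \<partial>lborel) * (\<Prod>v\<in>H. b (field \<psi> v - field \<psi> (parent v))) \<partial>PiM H (\<lambda>_. lborel))"
    unfolding split by (subst nn_integral_multc) (simp_all add: shift)
  also have "\<dots> = (\<integral>\<^sup>+x. b x \<partial>lborel) * (\<integral>\<^sup>+\<psi>. (\<Prod>v\<in>H. b (field \<psi> v - field \<psi> (parent v))) \<partial>PiM H (\<lambda>_. lborel))"
    by (rule nn_integral_cmult) measurable
  also have "(\<integral>\<^sup>+\<psi>. (\<Prod>v\<in>H. b (field \<psi> v - field \<psi> (parent v))) \<partial>PiM H (\<lambda>_. lborel)) = (\<integral>\<^sup>+x. b x \<partial>lborel) ^ card H"
    using Suc.hyps(2) Suc.prems H closed by (intro Suc.hyps(1)) auto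
  finally show ?case using H by simp
qed

locale surface_potential =
  fixes U :: "real \<Rightarrow> ereal" and M :: real
  assumes U_measurable [measurable]: "U \<in> borel_measurable borel"
    and U_symmetric: "U (- x) = U x"
    and U_ge: "ereal M \<le> U x"
    and boltz_integrable: "(\<integral>\<^sup>+ x. boltz U x \<partial>lborel) < \<infinity>"
    and U_smooth: "C2_on_unit U"
begin

abbreviation "b \<equiv> edge_weight U"

lemma measurable_boltz [measurable]: "boltz U \<in> borel_measurable borel"
  unfolding boltz_def by measurable

lemma measurable_edge_weight [measurable]: "b \<in> borel_measurable borel"
  unfolding edge_weight_def by measurable

lemma edge_weight_minus: "b (- x) = b x"
  by (simp add: edge_weight_def boltz_def U_symmetric)

lemma edge_weight_le: "b x \<le> exp (- M)"
proof (cases "U x = \<infinity>")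
  case False
  then obtain r where r: "U x = ereal r" using U_ge[of x] by (cases "U x") auto
  then show ?thesis using U_ge[of x] by (simp add: edge_weight_def boltz_def)
qed (simp add: edge_weight_def boltz_def)

lemma edge_weight_eq_exp: "\<bar>x\<bar> \<le> 1 \<Longrightarrow> b x = exp (- real_of_ereal (U x))"
proof -
  assume "\<bar>x\<bar> \<le> 1"
  then have "\<bar>U x\<bar> \<noteq> \<infinity>" using U_smooth by (simp add: C2_on_unit_def abs_le_iff)
  then show ?thesis by (auto simp: edge_weight_def boltz_def)
qed

lemma second_difference:
  obtains Q where "Q \<ge> 0" "\<And>x d. \<bar>x\<bar> + \<bar>d\<bar> < 1 \<Longrightarrow> (b x)\<^sup>2 \<le> exp (Q * d\<^sup>2) * (b (x + d) * b (x - d))"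
proof -
  let ?u = "\<lambda>x. real_of_ereal (U x)"
  obtain u1 u2 where u: "\<And>x. x \<in> {-1..1} \<Longrightarrow> (?u has_real_derivative u1 x) (at x within {-1..1})"
    "\<And>x. x \<in> {-1..1} \<Longrightarrow> (u1 has_real_derivative u2 x) (at x within {-1..1})" "continuous_on {-1..1} u2"
    using U_smooth unfolding C2_on_unit_def by blast
  have "compact (u2 ` {-1..1})" using u(3) by (intro compact_continuous_image) auto
  then obtain Q0 where Q0: "\<And>x. x \<in> {-1..1} \<Longrightarrow> \<bar>u2 x\<bar> \<le> Q0"
    using compact_imp_bounded bounded_real by (metis (no_types, lifting) imageI)
  have Q: "0 \<le> Q0" using Q0[of 0] by auto
  show ?thesis
  proof (rule that[OF Q])
    fix x d :: real assume xd: "\<bar>x\<bar> + \<bar>d\<bar> < 1"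
    have "?u (x + d) + ?u (x - d) - 2 * ?u x \<le> Q0 * d\<^sup>2"
      using Q0 xd by (intro second_difference_bound[OF u(1,2)]) (auto simp: abs_le_iff)
    then have "exp (- (2 * ?u x)) \<le> exp (Q0 * d\<^sup>2 + (- ?u (x + d) - ?u (x - d)))" by simp
    then show "(b x)\<^sup>2 \<le> exp (Q0 * d\<^sup>2) * (b (x + d) * b (x - d))"
      using xd by (simp add: edge_weight_eq_exp exp_add[symmetric] exp_double[symmetric])
  qed
qed

lemma edge_weight_lower_bound:
  obtains \<beta> where "\<beta> > 0" "\<And>x. \<bar>x\<bar> \<le> 1 \<Longrightarrow> \<beta> \<le> b x"
proof -
  let ?u = "\<lambda>x. real_of_ereal (U x)"
  obtain u1 where "\<And>x. x \<in> {-1..1} \<Longrightarrow> (?u has_real_derivative u1 x) (at x within {-1..1})"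
    using U_smooth unfolding C2_on_unit_def by blast
  then have "continuous_on {-1..1} ?u" by (rule DERIV_continuous_on)
  then have "compact (?u ` {-1..1})" by (intro compact_continuous_image) auto
  then obtain B where B: "\<And>x. x \<in> {-1..1} \<Longrightarrow> \<bar>?u x\<bar> \<le> B"
    using compact_imp_bounded bounded_real by (metis (no_types, lifting) imageI)
  show ?thesis
  proof (rule that[of "exp (- B)"])
    fix x :: real assume x: "\<bar>x\<bar> \<le> 1"
    then have "?u x \<le> B" using abs_le_D1[OF B[of x]] by (simp add: abs_le_iff)
    then show "exp (- B) \<le> b x" using x by (simp add: edge_weight_eq_exp)
  qed simp
qed

section \<open>Partition function and density\<close>

lemma measurable_total_weight [measurable]: "total_weight n U \<in> borel_measurable (ref_measure n)"
  unfolding total_weight_def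
  by (intro borel_measurable_prod measurable_compose[OF measurable_gradient measurable_edge_weight])

lemma partition_fn_eq: "partition_fn n U = (\<integral>\<^sup>+\<psi>. ennreal (total_weight n U \<psi>) \<partial>ref_measure n)"
  by (simp add: partition_fn_def gibbs_weight_eq)

text \<open>Edges off the spanning tree are bounded by \<open>exp (- M)\<close>, using that the
  potential is bounded below; the remaining product over tree edges integrates exactly.\<close>

lemma partition_fn_finite: "partition_fn n U < \<infinity>"
proof -
  define T where "T = tree_edge ` free_V n"
  have T: "T \<subseteq> torus_E n" using tree_edge_in_torus_E by (auto simp: T_def)
  define K where "K = exp (- M) ^ card (torus_E n - T)"
  have le: "total_weight n U \<psi> \<le> K * (\<Prod>v\<in>free_V n. b (field \<psi> v - field \<psi> (parent v)))" for \<psi>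
  proof -
    have "total_weight n U \<psi> = (\<Prod>e\<in>torus_E n - T. b (gradient \<psi> e)) * (\<Prod>e\<in>T. b (gradient \<psi> e))"
      unfolding total_weight_def by (rule prod.subset_diff[OF T finite_torus_E])
    also have "\<dots> \<le> K * (\<Prod>e\<in>T. b (gradient \<psi> e))"
    proof (rule mult_right_mono)
      have "(\<Prod>e\<in>torus_E n - T. b (gradient \<psi> e)) \<le> (\<Prod>e\<in>torus_E n - T. exp (- M))"
        by (intro prod_mono) (auto simp: edge_weight_nonneg edge_weight_le)
      then show "(\<Prod>e\<in>torus_E n - T. b (gradient \<psi> e)) \<le> K" by (simp add: K_def)
    qed (intro prod_nonneg, simp add: edge_weight_nonneg)
    also have "(\<Prod>e\<in>T. b (gradient \<psi> e)) = (\<Prod>v\<in>free_V n. b (gradient \<psi> (tree_edge v)))"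
      unfolding T_def by (subst prod.reindex[OF inj_on_tree_edge]) simp
    also have "\<dots> = (\<Prod>v\<in>free_V n. b (field \<psi> v - field \<psi> (parent v)))"
    proof (intro prod.cong refl)
      fix v
      show "b (gradient \<psi> (tree_edge v)) = b (field \<psi> v - field \<psi> (parent v))"
        using edge_weight_minus[of "field \<psi> v - field \<psi> (parent v)"]
        by (simp add: tree_edge_def gradient_def)
    qed
    finally show ?thesis .
  qed
  have "partition_fn n U \<le> (\<integral>\<^sup>+\<psi>. ennreal K * (\<Prod>v\<in>free_V n. boltz U (field \<psi> v - field \<psi> (parent v))) \<partial>ref_measure n)"
    unfolding partition_fn_eq
  proof (intro nn_integral_mono)
    fix \<psi>
    have "ennreal (total_weight n U \<psi>) \<le> ennreal (K * (\<Prod>v\<in>free_V n. b (field \<psi> v - field \<psi> (parent v))))"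
      using le by (rule ennreal_leI)
    also have "\<dots> = ennreal K * (\<Prod>v\<in>free_V n. boltz U (field \<psi> v - field \<psi> (parent v)))"
      by (simp add: boltz_eq_edge_weight prod_ennreal edge_weight_nonneg ennreal_mult K_def prod_nonneg)
    finally show "ennreal (total_weight n U \<psi>) \<le> ennreal K * (\<Prod>v\<in>free_V n. boltz U (field \<psi> v - field \<psi> (parent v)))" .
  qed
  also have "\<dots> = ennreal K * (\<integral>\<^sup>+\<psi>. (\<Prod>v\<in>free_V n. boltz U (field \<psi> v - field \<psi> (parent v))) \<partial>ref_measure n)"
    using parent_in_torus
    by (intro nn_integral_cmult borel_measurable_prod_ennreal
        measurable_compose[OF borel_measurable_diff measurable_boltz] measurable_field) (auto simp: free_V_def)
  also have "(\<integral>\<^sup>+\<psi>. (\<Prod>v\<in>free_V n. boltz U (field \<psi> v - field \<psi> (parent v))) \<partial>ref_measure n)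
      = (\<integral>\<^sup>+x. boltz U x \<partial>lborel) ^ card (free_V n)"
    unfolding ref_measure_def using parent_in_torus
    by (intro nn_integral_tree_weight finite_free_V) (auto simp: free_V_def)
  also have "ennreal K * \<dots> < \<infinity>"
    using boltz_integrable by (simp add: ennreal_mult_less_top power_less_top_ennreal)
  finally show ?thesis .
qed

text \<open>Heights are placed in intervals of length \<open>1 - \<rho>\<close> above the cone of
  slope \<open>\<rho>\<close>. Neighbours then differ by at most
  \<open>\<rho> + (1 - \<rho>) = 1\<close>, where the edge weight is bounded away from 0. The value
  \<open>\<rho> = 0\<close> yields positivity of the partition function; larger slopes serve the
  tail close to the origin.\<close>

lemma steep_weight_positive:
  assumes "0 \<le> \<rho>" "\<rho> < 1"
  shows "0 < (\<integral>\<^sup>+\<psi>. ennreal (total_weight n U \<psi>) * indicator {\<psi> \<in> space (ref_measure n). \<forall>v\<in>torus_V n. \<rho> * l1norm v \<le> field \<psi> v} \<psi> \<partial>ref_measure n)"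
proof -
  obtain \<beta> where \<beta>: "\<beta> > 0" "\<And>x. \<bar>x\<bar> \<le> 1 \<Longrightarrow> \<beta> \<le> b x" using edge_weight_lower_bound by blast
  interpret product_sigma_finite "\<lambda>_::vertex. lborel :: real measure" by standard
  define A where "A = Pi\<^sub>E (free_V n) (\<lambda>w. {\<rho> * l1norm w..\<rho> * l1norm w + (1 - \<rho>)})"
  have A: "A \<in> sets (ref_measure n)"
    unfolding A_def ref_measure_def by (intro sets_PiM_I_finite finite_free_V) auto
  have sub: "field \<psi> v \<in> {\<rho> * l1norm v..\<rho> * l1norm v + (1 - \<rho>)}" if "\<psi> \<in> A" "v \<in> torus_V n" for \<psi> v
  proof (cases "v = (0, 0)")
    case True
    then show ?thesis using assms by (simp add: field_def l1norm_def)
  next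
    case False
    then show ?thesis using that by (auto simp: A_def field_def free_V_def dest!: PiE_mem)
  qed
  have W: "\<beta> ^ card (torus_E n) \<le> total_weight n U \<psi>" if "\<psi> \<in> A" for \<psi>
  proof -
    have "(\<Prod>e\<in>torus_E n. \<beta>) \<le> total_weight n U \<psi>"
      unfolding total_weight_def
    proof (intro prod_mono conjI)
      fix e assume e: "e \<in> torus_E n"
      have "fst e \<in> torus_V n" "snd e \<in> torus_V n" using e torus_E_subset[of n] by auto
      note s = sub[OF that this(1)] sub[OF that this(2)]
      have "\<bar>\<rho> * (l1norm (fst e) - l1norm (snd e))\<bar> \<le> \<rho> * 1"
        using l1norm_edge[OF e] assms unfolding abs_mult by (intro mult_mono) auto
      then have "\<bar>gradient \<psi> e\<bar> \<le> 1"
        using s by (simp add: gradient_def right_diff_distrib abs_le_iff)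
      then show "\<beta> \<le> b (gradient \<psi> e)" by (rule \<beta>)
    qed (use \<beta> in auto)
    then show ?thesis by simp
  qed
  have "emeasure (ref_measure n) A = (\<Prod>w\<in>free_V n. ennreal (1 - \<rho>))"
    unfolding A_def ref_measure_def using assms by (subst emeasure_PiM[OF finite_free_V]) auto
  also have "\<dots> = ennreal ((1 - \<rho>) ^ card (free_V n))" using assms by (simp add: ennreal_power)
  finally have "0 < ennreal (\<beta> ^ card (torus_E n)) * emeasure (ref_measure n) A"
    using assms \<beta> by (simp add: ennreal_zero_less_mult_iff)
  also have "\<dots> = (\<integral>\<^sup>+\<psi>. ennreal (\<beta> ^ card (torus_E n)) * indicator A \<psi> \<partial>ref_measure n)"
    using A by (simp add: nn_integral_cmult_indicator)
  also have "\<dots> \<le> (\<integral>\<^sup>+\<psi>. ennreal (total_weight n U \<psi>) * indicator {\<psi> \<in> space (ref_measure n). \<forall>v\<in>torus_V n. \<rho> * l1norm v \<le> field \<psi> v} \<psi> \<partial>ref_measure n)"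
    using W sub sets.sets_into_space[OF A] by (intro nn_integral_mono) (auto simp: indicator_def ennreal_leI)
  finally show ?thesis .
qed

lemma partition_fn_positive: "0 < partition_fn n U"
proof -
  note steep_weight_positive[of 0 n]
  also have "(\<integral>\<^sup>+\<psi>. ennreal (total_weight n U \<psi>) * indicator {\<psi> \<in> space (ref_measure n). \<forall>v\<in>torus_V n. 0 * l1norm v \<le> field \<psi> v} \<psi> \<partial>ref_measure n)
     \<le> partition_fn n U"
    unfolding partition_fn_eq by (intro nn_integral_mono) (simp add: indicator_def)
  finally show ?thesis by simp
qed

lemma gibbs_density_nonneg: "0 \<le> gibbs_density n U \<psi>"
  by (simp add: gibbs_density_def total_weight_nonneg)

lemma measurable_gibbs_density [measurable]: "gibbs_density n U \<in> borel_measurable (ref_measure n)"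
  unfolding gibbs_density_def by measurable

lemma gibbs_eq: "gibbs n U = density (ref_measure n) (\<lambda>\<psi>. ennreal (gibbs_density n U \<psi>))"
proof -
  have "partition_fn n U = ennreal (enn2real (partition_fn n U))" "0 < enn2real (partition_fn n U)"
    using partition_fn_finite[of n] partition_fn_positive[of n]
    by (simp_all add: enn2real_positive_iff)
  then have "gibbs_weight n U \<psi> / partition_fn n U = ennreal (gibbs_density n U \<psi>)" for \<psi>
    by (metis divide_ennreal gibbs_density_def gibbs_weight_eq total_weight_nonneg)
  then show ?thesis by (simp add: gibbs_def)
qed

lemma space_gibbs [simp]: "space (gibbs n U) = space (ref_measure n)"
  and sets_gibbs [measurable_cong, simp]: "sets (gibbs n U) = sets (ref_measure n)"
  by (simp_all add: gibbs_eq)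

lemma nn_integral_gibbs:
  "F \<in> borel_measurable (ref_measure n) \<Longrightarrow>
    (\<integral>\<^sup>+\<psi>. F \<psi> \<partial>gibbs n U) = (\<integral>\<^sup>+\<psi>. ennreal (gibbs_density n U \<psi>) * F \<psi> \<partial>ref_measure n)"
  unfolding gibbs_eq by (rule nn_integral_density) measurable

lemma nn_integral_gibbs_density: 
  assumes [measurable]: "F \<in> borel_measurable (ref_measure n)"
  shows "(\<integral>\<^sup>+\<psi>. ennreal (total_weight n U \<psi>) * F \<psi> \<partial>ref_measure n)
    = partition_fn n U * (\<integral>\<^sup>+\<psi>. F \<psi> \<partial>gibbs n U)"
proof -
  have Z: "partition_fn n U = ennreal (enn2real (partition_fn n U))" "0 < enn2real (partition_fn n U)"
    using partition_fn_finite[of n] partition_fn_positive[of n]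
    by (simp_all add: enn2real_positive_iff)
  have "partition_fn n U * ennreal (gibbs_density n U \<psi>) = ennreal (total_weight n U \<psi>)" for \<psi>
    using Z(2) by (subst Z(1)) (simp add: ennreal_mult'[symmetric] gibbs_density_def)
  then have "(\<integral>\<^sup>+\<psi>. ennreal (total_weight n U \<psi>) * F \<psi> \<partial>ref_measure n)
    = (\<integral>\<^sup>+\<psi>. partition_fn n U * (ennreal (gibbs_density n U \<psi>) * F \<psi>) \<partial>ref_measure n)"
    by (simp add: mult.assoc[symmetric])
  also have "\<dots> = partition_fn n U * (\<integral>\<^sup>+\<psi>. F \<psi> \<partial>gibbs n U)"
    by (subst nn_integral_cmult) (simp_all add: nn_integral_gibbs)
  finally show ?thesis .
qed

lemma prob_space_gibbs: "prob_space (gibbs n U)"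
proof
  have "partition_fn n U * 1 = partition_fn n U * emeasure (gibbs n U) (space (gibbs n U))"
    using nn_integral_gibbs_density[of "\<lambda>_. 1" n] by (simp add: partition_fn_eq)
  then show "emeasure (gibbs n U) (space (gibbs n U)) = 1"
    using partition_fn_finite[of n] partition_fn_positive[of n]
    by (metis ennreal_mult_cancel_left infinity_ennreal_def less_irrefl)
qed

section \<open>Consequences of steep configurations and of the reflection symmetry\<close>

lemma steep_event_positive:
  assumes "0 \<le> \<rho>" "\<rho> < 1" and v: "v \<in> torus_V n"
  shows "0 < measure (gibbs n U) {\<psi> \<in> space (gibbs n U). \<rho> * l1norm v \<le> field \<psi> v}"
proof -
  interpret prob_space "gibbs n U" by (rule prob_space_gibbs)
  define A where "A = {\<psi> \<in> space (gibbs n U). \<rho> * l1norm v \<le> field \<psi> v}"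
  have [measurable]: "A \<in> sets (ref_measure n)" unfolding A_def space_gibbs using v by measurable
  note steep_weight_positive[OF assms(1,2), of n]
  also have "(\<integral>\<^sup>+\<psi>. ennreal (total_weight n U \<psi>) * indicator {\<psi> \<in> space (ref_measure n). \<forall>v\<in>torus_V n. \<rho> * l1norm v \<le> field \<psi> v} \<psi> \<partial>ref_measure n)
    \<le> (\<integral>\<^sup>+\<psi>. ennreal (total_weight n U \<psi>) * indicator A \<psi> \<partial>ref_measure n)"
    using v by (intro nn_integral_mono) (auto simp: A_def indicator_def)
  also have "\<dots> = partition_fn n U * emeasure (gibbs n U) A"
    by (subst nn_integral_gibbs_density) simp_all
  finally have "emeasure (gibbs n U) A \<noteq> 0" by auto
  then show ?thesis unfolding A_def[symmetric] by (simp add: emeasure_eq_measure zero_less_measure_iff)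
qed

text \<open>Negating all free coordinates preserves Lebesgue measure, every edge weight and the
  pinning at the origin.\<close>

lemma gibbs_field_symmetric:
  assumes v: "v \<in> torus_V n"
  shows "distr (gibbs n U) borel (\<lambda>\<psi>. - field \<psi> v) = distr (gibbs n U) borel (\<lambda>\<psi>. field \<psi> v)"
proof -
  let ?R = "ref_measure n"
  define T where "T \<psi> = (\<lambda>v\<in>free_V n. - \<psi> v)" for \<psi> :: "vertex \<Rightarrow> real"
  have [measurable]: "T \<in> measurable ?R ?R" unfolding T_def ref_measure_def by measurable
  have TR: "distr ?R ?R T = ?R"
    unfolding T_def ref_measure_def
    by (rule distr_PiM_coordinatewise[OF finite_free_V]) (auto simp: lborel_distr_uminus)
  have f: "field (T \<psi>) w = - field \<psi> w" if "w \<in> torus_V n" for w \<psi>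
    using that by (simp add: T_def field_def free_V_def)
  have "total_weight n U (T \<psi>) = total_weight n U \<psi>" for \<psi>
    unfolding total_weight_def
  proof (intro prod.cong refl)
    fix e assume "e \<in> torus_E n"
    then have "gradient (T \<psi>) e = - gradient \<psi> e"
      using torus_E_subset[of n] by (cases e) (auto simp: gradient_def f)
    then show "b (gradient (T \<psi>) e) = b (gradient \<psi> e)" by (simp add: edge_weight_minus)
  qed
  then have d: "gibbs_density n U (T \<psi>) = gibbs_density n U \<psi>" for \<psi> by (simp add: gibbs_density_def)
  note [measurable] = measurable_field[OF v]
  show ?thesis
  proof (rule measure_eqI)
    fix A :: "real set" assume "A \<in> sets (distr (gibbs n U) borel (\<lambda>\<psi>. - field \<psi> v))"
    then have A [measurable]: "A \<in> sets borel" by simp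
    have "emeasure (distr (gibbs n U) borel (\<lambda>\<psi>. - field \<psi> v)) A = (\<integral>\<^sup>+x. indicator A x \<partial>distr (gibbs n U) borel (\<lambda>\<psi>. - field \<psi> v))"
      by simp
    also have "\<dots> = (\<integral>\<^sup>+\<psi>. indicator A (- field \<psi> v) \<partial>gibbs n U)" by (subst nn_integral_distr) auto
    also have "\<dots> = (\<integral>\<^sup>+\<psi>. ennreal (gibbs_density n U \<psi>) * indicator A (- field \<psi> v) \<partial>?R)"
      by (subst nn_integral_gibbs) auto
    also have "\<dots> = (\<integral>\<^sup>+\<psi>. ennreal (gibbs_density n U (T \<psi>)) * indicator A (field (T \<psi>) v) \<partial>?R)"
      using v by (simp add: f d)
    also have "\<dots> = (\<integral>\<^sup>+\<psi>. ennreal (gibbs_density n U \<psi>) * indicator A (field \<psi> v) \<partial>distr ?R ?R T)"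
      by (subst nn_integral_distr) auto
    also have "\<dots> = (\<integral>\<^sup>+\<psi>. indicator A (field \<psi> v) \<partial>gibbs n U)"
      unfolding TR by (subst nn_integral_gibbs) auto
    also have "\<dots> = (\<integral>\<^sup>+x. indicator A x \<partial>distr (gibbs n U) borel (\<lambda>\<psi>. field \<psi> v))" by (subst nn_integral_distr) auto
    also have "\<dots> = emeasure (distr (gibbs n U) borel (\<lambda>\<psi>. field \<psi> v)) A" by simp
    finally show "emeasure (distr (gibbs n U) borel (\<lambda>\<psi>. - field \<psi> v)) A = emeasure (distr (gibbs n U) borel (\<lambda>\<psi>. field \<psi> v)) A" .
  qed simp
qed

lemma gibbs_half:
  assumes v: "v \<in> torus_V n"
  shows "1 / 2 \<le> measure (gibbs n U) {\<psi> \<in> space (gibbs n U). 0 \<le> field \<psi> v}"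
proof -
  interpret prob_space "gibbs n U" by (rule prob_space_gibbs)
  note [measurable] = measurable_field[OF v]
  let ?A = "{\<psi> \<in> space (gibbs n U). 0 \<le> field \<psi> v}" and ?B = "{\<psi> \<in> space (gibbs n U). 0 \<le> - field \<psi> v}"
  have [measurable]: "?A \<in> sets (gibbs n U)" "?B \<in> sets (gibbs n U)" by measurable
  have "prob ?A = measure (distr (gibbs n U) borel (\<lambda>\<psi>. field \<psi> v)) {0..}"
    by (subst measure_distr) (auto intro!: arg_cong[of _ _ prob])
  also have "\<dots> = measure (distr (gibbs n U) borel (\<lambda>\<psi>. - field \<psi> v)) {0..}"
    by (simp add: gibbs_field_symmetric[OF v])
  also have "\<dots> = prob ?B" by (subst measure_distr) (auto intro!: arg_cong[of _ _ prob])
  finally have "prob ?A = prob ?B" .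
  moreover have "?A \<union> ?B = space (gibbs n U)" by auto
  then have "1 \<le> prob ?A + prob ?B" using measure_Un_le[of ?A "gibbs n U" ?B] prob_space by simp
  ultimately show ?thesis by simp
qed

text \<open>By symmetry the mean is zero, and the claim becomes Chebyshev's inequality; without
  integrability the extended variance is infinite.\<close>

lemma ext_variance_ge:
  assumes v: "v \<in> torus_V n" and h: "0 \<le> h"
  shows "ennreal (h\<^sup>2 * measure (gibbs n U) {\<psi> \<in> space (gibbs n U). h \<le> \<bar>field \<psi> v\<bar>})
    \<le> ext_variance (gibbs n U) (\<lambda>\<psi>. field \<psi> v)"
proof (cases "integrable (gibbs n U) (\<lambda>\<psi>. field \<psi> v)")
  case True
  interpret prob_space "gibbs n U" by (rule prob_space_gibbs)
  note [measurable] = measurable_field[OF v]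
  have "(\<integral>\<psi>. field \<psi> v \<partial>gibbs n U) = (\<integral>x. x \<partial>distr (gibbs n U) borel (\<lambda>\<psi>. field \<psi> v))"
    by (subst integral_distr) auto
  also have "\<dots> = (\<integral>\<psi>. - field \<psi> v \<partial>gibbs n U)"
    unfolding gibbs_field_symmetric[OF v, symmetric] by (subst integral_distr) auto
  finally have 0: "(\<integral>\<psi>. field \<psi> v \<partial>gibbs n U) = 0" by simp
  let ?A = "{\<psi> \<in> space (gibbs n U). h \<le> \<bar>field \<psi> v\<bar>}"
  have A [measurable]: "?A \<in> sets (gibbs n U)" by measurable
  have "ennreal (h\<^sup>2 * prob ?A) = (\<integral>\<^sup>+\<psi>. ennreal (h\<^sup>2) * indicator ?A \<psi> \<partial>gibbs n U)"
    using A by (subst nn_integral_cmult_indicator) (auto simp: emeasure_eq_measure ennreal_mult)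
  also have "\<dots> \<le> (\<integral>\<^sup>+\<psi>. ennreal ((field \<psi> v)\<^sup>2) \<partial>gibbs n U)"
  proof (intro nn_integral_mono)
    fix \<psi>
    have "h\<^sup>2 \<le> (field \<psi> v)\<^sup>2" if "h \<le> \<bar>field \<psi> v\<bar>" using power_mono[OF that h, of 2] by simp
    then show "ennreal (h\<^sup>2) * indicator ?A \<psi> \<le> ennreal ((field \<psi> v)\<^sup>2)"
      by (auto simp: indicator_def intro!: ennreal_leI)
  qed
  finally show ?thesis using True by (simp add: ext_variance_def 0)
qed (simp add: ext_variance_def)

end

section \<open>Transport along a random translation\<close>

text \<open>What is used is the bound 300, uniform in \<open>K\<close>. The polynomial
  \<open>p\<close> solves \<open>p (K + 1) = 2 * (p K - (K + 1) ^ 4)\<close>, which makes the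
  induction exact.\<close>

lemma sum_fourth_powers_halves:
  "(\<Sum>j<K. (real j + 1) ^ 4 * (1 / 2) ^ j)
    = 300 - (2 * real K ^ 4 + 16 * real K ^ 3 + 72 * real K ^ 2 + 208 * real K + 300) * (1 / 2) ^ K"
proof (induction K)
  case (Suc K)
  have "(\<Sum>j<Suc K. (real j + 1) ^ 4 * (1 / 2) ^ j)
    = 300 - ((2 * real K ^ 4 + 16 * real K ^ 3 + 72 * real K ^ 2 + 208 * real K + 300) - (real K + 1) ^ 4) * (1 / 2) ^ K"
    by (simp add: Suc left_diff_distrib)
  also have "(2 * real K ^ 4 + 16 * real K ^ 3 + 72 * real K ^ 2 + 208 * real K + 300) - (real K + 1) ^ 4
    = (2 * real (Suc K) ^ 4 + 16 * real (Suc K) ^ 3 + 72 * real (Suc K) ^ 2 + 208 * real (Suc K) + 300) * (1 / 2)"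
    by (simp add: algebra_simps power4_eq_xxxx power3_eq_cube power2_eq_square)
  finally show ?case by (simp only: power_Suc mult.assoc)
qed simp

text \<open>The parameter \<open>l\<close> weights the two translates: a lower bound for a tail
  favours the upward one, a bound for small balls treats both alike.\<close>

lemma weighted_AM_GM:
  fixes x p q :: real
  assumes "x\<^sup>2 \<le> exp (2 * B) * (p * q)" "0 \<le> p" "0 \<le> q" "0 < l"
  shows "x \<le> exp B / 2 * (l * p + q / l)"
proof -
  define t where "t = l * p + q / l"
  have "(l * p) * (q / l) = p * q" using assms(4) by simp
  moreover have "0 \<le> (l * p - q / l)\<^sup>2" by simp
  ultimately have "4 * (p * q) \<le> t\<^sup>2" unfolding t_def using assms(4) by (simp add: power2_diff power2_sum)
  then have "exp (2 * B) * (p * q) \<le> exp (2 * B) * (t\<^sup>2 / 4)" by simp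
  also have "\<dots> = (exp B / 2 * t)\<^sup>2" by (simp add: power2_eq_square exp_double)
  finally have "x\<^sup>2 \<le> (exp B / 2 * t)\<^sup>2" using assms(1) by linarith
  moreover have "0 \<le> t" using assms by (simp add: t_def)
  ultimately have "x \<le> exp B / 2 * t" by (intro power2_le_imp_le[of x]) auto
  then show ?thesis by (simp only: t_def)
qed

text \<open>The length \<open>k + 1\<close> in \<open>\<tau>_slope\<close> is a cluster path of
  \<open>k\<close> steps plus the edge under consideration. The bounds in
  \<open>\<alpha>_small\<close> are half of what an edge tolerates, because
  \<open>edge_scale\<close> adds the values at both ends: \<open>1 / 2\<close> for the lift of the
  target and \<open>\<epsilon> / 4\<close> for the shift.\<close>

locale random_shift = surface_potential +
  fixes n :: nat and \<epsilon> Q :: real and \<tau> \<alpha> :: "vertex \<Rightarrow> real" and K :: nat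
  assumes eps: "0 < \<epsilon>" "\<epsilon> \<le> 1 / 2"
    and Q: "0 \<le> Q" "\<And>x d. \<bar>x\<bar> + \<bar>d\<bar> < 1 \<Longrightarrow> (b x)\<^sup>2 \<le> exp (Q * d\<^sup>2) * (b (x + d) * b (x - d))"
    and controlled: "controlled_gradients n U (1 / 8) (1 - \<epsilon>)"
    and \<tau>_nonneg: "\<And>v. 0 \<le> \<tau> v" and \<tau>_0: "\<tau> (0, 0) = 0"
    and \<alpha>_nonneg: "\<And>v. 0 \<le> \<alpha> v"
    and \<tau>_slope: "\<And>v u k. k < K \<Longrightarrow> \<bar>l1norm v - l1norm u\<bar> \<le> real k + 1 \<Longrightarrow> \<tau> v - \<tau> u \<le> \<alpha> v * (real k + 1)"
    and \<alpha>_small: "\<And>v. \<alpha> v \<le> 1 / 4" "\<And>v. \<alpha> v * real K \<le> \<epsilon> / 8"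
begin

abbreviation "E \<equiv> torus_E n"
abbreviation "V \<equiv> torus_V n"

definition edge_scale :: "vertex \<times> vertex \<Rightarrow> real" where
  "edge_scale e = \<alpha> (fst e) + \<alpha> (snd e)"

definition small_clusters :: "(vertex \<times> vertex) set \<Rightarrow> bool" where
  "small_clusters \<omega> \<longleftrightarrow> (\<forall>v\<in>V. \<not> has_path E \<omega> K v)"

text \<open>A surrogate for the fourth power of the cluster radius. Summing over all lengths makes
  it increasing in \<open>\<omega>\<close>, as \<open>edge_kernel_free_edge\<close> requires, and
  leaves its expectation accessible to path counting.\<close>

definition cluster_cost :: "(vertex \<times> vertex) set \<Rightarrow> vertex \<Rightarrow> real" where
  "cluster_cost \<omega> v = (\<Sum>j<K. (real j + 1) ^ 4 * of_bool (has_path E \<omega> j v))"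

definition edge_cost :: "(vertex \<times> vertex) set \<Rightarrow> vertex \<times> vertex \<Rightarrow> real" where
  "edge_cost \<omega> e = cluster_cost \<omega> (fst e) + cluster_cost \<omega> (snd e)"

definition cost_const :: real where
  "cost_const = 2 + (16 / \<epsilon>\<^sup>2 + (16 / \<epsilon>\<^sup>2)\<^sup>2) + Q"

definition free :: "(vertex \<Rightarrow> real) \<Rightarrow> vertex \<times> vertex \<Rightarrow> real" where
  "free \<psi> e = free_prob \<epsilon> (gradient \<psi> e)"

definition free_target :: "(vertex \<Rightarrow> real) \<Rightarrow> vertex \<times> vertex \<Rightarrow> real" where
  "free_target \<psi> e = free_prob_target \<epsilon> (edge_scale e) (gradient \<psi> e)"

text \<open>The exponent of \<open>transport_pointwise\<close>, collected edge by edge. A free edge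
  with \<open>free \<psi> e = 0\<close> contributes 0 by the convention on division; the kernel
  vanishes in that case.\<close>

definition loss :: "(vertex \<times> vertex) set \<Rightarrow> (vertex \<Rightarrow> real) \<Rightarrow> real" where
  "loss \<omega> \<psi> = (\<Sum>e\<in>E. if e \<in> \<omega> then 2 * (edge_scale e)\<^sup>2
     else cost_const * (edge_scale e)\<^sup>2 * (edge_cost \<omega> e / free \<psi> e))"

abbreviation "s \<equiv> cluster_min \<tau>"

lemma edge_scale_bounds: "0 \<le> edge_scale e" "edge_scale e \<le> 1 / 2" "edge_scale e * real K \<le> \<epsilon> / 4"
  using \<alpha>_nonneg[of "fst e"] \<alpha>_nonneg[of "snd e"] \<alpha>_small[of "fst e"] \<alpha>_small[of "snd e"]
  by (auto simp: edge_scale_def distrib_right)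

lemma cost_const_ge: "2 \<le> cost_const"
  using Q by (simp add: cost_const_def)

lemma free_bounds: "0 \<le> free \<psi> e" "free \<psi> e \<le> 1"
  by (simp_all add: free_def free_prob_bounds)

lemma free_target_bounds: "0 \<le> free_target \<psi> e" "free_target \<psi> e \<le> 1"
  using free_prob_target_bounds[of "edge_scale e"] edge_scale_bounds[of e] by (simp_all add: free_target_def)

lemma cluster_cost_nonneg: "0 \<le> cluster_cost \<omega> v"
  unfolding cluster_cost_def by (intro sum_nonneg) auto

lemma cluster_cost_mono: "\<omega> \<subseteq> \<omega>' \<Longrightarrow> cluster_cost \<omega> v \<le> cluster_cost \<omega>' v"
  unfolding cluster_cost_def
  by (intro sum_mono mult_left_mono) (auto simp: of_bool_def intro: has_path_mono)

lemma edge_cost_nonneg: "0 \<le> edge_cost \<omega> e"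
  by (simp add: edge_cost_def cluster_cost_nonneg)

lemma cluster_cost_ge: "k < K \<Longrightarrow> has_path E \<omega> k v \<Longrightarrow> (real k + 1) ^ 4 \<le> cluster_cost \<omega> v"
  unfolding cluster_cost_def
  using member_le_sum[of k "{..<K}" "\<lambda>j. (real j + 1) ^ 4 * of_bool (has_path E \<omega> j v)"] by simp

section \<open>Size of the shift across an edge\<close>

lemma s_0: "finite \<omega> \<Longrightarrow> s \<omega> (0, 0) = 0"
  using cluster_min_le[of \<omega> "(0, 0)" "(0, 0)" \<tau>] cluster_self[of "(0, 0)" \<omega>] \<tau>_0
    cluster_min_attained[of \<omega> "(0, 0)" \<tau>] \<tau>_nonneg by (metis antisym)

text \<open>If the minimum over the cluster of \<open>w\<close> is attained at \<open>u\<close>,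
  then \<open>s \<omega> v - s \<omega> w \<le> \<tau> v - \<tau> u\<close>. Taking minima thus
  reduces the estimate to the slope of \<open>\<tau>\<close> at \<open>v\<close> itself, and only
  the cluster of \<open>w\<close> is charged.\<close>

lemma s_difference_aux:
  assumes \<omega>: "\<omega> \<subseteq> E" "small_clusters \<omega>" and vw: "v \<in> V" "w \<in> V" "\<bar>l1norm v - l1norm w\<bar> \<le> 1"
  shows "\<exists>k<K. s \<omega> v - s \<omega> w \<le> \<alpha> v * (real k + 1) \<and> (real k + 1) ^ 4 \<le> cluster_cost \<omega> w"
proof -
  have fin: "finite \<omega>" using \<omega>(1) finite_torus_E finite_subset by blast
  obtain u where u: "u \<in> cluster \<omega> w" "s \<omega> w = \<tau> u" using cluster_min_attained[OF fin] by blast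
  have "\<not> has_path E \<omega> K w" using \<omega>(2) vw(2) by (simp add: small_clusters_def)
  then obtain k where k: "k < K" "(w, u) \<in> adj_rel \<omega> ^^ k" "has_path E \<omega> k w"
    using cluster_path[OF \<omega>(1) finite_torus_E u(1)] by blast
  have "\<bar>l1norm v - l1norm u\<bar> \<le> real k + 1" using l1norm_relpow[OF \<omega>(1) k(2)] vw(3) by linarith
  then have "\<tau> v - \<tau> u \<le> \<alpha> v * (real k + 1)" by (rule \<tau>_slope[OF k(1)])
  moreover have "s \<omega> v \<le> \<tau> v" by (rule cluster_min_le[OF fin cluster_self])
  ultimately show ?thesis using k cluster_cost_ge[OF k(1,3)] u(2) by (intro exI[of _ k]) auto
qed

lemma s_difference:
  assumes \<omega>: "\<omega> \<subseteq> E" "small_clusters \<omega>" and e: "e \<in> E"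
  shows "\<exists>k<K. \<bar>s \<omega> (fst e) - s \<omega> (snd e)\<bar> \<le> edge_scale e * (real k + 1) \<and> (real k + 1) ^ 4 \<le> edge_cost \<omega> e"
proof -
  let ?v = "fst e" and ?w = "snd e"
  have vw: "?v \<in> V" "?w \<in> V" using e torus_E_subset[of n] by auto
  have l: "\<bar>l1norm ?v - l1norm ?w\<bar> \<le> 1" "\<bar>l1norm ?w - l1norm ?v\<bar> \<le> 1"
    using l1norm_edge[OF e] by (simp_all add: abs_minus_commute)
  have sc: "\<alpha> ?v * (real k + 1) \<le> edge_scale e * (real k + 1)" "\<alpha> ?w * (real k + 1) \<le> edge_scale e * (real k + 1)" for k
    using \<alpha>_nonneg by (auto simp: edge_scale_def intro!: mult_right_mono)
  show ?thesis
  proof (cases "s \<omega> ?w \<le> s \<omega> ?v")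
    case True
    then show ?thesis
      using s_difference_aux[OF \<omega> vw l(1)] sc cluster_cost_nonneg[of \<omega> ?v] unfolding edge_cost_def
      by (smt (verit, best))
  next
    case False
    then show ?thesis
      using s_difference_aux[OF \<omega> vw(2,1) l(2)] sc cluster_cost_nonneg[of \<omega> ?w] unfolding edge_cost_def
      by (smt (verit, best))
  qed
qed

section \<open>Comparison with both translated configurations\<close>

lemma frozen_edge_pointwise:
  "(b x * (1 - free_prob \<epsilon> x))\<^sup>2 \<le> exp (2 * (2 * (edge_scale e)\<^sup>2)) *
    ((b x * (1 - free_prob_target \<epsilon> (edge_scale e) x)) * (b x * (1 - free_prob_target \<epsilon> (edge_scale e) x)))"
proof -
  have "0 \<le> b x * (1 - free_prob \<epsilon> x)" by (simp add: edge_weight_nonneg free_prob_bounds)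
  moreover have "b x * (1 - free_prob \<epsilon> x) \<le> exp (2 * (edge_scale e)\<^sup>2) * (b x * (1 - free_prob_target \<epsilon> (edge_scale e) x))"
    using mult_left_mono[OF frozen_edge_bound[OF edge_scale_bounds(1,2), of \<epsilon> x e], of "b x"]
    by (simp add: edge_weight_nonneg mult_ac)
  ultimately have "(b x * (1 - free_prob \<epsilon> x))\<^sup>2 \<le> (exp (2 * (edge_scale e)\<^sup>2) * (b x * (1 - free_prob_target \<epsilon> (edge_scale e) x)))\<^sup>2"
    by (intro power_mono)
  then show ?thesis
    unfolding power_mult_distrib[of "exp (2 * (edge_scale e)\<^sup>2)"] exp_double[symmetric] by (simp add: power2_eq_square)
qed

text \<open>Combines the second differences of the potential and of the freezing probability. An
  edge that can be free has \<open>\<bar>x\<bar> < 1 - \<epsilon> / 2\<close>, so a shift by at most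
  \<open>\<epsilon> / 4\<close> stays where the potential is smooth. The loss of the potential is
  also divided by \<open>free_prob \<epsilon> x \<le> 1\<close>, to give both losses the same
  form.\<close>

lemma free_edge_pointwise:
  assumes d: "\<bar>d\<bar> \<le> edge_scale e * (real k + 1)" and k: "k < K" and Y: "(real k + 1) ^ 4 \<le> Y"
  shows "(b x * free_prob \<epsilon> x)\<^sup>2 \<le> exp (2 * (cost_const * (edge_scale e)\<^sup>2 * (Y / free_prob \<epsilon> x))) *
    ((b (x + d) * free_prob_target \<epsilon> (edge_scale e) (x + d)) * (b (x - d) * free_prob_target \<epsilon> (edge_scale e) (x - d)))"
proof (cases "free_prob \<epsilon> x = 0")
  case True
  then show ?thesis using edge_scale_bounds[of e] free_prob_target_bounds[of "edge_scale e"] by (simp add: edge_weight_nonneg)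
next
  case False
  define a where "a = edge_scale e"
  define G where "G = free_prob \<epsilon> x"
  define P where "P = free_prob_target \<epsilon> a (x + d) * free_prob_target \<epsilon> a (x - d)"
  define C where "C = 16 / \<epsilon>\<^sup>2 + (16 / \<epsilon>\<^sup>2)\<^sup>2"
  have Y0: "0 \<le> Y" using order_trans[OF zero_le_power Y] by simp
  have G: "0 < G" "G \<le> 1" using False free_prob_bounds[of \<epsilon> x] by (auto simp: G_def)
  have a: "0 \<le> a" "a \<le> 1 / 2" using edge_scale_bounds[of e] by (auto simp: a_def)
  have P: "0 \<le> P" using a free_prob_target_bounds[of a] by (simp add: P_def)
  have "edge_scale e * (real k + 1) \<le> edge_scale e * real K" using edge_scale_bounds k by (intro mult_left_mono) auto
  then have d': "\<bar>d\<bar> \<le> \<epsilon> / 4" using d edge_scale_bounds(3)[of e] by linarith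
  have "\<bar>x\<bar> < 1 - \<epsilon> / 2"
    using False cutoff_eq_0[OF eps(1), of x] by (force simp: free_prob_def)
  then have "\<bar>x\<bar> + \<bar>d\<bar> < 1" using d' eps by linarith
  then have 1: "(b x)\<^sup>2 \<le> exp (Q * d\<^sup>2) * (b (x + d) * b (x - d))" by (rule Q(2))
  have "\<bar>d\<bar>\<^sup>2 \<le> (a * (real k + 1))\<^sup>2" using d by (intro power_mono) (auto simp: a_def)
  moreover have y: "(real k + 1)\<^sup>2 \<le> (real k + 1) ^ 4" by (intro power_increasing) auto
  ultimately have "d\<^sup>2 \<le> a\<^sup>2 * Y"
    using Y mult_left_mono[of "(real k + 1)\<^sup>2" Y "a\<^sup>2"] by (simp add: power_mult_distrib)
  moreover have "a\<^sup>2 * Y \<le> a\<^sup>2 * Y / G"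
    using G mult_nonneg_nonneg[OF zero_le_power2[of a] Y0] by (simp add: le_divide_eq mult_left_le)
  ultimately have q1: "Q * d\<^sup>2 \<le> Q * (a\<^sup>2 * Y / G)" using Q(1) by (intro mult_left_mono) linarith+
  have q2: "0 \<le> Q * (a\<^sup>2 * Y / G)" using Q(1) Y0 G by simp
  have Qd: "Q * d\<^sup>2 \<le> 2 * (Q * (a\<^sup>2 * Y / G))"
    using add_mono[OF q1 q2] by (simp only: mult_2 add_0_right)
  have "(b x)\<^sup>2 \<le> exp (2 * (Q * (a\<^sup>2 * Y / G))) * (b (x + d) * b (x - d))"
    by (rule order_trans[OF 1 mult_right_mono]) (use Qd in \<open>auto simp: edge_weight_nonneg\<close>)
  moreover have "G\<^sup>2 \<le> exp (2 * ((2 + C) * a\<^sup>2 * Y / G)) * P"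
    unfolding G_def P_def C_def using d d' a Y G eps
    by (intro free_prob_target_mult[where y = "real k + 1"]) (auto simp: a_def G_def)
  ultimately have "(b x)\<^sup>2 * G\<^sup>2 \<le> (exp (2 * (Q * (a\<^sup>2 * Y / G))) * (b (x + d) * b (x - d))) * (exp (2 * ((2 + C) * a\<^sup>2 * Y / G)) * P)"
    by (intro mult_mono) (auto simp: edge_weight_nonneg)
  also have "\<dots> = (exp (2 * (Q * (a\<^sup>2 * Y / G))) * exp (2 * ((2 + C) * a\<^sup>2 * Y / G))) * ((b (x + d) * b (x - d)) * P)"
    by (simp only: mult_ac)
  also have "exp (2 * (Q * (a\<^sup>2 * Y / G))) * exp (2 * ((2 + C) * a\<^sup>2 * Y / G)) = exp (2 * (cost_const * a\<^sup>2 * (Y / G)))"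
    unfolding exp_add[symmetric] cost_const_def C_def by (simp add: algebra_simps add_divide_distrib)
  finally show ?thesis unfolding G_def P_def a_def power_mult_distrib by (simp only: mult_ac)
qed

text \<open>For fixed \<open>\<omega>\<close> everything factorises over edges. Frozen edges have
  \<open>d = 0\<close>, as \<open>s\<close> is constant on clusters; for free edges
  \<open>s_difference\<close> provides one \<open>k\<close> that controls the shift and is paid for
  by \<open>edge_cost\<close>.\<close>

lemma transport_pointwise:
  assumes \<omega>: "\<omega> \<subseteq> E" "small_clusters \<omega>"
  shows "(gibbs_density n U \<psi> * edge_kernel E (free \<psi>) \<omega>)\<^sup>2 \<le> exp (2 * loss \<omega> \<psi>) *
    ((gibbs_density n U (translate n (s \<omega>) \<psi>) * edge_kernel E (free_target (translate n (s \<omega>) \<psi>)) \<omega>) *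
     (gibbs_density n U (translate n (\<lambda>v. - s \<omega> v) \<psi>) * edge_kernel E (free_target (translate n (\<lambda>v. - s \<omega> v) \<psi>)) \<omega>))"
proof -
  have fin: "finite \<omega>" using \<omega>(1) finite_torus_E finite_subset by blast
  define P where "P = translate n (s \<omega>) \<psi>"
  define N where "N = translate n (\<lambda>v. - s \<omega> v) \<psi>"
  define l where "l e = (if e \<in> \<omega> then 2 * (edge_scale e)\<^sup>2 else cost_const * (edge_scale e)\<^sup>2 * (edge_cost \<omega> e / free \<psi> e))" for e
  define X where "X \<phi> G e = b (gradient \<phi> e) * (if e \<in> \<omega> then 1 - G \<phi> e else G \<phi> e)"
    for \<phi> and G :: "(vertex \<Rightarrow> real) \<Rightarrow> vertex \<times> vertex \<Rightarrow> real" and e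
  have prodX: "(\<Prod>e\<in>E. X \<phi> G e) = total_weight n U \<phi> * edge_kernel E (G \<phi>) \<omega>" for \<phi> G
    unfolding X_def total_weight_def edge_kernel_def by (rule prod.distrib)
  have edge: "(X \<psi> free e)\<^sup>2 \<le> exp (2 * l e) * (X P free_target e * X N free_target e)" if e: "e \<in> E" for e
  proof -
    define d where "d = s \<omega> (fst e) - s \<omega> (snd e)"
    have g: "gradient P e = gradient \<psi> e + d" "gradient N e = gradient \<psi> e - d"
      using e s_0[OF fin] by (simp_all add: P_def N_def gradient_translate d_def)
    show ?thesis
    proof (cases "e \<in> \<omega>")
      case True
      then have "d = 0" using cluster_min_edge[of "fst e" "snd e" \<omega> \<tau>] by (simp add: d_def)
      then show ?thesis using frozen_edge_pointwise[of "gradient \<psi> e" e] True g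
        by (simp add: X_def l_def free_def free_target_def)
    next
      case False
      obtain k where "k < K" "\<bar>d\<bar> \<le> edge_scale e * (real k + 1)" "(real k + 1) ^ 4 \<le> edge_cost \<omega> e"
        using s_difference[OF \<omega> e] by (auto simp: d_def)
      then show ?thesis using free_edge_pointwise[of d e k "edge_cost \<omega> e" "gradient \<psi> e"] False g
        by (simp add: X_def l_def free_def free_target_def)
    qed
  qed
  have "(\<Prod>e\<in>E. X \<psi> free e)\<^sup>2 = (\<Prod>e\<in>E. (X \<psi> free e)\<^sup>2)" by (rule prod_power_distrib)
  also have "\<dots> \<le> (\<Prod>e\<in>E. exp (2 * l e) * (X P free_target e * X N free_target e))"
    using edge by (intro prod_mono) auto
  also have "\<dots> = exp (\<Sum>e\<in>E. 2 * l e) * ((\<Prod>e\<in>E. X P free_target e) * (\<Prod>e\<in>E. X N free_target e))"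
    by (simp add: prod.distrib exp_sum finite_torus_E)
  also have "(\<Sum>e\<in>E. 2 * l e) = 2 * loss \<omega> \<psi>"
    by (simp add: loss_def l_def sum_distrib_left)
  finally have *: "(total_weight n U \<psi> * edge_kernel E (free \<psi>) \<omega>)\<^sup>2 \<le> exp (2 * loss \<omega> \<psi>) *
      ((total_weight n U P * edge_kernel E (free_target P) \<omega>) * (total_weight n U N * edge_kernel E (free_target N) \<omega>))"
    by (simp only: prodX)
  define Z where "Z = enn2real (partition_fn n U)"
  have "(total_weight n U \<psi> * edge_kernel E (free \<psi>) \<omega>)\<^sup>2 / Z\<^sup>2 \<le> exp (2 * loss \<omega> \<psi>) *
      ((total_weight n U P * edge_kernel E (free_target P) \<omega>) * (total_weight n U N * edge_kernel E (free_target N) \<omega>)) / Z\<^sup>2"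
    using * by (rule divide_right_mono) simp
  then show ?thesis
    by (simp add: gibbs_density_def P_def[symmetric] N_def[symmetric] Z_def[symmetric] power2_eq_square)
qed

abbreviation "R \<equiv> ref_measure n"
abbreviation "P \<equiv> measure (gibbs n U)"

definition rough :: "(vertex \<times> vertex) set \<Rightarrow> (vertex \<Rightarrow> real) \<Rightarrow> bool" where
  "rough S \<psi> \<longleftrightarrow> (\<forall>e\<in>S. 1 - \<epsilon> \<le> \<bar>gradient \<psi> e\<bar>)"

definition rough_paths :: "nat \<Rightarrow> vertex \<Rightarrow> (vertex \<Rightarrow> real) \<Rightarrow> real" where
  "rough_paths j v \<psi> = (\<Sum>S | S \<in> paths E j v \<and> card S = j. of_bool (rough S \<psi>))"

lemma measurable_free_prob [measurable]: "free_prob \<epsilon> \<in> borel_measurable borel"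
  unfolding free_prob_def cutoff_def by measurable

lemma measurable_free_prob_target [measurable]: "free_prob_target \<epsilon> a \<in> borel_measurable borel"
  unfolding free_prob_target_def by measurable

lemma measurable_free: "e \<in> E \<Longrightarrow> (\<lambda>\<psi>. free \<psi> e) \<in> borel_measurable R"
  unfolding free_def by (rule measurable_compose[OF measurable_gradient measurable_free_prob])

lemma measurable_free_target: "e \<in> E \<Longrightarrow> (\<lambda>\<psi>. free_target \<psi> e) \<in> borel_measurable R"
  unfolding free_target_def by (rule measurable_compose[OF measurable_gradient measurable_free_prob_target])

lemma measurable_kernel [measurable]: "(\<lambda>\<psi>. edge_kernel E (free \<psi>) \<omega>) \<in> borel_measurable R"
  unfolding edge_kernel_def
proof (intro borel_measurable_prod)
  fix e assume "e \<in> E"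
  from measurable_free[OF this] show "(\<lambda>\<psi>. if e \<in> \<omega> then 1 - free \<psi> e else free \<psi> e) \<in> borel_measurable R"
    by (cases "e \<in> \<omega>") auto
qed

lemma measurable_kernel_target [measurable]: "(\<lambda>\<psi>. edge_kernel E (free_target \<psi>) \<omega>) \<in> borel_measurable R"
  unfolding edge_kernel_def
proof (intro borel_measurable_prod)
  fix e assume "e \<in> E"
  from measurable_free_target[OF this] show "(\<lambda>\<psi>. if e \<in> \<omega> then 1 - free_target \<psi> e else free_target \<psi> e) \<in> borel_measurable R"
    by (cases "e \<in> \<omega>") auto
qed

lemma measurable_loss [measurable]: "loss \<omega> \<in> borel_measurable R"
  unfolding loss_def
proof (intro borel_measurable_sum)
  fix e assume "e \<in> E"
  note [measurable] = measurable_free[OF this]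
  show "(\<lambda>\<psi>. if e \<in> \<omega> then 2 * (edge_scale e)\<^sup>2 else cost_const * (edge_scale e)\<^sup>2 * (edge_cost \<omega> e / free \<psi> e)) \<in> borel_measurable R"
    by (cases "e \<in> \<omega>") auto
qed

lemma kernel_nonneg: "0 \<le> edge_kernel E (free \<psi>) \<omega>" "0 \<le> edge_kernel E (free_target \<psi>) \<omega>"
  by (auto intro!: edge_kernel_nonneg simp: free_bounds free_target_bounds)

lemma loss_nonneg: "0 \<le> loss \<omega> \<psi>"
  unfolding loss_def using cost_const_ge
  by (intro sum_nonneg) (auto intro!: mult_nonneg_nonneg divide_nonneg_nonneg simp: edge_cost_nonneg free_bounds)

text \<open>After a change of variables for each \<open>\<omega>\<close>, the target kernels are
  summed over \<open>\<omega>\<close> at a common configuration and give 1. This is why the lifted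
  target had to remain a probability kernel and why both images of \<open>A\<close> must lie in sets
  independent of \<open>\<omega>\<close>.\<close>

lemma transport_integral:
  assumes [measurable]: "A \<in> sets R" "Hp \<in> sets R" "Hm \<in> sets R" and l: "0 < l"
    and Hp: "\<And>\<omega> \<psi>. \<omega> \<subseteq> E \<Longrightarrow> small_clusters \<omega> \<Longrightarrow> \<psi> \<in> A \<Longrightarrow> translate n (s \<omega>) \<psi> \<in> Hp"
    and Hm: "\<And>\<omega> \<psi>. \<omega> \<subseteq> E \<Longrightarrow> small_clusters \<omega> \<Longrightarrow> \<psi> \<in> A \<Longrightarrow> translate n (\<lambda>v. - s \<omega> v) \<psi> \<in> Hm"
  shows "(\<integral>\<^sup>+\<psi>. ennreal (\<Sum>\<omega>\<in>Pow E. of_bool (small_clusters \<omega> \<and> loss \<omega> \<psi> \<le> B \<and> \<psi> \<in> A) * edge_kernel E (free \<psi>) \<omega>) \<partial>gibbs n U)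
    \<le> ennreal (exp B / 2 * (l * P Hp + P Hm / l))"
proof -
  interpret prob_space "gibbs n U" by (rule prob_space_gibbs)
  let ?f = "gibbs_density n U"
  define J where "J \<omega> \<psi> = of_bool (small_clusters \<omega> \<and> loss \<omega> \<psi> \<le> B \<and> \<psi> \<in> A) * edge_kernel E (free \<psi>) \<omega>" for \<omega> \<psi>
  define F where "F H \<omega> \<psi> = ennreal (?f \<psi> * edge_kernel E (free_target \<psi>) \<omega>) * indicator H \<psi>" for H \<omega> \<psi>
  define c1 where "c1 = exp B / 2 * l"
  define c2 where "c2 = exp B / 2 / l"
  have c: "0 \<le> c1" "0 \<le> c2" using l by (auto simp: c1_def c2_def)
  have J0: "0 \<le> J \<omega> \<psi>" for \<omega> \<psi> by (simp add: J_def kernel_nonneg)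
  have [measurable]: "J \<omega> \<in> borel_measurable R" for \<omega> unfolding J_def by measurable
  have [measurable]: "F H \<omega> \<in> borel_measurable R" if [measurable]: "H \<in> sets R" for H \<omega> unfolding F_def by measurable
  have pt: "ennreal (?f \<psi> * J \<omega> \<psi>) \<le> ennreal c1 * F Hp \<omega> (translate n (s \<omega>) \<psi>)
      + ennreal c2 * F Hm \<omega> (translate n (\<lambda>v. - s \<omega> v) \<psi>)" if \<omega>: "\<omega> \<subseteq> E" for \<omega> \<psi>
  proof (cases "small_clusters \<omega> \<and> loss \<omega> \<psi> \<le> B \<and> \<psi> \<in> A")
    case True
    let ?p = "translate n (s \<omega>) \<psi>" and ?m = "translate n (\<lambda>v. - s \<omega> v) \<psi>"
    let ?x = "?f \<psi> * edge_kernel E (free \<psi>) \<omega>"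
    let ?y = "?f ?p * edge_kernel E (free_target ?p) \<omega>" and ?z = "?f ?m * edge_kernel E (free_target ?m) \<omega>"
    have yz: "0 \<le> ?y" "0 \<le> ?z" by (simp_all add: gibbs_density_nonneg kernel_nonneg)
    have "?x\<^sup>2 \<le> exp (2 * loss \<omega> \<psi>) * (?y * ?z)" using transport_pointwise[OF \<omega>] True by blast
    also have "\<dots> \<le> exp (2 * B) * (?y * ?z)" using True yz by (intro mult_right_mono) auto
    finally have "?x \<le> exp B / 2 * (l * ?y + ?z / l)" using yz l by (rule weighted_AM_GM)
    also have "\<dots> = c1 * ?y + c2 * ?z" by (simp add: c1_def c2_def distrib_left)
    finally have "ennreal ?x \<le> ennreal (c1 * ?y + c2 * ?z)" by (rule ennreal_leI)
    also have "\<dots> = ennreal c1 * ennreal ?y + ennreal c2 * ennreal ?z"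
      using c yz by (simp only: ennreal_plus ennreal_mult mult_nonneg_nonneg)
    finally show ?thesis using True Hp[OF \<omega>] Hm[OF \<omega>] by (simp add: J_def F_def)
  next
    case False
    then show ?thesis by (auto simp: J_def)
  qed
  have sumF: "(\<Sum>\<omega>\<in>Pow E. \<integral>\<^sup>+\<psi>. F H \<omega> \<psi> \<partial>R) = ennreal (P H)" if H [measurable]: "H \<in> sets R" for H
  proof -
    have "(\<Sum>\<omega>\<in>Pow E. \<integral>\<^sup>+\<psi>. F H \<omega> \<psi> \<partial>R) = (\<integral>\<^sup>+\<psi>. (\<Sum>\<omega>\<in>Pow E. F H \<omega> \<psi>) \<partial>R)"
      by (subst nn_integral_sum) auto
    also have "\<dots> = (\<integral>\<^sup>+\<psi>. ennreal (?f \<psi>) * indicator H \<psi> \<partial>R)"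
    proof (intro nn_integral_cong)
      fix \<psi>
      have "(\<Sum>\<omega>\<in>Pow E. F H \<omega> \<psi>) = ennreal (\<Sum>\<omega>\<in>Pow E. ?f \<psi> * edge_kernel E (free_target \<psi>) \<omega>) * indicator H \<psi>"
        unfolding F_def sum_distrib_right[symmetric]
        by (subst sum_ennreal) (auto simp: gibbs_density_nonneg kernel_nonneg)
      also have "(\<Sum>\<omega>\<in>Pow E. ?f \<psi> * edge_kernel E (free_target \<psi>) \<omega>) = ?f \<psi>"
        by (simp add: sum_distrib_left[symmetric] sum_edge_kernel[OF finite_torus_E])
      finally show "(\<Sum>\<omega>\<in>Pow E. F H \<omega> \<psi>) = ennreal (?f \<psi>) * indicator H \<psi>" .
    qed
    also have "\<dots> = (\<integral>\<^sup>+\<psi>. indicator H \<psi> \<partial>gibbs n U)" by (subst nn_integral_gibbs) auto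
    also have "\<dots> = ennreal (P H)" using H by (simp add: emeasure_eq_measure)
    finally show ?thesis .
  qed
  have "(\<integral>\<^sup>+\<psi>. ennreal (\<Sum>\<omega>\<in>Pow E. J \<omega> \<psi>) \<partial>gibbs n U) = (\<integral>\<^sup>+\<psi>. ennreal (?f \<psi>) * ennreal (\<Sum>\<omega>\<in>Pow E. J \<omega> \<psi>) \<partial>R)"
    by (rule nn_integral_gibbs) measurable
  also have "\<dots> = (\<integral>\<^sup>+\<psi>. (\<Sum>\<omega>\<in>Pow E. ennreal (?f \<psi> * J \<omega> \<psi>)) \<partial>R)"
    by (intro nn_integral_cong, subst sum_ennreal)
      (auto simp: J0 gibbs_density_nonneg sum_distrib_left[symmetric] ennreal_mult sum_nonneg)
  also have "\<dots> = (\<Sum>\<omega>\<in>Pow E. \<integral>\<^sup>+\<psi>. ennreal (?f \<psi> * J \<omega> \<psi>) \<partial>R)" by (rule nn_integral_sum) measurable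
  also have "\<dots> \<le> (\<Sum>\<omega>\<in>Pow E. \<integral>\<^sup>+\<psi>. ennreal c1 * F Hp \<omega> (translate n (s \<omega>) \<psi>)
      + ennreal c2 * F Hm \<omega> (translate n (\<lambda>v. - s \<omega> v) \<psi>) \<partial>R)"
    using pt by (intro sum_mono nn_integral_mono) auto
  also have "\<dots> = (\<Sum>\<omega>\<in>Pow E. ennreal c1 * (\<integral>\<^sup>+\<psi>. F Hp \<omega> \<psi> \<partial>R) + ennreal c2 * (\<integral>\<^sup>+\<psi>. F Hm \<omega> \<psi> \<partial>R))"
  proof (intro sum.cong refl)
    fix \<omega>
    have "(\<integral>\<^sup>+\<psi>. ennreal c1 * F Hp \<omega> (translate n (s \<omega>) \<psi>) + ennreal c2 * F Hm \<omega> (translate n (\<lambda>v. - s \<omega> v) \<psi>) \<partial>R)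
      = ennreal c1 * (\<integral>\<^sup>+\<psi>. F Hp \<omega> (translate n (s \<omega>) \<psi>) \<partial>R) + ennreal c2 * (\<integral>\<^sup>+\<psi>. F Hm \<omega> (translate n (\<lambda>v. - s \<omega> v) \<psi>) \<partial>R)"
      by (simp add: nn_integral_add nn_integral_cmult)
    then show "(\<integral>\<^sup>+\<psi>. ennreal c1 * F Hp \<omega> (translate n (s \<omega>) \<psi>) + ennreal c2 * F Hm \<omega> (translate n (\<lambda>v. - s \<omega> v) \<psi>) \<partial>R)
      = ennreal c1 * (\<integral>\<^sup>+\<psi>. F Hp \<omega> \<psi> \<partial>R) + ennreal c2 * (\<integral>\<^sup>+\<psi>. F Hm \<omega> \<psi> \<partial>R)"
      by (simp add: nn_integral_translate)
  qed
  also have "\<dots> = ennreal c1 * ennreal (P Hp) + ennreal c2 * ennreal (P Hm)"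
    by (simp add: sum.distrib sum_distrib_left[symmetric] sumF)
  also have "\<dots> = ennreal (c1 * P Hp + c2 * P Hm)"
    using c by (simp add: ennreal_mult)
  also have "c1 * P Hp + c2 * P Hm = exp B / 2 * (l * P Hp + P Hm / l)"
    by (simp add: c1_def c2_def distrib_left)
  finally show ?thesis by (simp add: J_def)
qed

text \<open>An edge with gradient at most \<open>1 - \<epsilon>\<close> is never frozen, so the
  kernel vanishes whenever a frozen path contains one. A union bound over paths then leaves a
  quantity of the field alone, to which the gradient hypothesis applies.\<close>

lemma sum_kernel_has_path:
  "(\<Sum>\<omega>\<in>Pow E. edge_kernel E (free \<psi>) \<omega> * of_bool (has_path E \<omega> j v)) \<le> rough_paths j v \<psi>"
proof -
  let ?k = "edge_kernel E (free \<psi>)" and ?S = "{S. S \<in> paths E j v \<and> card S = j}"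
  have finS: "finite ?S" using finite_paths[OF finite_torus_E] by simp
  have 1: "of_bool (has_path E \<omega> j v) \<le> (\<Sum>S\<in>?S. of_bool (S \<subseteq> \<omega>) :: real)" for \<omega>
  proof (cases "has_path E \<omega> j v")
    case True
    then obtain S where S: "S \<in> ?S" "S \<subseteq> \<omega>" by (auto simp: has_path_def)
    have "of_bool (S \<subseteq> \<omega>) \<le> (\<Sum>S\<in>?S. of_bool (S \<subseteq> \<omega>) :: real)" using finS S(1) by (intro member_le_sum) auto
    then show ?thesis using True S(2) by simp
  qed (simp add: sum_nonneg)
  have 2: "?k \<omega> * of_bool (S \<subseteq> \<omega>) \<le> ?k \<omega> * of_bool (rough S \<psi>)" if S: "S \<in> ?S" for S \<omega>
  proof (cases "S \<subseteq> \<omega> \<and> \<not> rough S \<psi>")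
    case True
    then obtain e where e: "e \<in> S" "\<bar>gradient \<psi> e\<bar> \<le> 1 - \<epsilon>" by (auto simp: rough_def not_le)
    have "S \<subseteq> E" using S paths_subset[of S E j v] by simp
    then have "e \<in> E" using e(1) by blast
    moreover have "free \<psi> e = 1" unfolding free_def using e(2) by (rule free_prob_eq_1)
    moreover have "e \<in> \<omega>" using True e(1) by auto
    ultimately have "?k \<omega> = 0" unfolding edge_kernel_def using finite_torus_E by (intro prod_zero) auto
    then show ?thesis by simp
  next
    case False
    then have "of_bool (S \<subseteq> \<omega>) \<le> (of_bool (rough S \<psi>) :: real)" by simp
    then show ?thesis using kernel_nonneg(1) by (rule mult_left_mono)
  qed
  have "(\<Sum>\<omega>\<in>Pow E. ?k \<omega> * of_bool (has_path E \<omega> j v)) \<le> (\<Sum>\<omega>\<in>Pow E. \<Sum>S\<in>?S. ?k \<omega> * of_bool (S \<subseteq> \<omega>))"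
    unfolding sum_distrib_left[symmetric] using 1 kernel_nonneg(1) by (intro sum_mono mult_left_mono) auto
  also have "\<dots> \<le> (\<Sum>\<omega>\<in>Pow E. \<Sum>S\<in>?S. ?k \<omega> * of_bool (rough S \<psi>))"
    using 2 by (intro sum_mono) auto
  also have "\<dots> = (\<Sum>\<omega>\<in>Pow E. ?k \<omega>) * rough_paths j v \<psi>"
    unfolding rough_paths_def by (rule sum_product[symmetric])
  also have "\<dots> = rough_paths j v \<psi>" by (simp add: sum_edge_kernel[OF finite_torus_E])
  finally show ?thesis .
qed

lemma rough_measurable:
  assumes "S \<subseteq> E"
  shows "{\<psi> \<in> space R. rough S \<psi>} \<in> sets R"
proof -
  have "{\<psi> \<in> space R. \<forall>e\<in>S. 1 - \<epsilon> \<le> \<bar>gradient \<psi> e\<bar>} \<in> sets R"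
  proof (rule sets.sets_Collect_finite_All)
    show "finite S" using assms finite_torus_E finite_subset by blast
    fix e assume "e \<in> S"
    then have "e \<in> E" using assms by blast
    note [measurable] = measurable_gradient[OF this]
    show "{\<psi> \<in> space R. 1 - \<epsilon> \<le> \<bar>gradient \<psi> e\<bar>} \<in> sets R" by measurable
  qed
  then show ?thesis by (simp add: rough_def)
qed

lemma rough_paths_integral:
  "integrable (gibbs n U) (rough_paths j v)" "(\<integral>\<psi>. rough_paths j v \<psi> \<partial>gibbs n U) \<le> (1 / 2) ^ j"
proof -
  interpret prob_space "gibbs n U" by (rule prob_space_gibbs)
  let ?S = "{S. S \<in> paths E j v \<and> card S = j}"
  have finS: "finite ?S" using finite_paths[OF finite_torus_E] by simp
  have sub: "S \<subseteq> E" if "S \<in> ?S" for S using that paths_subset[of S E j v] by simp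
  let ?A = "\<lambda>S. {\<psi> \<in> space (gibbs n U). rough S \<psi>}"
  have A: "?A S \<in> sets (gibbs n U)" if "S \<in> ?S" for S
    using rough_measurable[OF sub[OF that]] by simp
  have ind: "integrable (gibbs n U) (indicator (?A S) :: _ \<Rightarrow> real)" if "S \<in> ?S" for S
    by (rule integrable_real_indicator[OF A[OF that]]) (simp add: less_top[symmetric])
  have eq: "rough_paths j v \<psi> = (\<Sum>S\<in>?S. indicator (?A S) \<psi>)" if "\<psi> \<in> space (gibbs n U)" for \<psi>
    unfolding rough_paths_def using that by (intro sum.cong) (auto simp: indicator_def)
  have "integrable (gibbs n U) (rough_paths j v) \<longleftrightarrow> integrable (gibbs n U) (\<lambda>\<psi>. \<Sum>S\<in>?S. indicator (?A S) \<psi> :: real)"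
    by (rule Bochner_Integration.integrable_cong[OF refl eq])
  moreover have "integrable (gibbs n U) (\<lambda>\<psi>. \<Sum>S\<in>?S. indicator (?A S) \<psi> :: real)"
    using ind by (rule Bochner_Integration.integrable_sum)
  ultimately show "integrable (gibbs n U) (rough_paths j v)" by blast
  have pA: "prob (?A S) \<le> (1 / 8) ^ j" if "S \<in> ?S" for S
  proof (cases "S = {}")
    \<comment> \<open>Here \<open>j = 0\<close>; the gradient hypothesis concerns nonempty sets
      only, and the trivial bound 1 is the right one.\<close>
    case True
    then show ?thesis using that by auto
  next
    case False
    have "prob {\<psi> \<in> space (gibbs n U). \<forall>(v, w)\<in>S. \<bar>field \<psi> v - field \<psi> w\<bar> \<ge> 1 - \<epsilon>} \<le> (1 / 8) ^ card S"
      using controlled sub[OF that] False by (auto simp: controlled_gradients_def)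
    then show ?thesis using that by (simp add: rough_def gradient_def case_prod_unfold)
  qed
  have "(\<integral>\<psi>. rough_paths j v \<psi> \<partial>gibbs n U) = (\<integral>\<psi>. (\<Sum>S\<in>?S. indicator (?A S) \<psi>) \<partial>gibbs n U)"
    by (rule Bochner_Integration.integral_cong[OF refl eq])
  also have "\<dots> = (\<Sum>S\<in>?S. \<integral>\<psi>. indicator (?A S) \<psi> \<partial>gibbs n U)"
    using ind by (rule Bochner_Integration.integral_sum)
  also have "\<dots> = (\<Sum>S\<in>?S. prob (?A S))" using A by (intro sum.cong) auto
  also have "\<dots> \<le> (\<Sum>S\<in>?S. (1 / 8) ^ j)" using pA by (rule sum_mono)
  also have "\<dots> = real (card ?S) * (1 / 8) ^ j" by simp
  also have "\<dots> \<le> 4 ^ j * (1 / 8) ^ j"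
  proof (rule mult_right_mono)
    have "card ?S \<le> card (paths E j v)" using finite_paths[OF finite_torus_E] by (intro card_mono) auto
    also have "\<dots> \<le> 4 ^ j" using torus_degree by (rule card_paths[OF finite_torus_E])
    finally have "real (card ?S) \<le> real (4 ^ j)" by (rule of_nat_mono)
    then show "real (card ?S) \<le> 4 ^ j" by simp
  qed simp
  also have "\<dots> = (1 / 2) ^ j" unfolding power_mult_distrib[symmetric] by simp
  finally show "(\<integral>\<psi>. rough_paths j v \<psi> \<partial>gibbs n U) \<le> (1 / 2) ^ j" .
qed

definition expected_cost :: "(vertex \<Rightarrow> real) \<Rightarrow> vertex \<Rightarrow> real" where
  "expected_cost \<psi> v = (\<Sum>j<K. (real j + 1) ^ 4 * rough_paths j v \<psi>)"

lemma sum_kernel_cluster_cost: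
  "(\<Sum>\<omega>\<in>Pow E. edge_kernel E (free \<psi>) \<omega> * cluster_cost \<omega> v) \<le> expected_cost \<psi> v"
proof -
  let ?k = "edge_kernel E (free \<psi>)"
  have "(\<Sum>\<omega>\<in>Pow E. ?k \<omega> * cluster_cost \<omega> v)
    = (\<Sum>\<omega>\<in>Pow E. \<Sum>j<K. (real j + 1) ^ 4 * (?k \<omega> * of_bool (has_path E \<omega> j v)))"
    unfolding cluster_cost_def sum_distrib_left by (intro sum.cong refl) (simp only: mult_ac)
  also have "\<dots> = (\<Sum>j<K. (real j + 1) ^ 4 * (\<Sum>\<omega>\<in>Pow E. ?k \<omega> * of_bool (has_path E \<omega> j v)))"
    unfolding sum_distrib_left by (rule sum.swap)
  also have "\<dots> \<le> expected_cost \<psi> v"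
    unfolding expected_cost_def using sum_kernel_has_path by (intro sum_mono mult_left_mono) auto
  finally show ?thesis .
qed

lemma sum_kernel_loss:
  "(\<Sum>\<omega>\<in>Pow E. edge_kernel E (free \<psi>) \<omega> * loss \<omega> \<psi>)
    \<le> (\<Sum>e\<in>E. (edge_scale e)\<^sup>2 * (2 + cost_const * (expected_cost \<psi> (fst e) + expected_cost \<psi> (snd e))))"
proof -
  let ?k = "edge_kernel E (free \<psi>)"
  have "(\<Sum>\<omega>\<in>Pow E. ?k \<omega> * loss \<omega> \<psi>) \<le> (\<Sum>\<omega>\<in>Pow E. \<Sum>e\<in>E. ?k \<omega> * (2 * (edge_scale e)\<^sup>2)
      + cost_const * (edge_scale e)\<^sup>2 * (?k \<omega> * (if e \<in> \<omega> then 0 else edge_cost \<omega> e / free \<psi> e)))"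
    unfolding loss_def sum_distrib_left using kernel_nonneg(1) by (intro sum_mono) (simp add: mult_ac)
  also have "\<dots> = (\<Sum>e\<in>E. (\<Sum>\<omega>\<in>Pow E. ?k \<omega>) * (2 * (edge_scale e)\<^sup>2)
      + cost_const * (edge_scale e)\<^sup>2 * (\<Sum>\<omega>\<in>Pow E. ?k \<omega> * (if e \<in> \<omega> then 0 else edge_cost \<omega> e / free \<psi> e)))"
    unfolding sum_distrib_left sum_distrib_right sum.distrib[symmetric] by (rule sum.swap)
  also have "\<dots> \<le> (\<Sum>e\<in>E. (edge_scale e)\<^sup>2 * (2 + cost_const * (expected_cost \<psi> (fst e) + expected_cost \<psi> (snd e))))"
  proof (intro sum_mono)
    fix e assume e: "e \<in> E"
    have "(\<Sum>\<omega>\<in>Pow E. ?k \<omega> * (if e \<in> \<omega> then 0 else edge_cost \<omega> e / free \<psi> e)) \<le> (\<Sum>\<omega>\<in>Pow E. ?k \<omega> * edge_cost \<omega> e)"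
    proof (rule edge_kernel_free_edge[OF finite_torus_E e])
      show "edge_cost \<omega> e \<le> edge_cost \<omega>' e" if "\<omega> \<subseteq> \<omega>'" for \<omega> \<omega>'
        unfolding edge_cost_def by (intro add_mono cluster_cost_mono that)
    qed (auto simp: free_bounds edge_cost_nonneg)
    also have "\<dots> \<le> expected_cost \<psi> (fst e) + expected_cost \<psi> (snd e)"
      unfolding edge_cost_def distrib_left sum.distrib by (intro add_mono sum_kernel_cluster_cost)
    finally have "cost_const * (edge_scale e)\<^sup>2 * (\<Sum>\<omega>\<in>Pow E. ?k \<omega> * (if e \<in> \<omega> then 0 else edge_cost \<omega> e / free \<psi> e))
        \<le> cost_const * (edge_scale e)\<^sup>2 * (expected_cost \<psi> (fst e) + expected_cost \<psi> (snd e))"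
      using cost_const_ge by (intro mult_left_mono) auto
    then show "(\<Sum>\<omega>\<in>Pow E. ?k \<omega>) * (2 * (edge_scale e)\<^sup>2)
      + cost_const * (edge_scale e)\<^sup>2 * (\<Sum>\<omega>\<in>Pow E. ?k \<omega> * (if e \<in> \<omega> then 0 else edge_cost \<omega> e / free \<psi> e))
      \<le> (edge_scale e)\<^sup>2 * (2 + cost_const * (expected_cost \<psi> (fst e) + expected_cost \<psi> (snd e)))"
      by (simp add: sum_edge_kernel[OF finite_torus_E] algebra_simps)
  qed
  finally show ?thesis .
qed

lemma expected_cost_integral:
  "integrable (gibbs n U) (\<lambda>\<psi>. expected_cost \<psi> v)" "(\<integral>\<psi>. expected_cost \<psi> v \<partial>gibbs n U) \<le> 300"
proof -
  show "integrable (gibbs n U) (\<lambda>\<psi>. expected_cost \<psi> v)"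
    unfolding expected_cost_def
    by (intro Bochner_Integration.integrable_sum integrable_mult_right rough_paths_integral)
  have "(\<integral>\<psi>. expected_cost \<psi> v \<partial>gibbs n U) = (\<Sum>j<K. (real j + 1) ^ 4 * (\<integral>\<psi>. rough_paths j v \<psi> \<partial>gibbs n U))"
    unfolding expected_cost_def
    by (subst Bochner_Integration.integral_sum) (auto intro!: integrable_mult_right rough_paths_integral)
  also have "\<dots> \<le> (\<Sum>j<K. (real j + 1) ^ 4 * (1 / 2) ^ j)"
    by (intro sum_mono mult_left_mono rough_paths_integral) auto
  also have "\<dots> \<le> 300" unfolding sum_fourth_powers_halves by simp
  finally show "(\<integral>\<psi>. expected_cost \<psi> v \<partial>gibbs n U) \<le> 300" .
qed

text \<open>The three terms stand for the good pairs of field and frozen set, for a frozen path of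
  length \<open>K\<close> (\<open>4 * n\<^sup>2\<close> starting points, each with probability at
  most \<open>(1 / 2) ^ K\<close>), and for a loss above \<open>B\<close>, by Markov's
  inequality.\<close>

lemma shift_inequality:
  assumes [measurable]: "A \<in> sets R" "Hp \<in> sets R" "Hm \<in> sets R" and l: "0 < l" and B: "0 < B"
    and Hp: "\<And>\<omega> \<psi>. \<omega> \<subseteq> E \<Longrightarrow> small_clusters \<omega> \<Longrightarrow> \<psi> \<in> A \<Longrightarrow> translate n (s \<omega>) \<psi> \<in> Hp"
    and Hm: "\<And>\<omega> \<psi>. \<omega> \<subseteq> E \<Longrightarrow> small_clusters \<omega> \<Longrightarrow> \<psi> \<in> A \<Longrightarrow> translate n (\<lambda>v. - s \<omega> v) \<psi> \<in> Hm"
  shows "P A \<le> exp B / 2 * (l * P Hp + P Hm / l) + 4 * (real n)\<^sup>2 * (1 / 2) ^ K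
    + 8 * (2 + 600 * cost_const) * (\<Sum>v\<in>V. (\<alpha> v)\<^sup>2) / B"
proof -
  interpret prob_space "gibbs n U" by (rule prob_space_gibbs)
  define T where "T \<psi> = (\<Sum>\<omega>\<in>Pow E. of_bool (small_clusters \<omega> \<and> loss \<omega> \<psi> \<le> B \<and> \<psi> \<in> A) * edge_kernel E (free \<psi>) \<omega>)" for \<psi>
  define D where "D \<psi> = (\<Sum>v\<in>V. rough_paths K v \<psi>)" for \<psi>
  define C where "C \<psi> = (\<Sum>e\<in>E. (edge_scale e)\<^sup>2 * (2 + cost_const * (expected_cost \<psi> (fst e) + expected_cost \<psi> (snd e))))" for \<psi>
  let ?k = "\<lambda>\<psi>. edge_kernel E (free \<psi>)"
  have T0: "0 \<le> T \<psi>" for \<psi> unfolding T_def by (intro sum_nonneg mult_nonneg_nonneg kernel_nonneg) auto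
  have T1: "T \<psi> \<le> 1" for \<psi>
  proof -
    have "T \<psi> \<le> (\<Sum>\<omega>\<in>Pow E. ?k \<psi> \<omega>)"
      unfolding T_def using kernel_nonneg(1) by (intro sum_mono) (auto simp: of_bool_def)
    then show ?thesis by (simp add: sum_edge_kernel[OF finite_torus_E])
  qed
  have [measurable]: "T \<in> borel_measurable R" unfolding T_def by measurable
  have pt: "indicator A \<psi> \<le> T \<psi> + D \<psi> + C \<psi> / B" for \<psi>
  proof -
    have "?k \<psi> \<omega> * indicator A \<psi> \<le> of_bool (small_clusters \<omega> \<and> loss \<omega> \<psi> \<le> B \<and> \<psi> \<in> A) * ?k \<psi> \<omega>
        + (\<Sum>v\<in>V. ?k \<psi> \<omega> * of_bool (has_path E \<omega> K v)) + ?k \<psi> \<omega> * loss \<omega> \<psi> / B" for \<omega>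
    proof -
      have k0: "0 \<le> ?k \<psi> \<omega>" by (rule kernel_nonneg)
      have t2: "0 \<le> (\<Sum>v\<in>V. ?k \<psi> \<omega> * of_bool (has_path E \<omega> K v))" using k0 by (intro sum_nonneg) auto
      have t3: "0 \<le> ?k \<psi> \<omega> * loss \<omega> \<psi> / B" using k0 loss_nonneg B by simp
      consider "\<psi> \<notin> A" | "\<not> small_clusters \<omega>" | "loss \<omega> \<psi> > B" | "\<psi> \<in> A" "small_clusters \<omega>" "loss \<omega> \<psi> \<le> B" by linarith
      then show ?thesis
      proof cases
        case 2
        then obtain v where v: "v \<in> V" "has_path E \<omega> K v" by (auto simp: small_clusters_def)
        have "?k \<psi> \<omega> * of_bool (has_path E \<omega> K v) \<le> (\<Sum>v\<in>V. ?k \<psi> \<omega> * of_bool (has_path E \<omega> K v))"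
          using v k0 finite_torus_V by (intro member_le_sum) auto
        then show ?thesis using 2 v t3 k0 by (auto simp: indicator_def)
      next
        case 3
        then have "?k \<psi> \<omega> * B \<le> ?k \<psi> \<omega> * loss \<omega> \<psi>" using k0 by (intro mult_left_mono) auto
        then have "?k \<psi> \<omega> \<le> ?k \<psi> \<omega> * loss \<omega> \<psi> / B" using B by (simp add: le_divide_eq)
        then show ?thesis using 3 t2 k0 by (auto simp: indicator_def)
      qed (use t2 t3 k0 in \<open>auto simp: indicator_def\<close>)
    qed
    then have "(\<Sum>\<omega>\<in>Pow E. ?k \<psi> \<omega> * indicator A \<psi>) \<le> (\<Sum>\<omega>\<in>Pow E. of_bool (small_clusters \<omega> \<and> loss \<omega> \<psi> \<le> B \<and> \<psi> \<in> A) * ?k \<psi> \<omega>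
        + (\<Sum>v\<in>V. ?k \<psi> \<omega> * of_bool (has_path E \<omega> K v)) + ?k \<psi> \<omega> * loss \<omega> \<psi> / B)"
      by (intro sum_mono)
    also have "\<dots> = T \<psi> + (\<Sum>v\<in>V. \<Sum>\<omega>\<in>Pow E. ?k \<psi> \<omega> * of_bool (has_path E \<omega> K v)) + (\<Sum>\<omega>\<in>Pow E. ?k \<psi> \<omega> * loss \<omega> \<psi>) / B"
      unfolding sum.distrib T_def sum_divide_distrib[symmetric] by (simp only: sum.swap[of _ V])
    also have "\<dots> \<le> T \<psi> + D \<psi> + C \<psi> / B"
      unfolding D_def C_def using B by (intro add_mono order_refl sum_mono sum_kernel_has_path divide_right_mono sum_kernel_loss) auto
    finally show ?thesis by (simp add: sum_distrib_right[symmetric] sum_edge_kernel[OF finite_torus_E])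
  qed
  have intT: "integrable (gibbs n U) T"
    using T0 T1 by (intro integrable_const_bound[where B = 1]) auto
  have intD: "integrable (gibbs n U) D" unfolding D_def by (intro Bochner_Integration.integrable_sum rough_paths_integral)
  have intC: "integrable (gibbs n U) C" unfolding C_def
    by (intro Bochner_Integration.integrable_sum integrable_mult_right Bochner_Integration.integrable_add expected_cost_integral integrable_const)
  have ED: "(\<integral>\<psi>. D \<psi> \<partial>gibbs n U) \<le> 4 * (real n)\<^sup>2 * (1 / 2) ^ K"
  proof -
    have "(\<integral>\<psi>. D \<psi> \<partial>gibbs n U) = (\<Sum>v\<in>V. \<integral>\<psi>. rough_paths K v \<psi> \<partial>gibbs n U)"
      unfolding D_def by (rule Bochner_Integration.integral_sum) (rule rough_paths_integral)
    also have "\<dots> \<le> (\<Sum>v\<in>V. (1 / 2) ^ K)" by (intro sum_mono rough_paths_integral)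
    finally show ?thesis by (simp add: card_torus_V)
  qed
  \<comment> \<open>The 600 is the bound 300 once for each end of an edge; the 8 is the factor 2 of
    \<open>(x + y)\<^sup>2 \<le> 2 * (x\<^sup>2 + y\<^sup>2)\<close> times the degree 4.\<close>
  have EC: "(\<integral>\<psi>. C \<psi> \<partial>gibbs n U) \<le> 8 * (2 + 600 * cost_const) * (\<Sum>v\<in>V. (\<alpha> v)\<^sup>2)"
  proof -
    have cc: "0 \<le> cost_const" using cost_const_ge by simp
    have "(\<integral>\<psi>. C \<psi> \<partial>gibbs n U) = (\<Sum>e\<in>E. \<integral>\<psi>. (edge_scale e)\<^sup>2 * (2 + cost_const * (expected_cost \<psi> (fst e) + expected_cost \<psi> (snd e))) \<partial>gibbs n U)"
      unfolding C_def
      by (intro Bochner_Integration.integral_sum integrable_mult_right Bochner_Integration.integrable_add expected_cost_integral integrable_const)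
    also have "\<dots> = (\<Sum>e\<in>E. (edge_scale e)\<^sup>2 * (2 + cost_const * ((\<integral>\<psi>. expected_cost \<psi> (fst e) \<partial>gibbs n U) + (\<integral>\<psi>. expected_cost \<psi> (snd e) \<partial>gibbs n U))))"
      using expected_cost_integral(1) by (intro sum.cong refl) (simp add: prob_space[simplified])
    also have "\<dots> \<le> (\<Sum>e\<in>E. (edge_scale e)\<^sup>2 * (2 + cost_const * (300 + 300)))"
      using cc by (intro sum_mono mult_left_mono add_mono expected_cost_integral(2)) auto
    also have "\<dots> \<le> (\<Sum>e\<in>E. (2 * ((\<alpha> (fst e))\<^sup>2 + (\<alpha> (snd e))\<^sup>2)) * (2 + cost_const * (300 + 300)))"
    proof (intro sum_mono mult_right_mono)
      fix e
      show "(edge_scale e)\<^sup>2 \<le> 2 * ((\<alpha> (fst e))\<^sup>2 + (\<alpha> (snd e))\<^sup>2)"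
        using sum_squares_bound[of "\<alpha> (fst e)" "\<alpha> (snd e)"] by (simp add: edge_scale_def power2_sum)
    qed (use cc in auto)
    also have "\<dots> = (2 + 600 * cost_const) * 2 * (\<Sum>e\<in>E. (\<alpha> (fst e))\<^sup>2 + (\<alpha> (snd e))\<^sup>2)"
      unfolding sum_distrib_left by (intro sum.cong refl) (simp add: algebra_simps)
    also have "\<dots> \<le> (2 + 600 * cost_const) * 2 * (4 * (\<Sum>v\<in>V. (\<alpha> v)\<^sup>2))"
      using cc by (intro mult_left_mono sum_over_edges_le) auto
    finally show ?thesis by (simp add: algebra_simps)
  qed
  have "ennreal (\<integral>\<psi>. T \<psi> \<partial>gibbs n U) = (\<integral>\<^sup>+\<psi>. ennreal (T \<psi>) \<partial>gibbs n U)"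
    using T0 by (intro nn_integral_eq_integral[symmetric] intT) auto
  also have "\<dots> \<le> ennreal (exp B / 2 * (l * P Hp + P Hm / l))"
    unfolding T_def by (rule transport_integral[OF assms(1-4) Hp Hm])
  finally have ET: "(\<integral>\<psi>. T \<psi> \<partial>gibbs n U) \<le> exp B / 2 * (l * P Hp + P Hm / l)"
    using l by (subst (asm) ennreal_le_iff) auto
  have "P A = (\<integral>\<psi>. indicator A \<psi> \<partial>gibbs n U)" by simp
  also have "\<dots> \<le> (\<integral>\<psi>. T \<psi> + D \<psi> + C \<psi> / B \<partial>gibbs n U)"
    using pt intT intD intC by (intro integral_mono) (auto intro!: integrable_real_indicator simp: less_top[symmetric])
  also have "\<dots> = (\<integral>\<psi>. T \<psi> \<partial>gibbs n U) + (\<integral>\<psi>. D \<psi> \<partial>gibbs n U) + (\<integral>\<psi>. C \<psi> \<partial>gibbs n U) / B"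
    using intT intD intC by simp
  also have "\<dots> \<le> exp B / 2 * (l * P Hp + P Hm / l) + 4 * (real n)\<^sup>2 * (1 / 2) ^ K
      + 8 * (2 + 600 * cost_const) * (\<Sum>v\<in>V. (\<alpha> v)\<^sup>2) / B"
    using ET ED EC B by (intro add_mono divide_right_mono) auto
  finally show ?thesis .
qed

end

section \<open>The logarithmic profile\<close>

locale log_profile =
  fixes m h :: real
  assumes m_large: "131072 \<le> m" and h_pos: "0 < h"
begin

text \<open>The inner radius is to exceed the maximal path length, which will be at most
  \<open>5 * sqrt m + 3\<close>. The outer radius keeps the whole cluster of a vertex at distance
  \<open>m\<close> in the region where the profile equals \<open>h\<close>. Their ratio is still of
  order \<open>sqrt m\<close>, so its logarithm is comparable with
  \<open>ln (1 + m)\<close>.\<close>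

definition inner_radius :: real where "inner_radius = 8 * sqrt m"
definition outer_radius :: real where "outer_radius = m / 2"
definition log_ratio :: real where "log_ratio = ln (outer_radius / inner_radius)"
definition clip :: "real \<Rightarrow> real" where "clip r = max inner_radius (min r outer_radius)"
definition profile :: "vertex \<Rightarrow> real" where "profile v = h * ln (clip (l1norm v) / inner_radius) / log_ratio"
text \<open>The radial derivative of the profile is \<open>h / (log_ratio * r)\<close>. One factor 2
  covers base points up to \<open>inner_radius\<close> closer to the origin, another one radii
  between \<open>outer_radius\<close> and \<open>m\<close>, where \<open>clip\<close> is smaller
  than the radius.\<close>

definition slope :: "vertex \<Rightarrow> real" where
  "slope v = (if l1norm v \<le> m then 4 * (h / log_ratio) / max inner_radius (l1norm v) else 0)"

lemma sqrt_m: "256 \<le> sqrt m" "sqrt m * sqrt m = m"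
proof -
  have "sqrt (256\<^sup>2) \<le> sqrt m" using m_large by (intro real_sqrt_le_mono) simp
  then show "256 \<le> sqrt m" by simp
  show "sqrt m * sqrt m = m" using m_large by simp
qed

lemma inner_pos: "0 < inner_radius" "1 \<le> inner_radius"
  using sqrt_m(1) m_large by (auto simp: inner_radius_def)

lemma inner_le_outer: "inner_radius \<le> outer_radius"
proof -
  have "16 * sqrt m \<le> sqrt m * sqrt m" using sqrt_m(1) m_large by (intro mult_right_mono) auto
  then show ?thesis using sqrt_m(2) by (simp add: inner_radius_def outer_radius_def)
qed

text \<open>The fourth power of \<open>sqrt m / 16\<close> is \<open>m * m / 65536\<close>, and
  \<open>131072 = 2 * 65536\<close> is chosen so that this is at least \<open>2 * m\<close>, hence
  at least \<open>1 + m\<close>.\<close>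

lemma log_ratio_ge: "ln (1 + m) / 4 \<le> log_ratio"
proof -
  have "outer_radius / inner_radius = sqrt m / 16"
    using sqrt_m m_large by (simp add: inner_radius_def outer_radius_def real_div_sqrt)
  then have "4 * log_ratio = 4 * ln (sqrt m / 16)" by (simp only: log_ratio_def)
  also have "\<dots> = ln ((sqrt m / 16) ^ 4)" using ln_realpow[of "sqrt m / 16" 4] sqrt_m(1) m_large by simp
  also have "(sqrt m / 16) ^ 4 = m * m / 65536"
    using sqrt_m(2) by (simp add: power4_eq_xxxx)
  finally have *: "4 * log_ratio = ln (m * m / 65536)" .
  have "131072 * m \<le> m * m" using m_large by (intro mult_right_mono) auto
  then have "1 + m \<le> m * m / 65536" using m_large by linarith
  then have "ln (1 + m) \<le> 4 * log_ratio" unfolding * using m_large by (subst ln_le_cancel_iff) auto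
  then show ?thesis by simp
qed

lemma ln_m_ge: "1 \<le> ln (1 + m)"
proof -
  have "exp 1 \<le> 1 + m" using m_large exp_le by linarith
  then show ?thesis using m_large by (subst ln_ge_iff) auto
qed

lemma log_ratio_pos: "0 < log_ratio"
  using log_ratio_ge ln_m_ge by linarith

lemma clip_ge: "inner_radius \<le> clip r"
  by (simp add: clip_def)

lemma profile_nonneg: "0 \<le> profile v"
  using clip_ge[of "l1norm v"] inner_pos log_ratio_pos h_pos by (simp add: profile_def)

lemma profile_0: "profile (0, 0) = 0"
  using inner_pos inner_le_outer by (simp add: profile_def clip_def l1norm_def)

lemma profile_outer: "outer_radius \<le> l1norm v \<Longrightarrow> profile v = h"
  using inner_pos inner_le_outer log_ratio_pos by (simp add: profile_def clip_def log_ratio_def)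

lemma slope_nonneg: "0 \<le> slope v"
  using h_pos log_ratio_pos inner_pos by (simp add: slope_def)

lemma slope_le: "slope v \<le> 4 * (h / log_ratio) / inner_radius"
proof -
  have "4 * (h / log_ratio) / max inner_radius (l1norm v) \<le> 4 * (h / log_ratio) / inner_radius"
    using h_pos log_ratio_pos inner_pos by (intro divide_left_mono) auto
  then show ?thesis using h_pos log_ratio_pos inner_pos by (simp add: slope_def)
qed

lemma profile_slope:
  assumes d: "\<bar>l1norm v - l1norm u\<bar> \<le> d" "d \<le> inner_radius"
  shows "profile v - profile u \<le> slope v * d"
proof -
  define r where "r = l1norm v"
  define r' where "r' = l1norm u"
  have d0: "0 \<le> d" using d by linarith
  have c: "0 < clip r" "0 < clip r'" using clip_ge[of r] clip_ge[of r'] inner_pos by linarith+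
  have diff: "profile v - profile u = h / log_ratio * (ln (clip r) - ln (clip r'))"
    using c inner_pos by (simp add: profile_def r_def r'_def ln_div algebra_simps diff_divide_distrib)
  have hl: "0 \<le> h / log_ratio" using h_pos log_ratio_pos by simp
  consider "r \<le> r'" | "r' < r" "m < r" | "r' < r" "r \<le> m" by linarith
  then show ?thesis
  proof cases
    case 1
    then have "clip r \<le> clip r'" by (auto simp: clip_def)
    then have "ln (clip r) - ln (clip r') \<le> 0" using c by simp
    then have "profile v - profile u \<le> 0" unfolding diff using hl by (rule mult_nonneg_nonpos[rotated])
    also have "0 \<le> slope v * d" using slope_nonneg d0 by simp
    finally show ?thesis .
  next
    case 2
    \<comment> \<open>Beyond \<open>m\<close> the slope is zero: a step of length at most
      \<open>inner_radius \<le> m / 2\<close> stays where the profile is constant.\<close>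
    have "outer_radius \<le> r" "outer_radius \<le> r'"
      using 2 d inner_le_outer unfolding r_def[symmetric] r'_def[symmetric] by (auto simp: outer_radius_def)
    then have "profile v = h" "profile u = h" by (auto simp: r_def r'_def profile_outer)
    then show ?thesis using slope_nonneg d0 by simp
  next
    case 3
    have rr: "r - r' \<le> d" using d(1) by (simp add: r_def r'_def)
    have cl: "clip r \<le> clip r' + (r - r')" using 3 by (auto simp: clip_def)
    have "max inner_radius r / 2 \<le> clip r" using 3 inner_pos inner_le_outer by (auto simp: clip_def outer_radius_def)
    moreover have "clip r \<le> 2 * clip r'" using cl rr d(2) clip_ge[of r'] by linarith
    ultimately have q: "max inner_radius r / 4 \<le> clip r'" by linarith
    have "ln (clip r) - ln (clip r') = ln (clip r / clip r')" using c by (simp add: ln_div)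
    also have "\<dots> \<le> clip r / clip r' - 1" using c by (intro ln_le_minus_one) simp
    also have "\<dots> = (clip r - clip r') / clip r'" using c by (simp add: diff_divide_distrib)
    also have "\<dots> \<le> d / clip r'" using cl rr c by (intro divide_right_mono) auto
    also have "\<dots> \<le> d / (max inner_radius r / 4)" using q d0 inner_pos c by (intro divide_left_mono) (auto simp: less_max_iff_disj)
    finally have "profile v - profile u \<le> h / log_ratio * (d / (max inner_radius r / 4))"
      unfolding diff using hl by (rule mult_left_mono)
    also have "\<dots> = slope v * d" using 3 by (simp add: slope_def r_def)
    finally show ?thesis .
  qed
qed

text \<open>The two logarithms in the squared slope meet one logarithm from the sum of inverse
  squares. In \<open>4608 = 16 * 16 * 18\<close> the factors are the square of the 4 in
  \<open>slope\<close>, the square of the 4 in \<open>log_ratio_ge\<close>, and \<open>6 * 3\<close>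
  from the harmonic sum.\<close>

lemma sum_slope:
  assumes "m = real k"
  shows "(\<Sum>v\<in>torus_V n. (slope v)\<^sup>2) \<le> 4608 * (h\<^sup>2 / ln (1 + m))"
proof -
  define L where "L = ln (1 + m)"
  define \<kappa> where "\<kappa> = h / log_ratio"
  have L: "1 \<le> L" using ln_m_ge by (simp add: L_def)
  have \<kappa>: "0 \<le> \<kappa>" using h_pos log_ratio_pos by (simp add: \<kappa>_def)
  let ?A = "{v. v \<in> torus_V n \<and> l1norm v \<le> real k}"
  have "(\<Sum>v\<in>torus_V n. (slope v)\<^sup>2) = (\<Sum>v\<in>?A. (slope v)\<^sup>2)"
    using finite_torus_V unfolding assms[symmetric] by (intro sum.mono_neutral_right) (auto simp: slope_def)
  also have "\<dots> \<le> (\<Sum>v\<in>?A. 16 * \<kappa>\<^sup>2 * (1 / (max 1 (l1norm v))\<^sup>2))"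
  proof (intro sum_mono)
    fix v assume "v \<in> ?A"
    then have "l1norm v \<le> m" using assms by simp
    then have "slope v = 4 * \<kappa> / max inner_radius (l1norm v)" by (simp add: slope_def \<kappa>_def)
    also have "\<dots> \<le> 4 * \<kappa> / max 1 (l1norm v)"
      using inner_pos \<kappa> by (intro divide_left_mono) (auto simp: less_max_iff_disj)
    finally have "(slope v)\<^sup>2 \<le> (4 * \<kappa> / max 1 (l1norm v))\<^sup>2" using slope_nonneg by (intro power_mono) auto
    then show "(slope v)\<^sup>2 \<le> 16 * \<kappa>\<^sup>2 * (1 / (max 1 (l1norm v))\<^sup>2)" by (simp add: power_divide power_mult_distrib)
  qed
  also have "\<dots> = 16 * \<kappa>\<^sup>2 * (\<Sum>v\<in>?A. 1 / (max 1 (l1norm v))\<^sup>2)" by (rule sum_distrib_left[symmetric])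
  also have "\<dots> \<le> 16 * \<kappa>\<^sup>2 * (6 * (2 + ln (real k)))"
    using m_large assms by (intro mult_left_mono sum_inverse_square_l1norm) auto
  also have "\<dots> \<le> 16 * (4 * h / L)\<^sup>2 * (6 * (3 * L))"
  proof (intro mult_mono power_mono)
    have "\<kappa> \<le> h / (L / 4)" unfolding \<kappa>_def L_def
      using log_ratio_ge h_pos L log_ratio_pos by (intro divide_left_mono) (auto simp: L_def)
    then show "\<kappa> \<le> 4 * h / L" by (simp add: mult.commute)
    have "ln (real k) \<le> L" unfolding L_def assms[symmetric] using m_large by simp
    then show "2 + ln (real k) \<le> 3 * L" using L by linarith
  qed (use \<kappa> L m_large assms in auto)
  also have "\<dots> = 4608 * (h\<^sup>2 / L)" using L by (simp add: power2_eq_square)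
  finally show ?thesis by (simp add: L_def)
qed

end

text \<open>From \<open>5 * ln 2 \<ge> 3\<close> the power is at most \<open>1 / n ^ 3\<close>, and
  the extra 2 in the exponent cancels the factor 4.\<close>

lemma pow_half_bound:
  assumes "2 \<le> n"
  shows "4 * (real n)\<^sup>2 * (1 / 2) ^ (nat \<lceil>5 * ln (real n)\<rceil> + 2) \<le> 1 / real n"
proof -
  define k where "k = nat \<lceil>5 * ln (real n)\<rceil>"
  have ln0: "0 \<le> ln (real n)" using assms by simp
  have "5 * ln (real n) \<le> real k" unfolding k_def using ln0 by linarith
  then have "5 * ln (real n) * (2 / 3) \<le> real k * ln 2"
    using ln2_ge_two_thirds ln0 by (intro mult_mono) auto
  then have "3 * ln (real n) \<le> real k * ln 2" using ln0 by linarith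
  then have "exp (3 * ln (real n)) \<le> exp (real k * ln 2)" by simp
  moreover have "exp (3 * ln (real n)) = real n ^ 3"
    using assms exp_of_nat_mult[of 3 "ln (real n)"] by simp
  moreover have "exp (real k * ln 2) = 2 ^ k" by (simp add: exp_of_nat_mult)
  ultimately have "real n ^ 3 \<le> 2 ^ k" by simp
  then have "(real n)\<^sup>2 * real n \<le> 2 ^ k" by (simp add: power3_eq_cube power2_eq_square)
  then show ?thesis unfolding k_def[symmetric] using assms
    by (simp add: power_add power_one_over field_simps power2_eq_square)
qed

section \<open>Shift inequality for the height at one vertex\<close>

context surface_potential begin

definition prob_field :: "nat \<Rightarrow> vertex \<Rightarrow> real set \<Rightarrow> real" where
  "prob_field n v S = measure (gibbs n U) {\<psi> \<in> space (gibbs n U). field \<psi> v \<in> S}"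

text \<open>The 80 in the condition on \<open>h\<close> comes from
  \<open>slope u * real K \<le> \<epsilon> / 8\<close>, after inserting
  \<open>K \<le> 5 * (1 + ln n)\<close>, the inner radius \<open>8 * sqrt m\<close> and
  \<open>log_ratio \<ge> ln (1 + m) / 4\<close>. The constant depends on the potential and on
  \<open>\<epsilon>\<close> only, because \<open>Q\<close> is fixed before \<open>n\<close>.\<close>

lemma delocalization_inequality:
  assumes \<epsilon>: "0 < \<epsilon>" "\<epsilon> \<le> 1 / 2"
  obtains C where "0 < C"
    "\<And>n v h (B :: real) l (S :: real set) (Sp :: real set) (Sm :: real set). 2 \<le> n \<Longrightarrow> controlled_gradients n U (1 / 8) (1 - \<epsilon>) \<Longrightarrow> v \<in> torus_V n \<Longrightarrow>
      (ln (real n))\<^sup>2 \<le> l1norm v \<Longrightarrow> 131072 \<le> l1norm v \<Longrightarrow> 0 < h \<Longrightarrow>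
      80 * h * (1 + ln (real n)) \<le> \<epsilon> * sqrt (l1norm v) * ln (1 + l1norm v) \<Longrightarrow> 0 < B \<Longrightarrow> 0 < l \<Longrightarrow>
      S \<in> sets borel \<Longrightarrow> Sp \<in> sets borel \<Longrightarrow> Sm \<in> sets borel \<Longrightarrow>
      (\<And>x. x \<in> S \<Longrightarrow> x + h \<in> Sp \<and> x - h \<in> Sm) \<Longrightarrow>
      prob_field n v S \<le> exp B / 2 * (l * prob_field n v Sp + prob_field n v Sm / l) + 1 / real n
        + C * (h\<^sup>2 / ln (1 + l1norm v)) / B"
proof -
  obtain Q where Q: "0 \<le> Q" "\<And>x d. \<bar>x\<bar> + \<bar>d\<bar> < 1 \<Longrightarrow> (b x)\<^sup>2 \<le> exp (Q * d\<^sup>2) * (b (x + d) * b (x - d))"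
    using second_difference by blast
  define cc where "cc = 2 + (16 / \<epsilon>\<^sup>2 + (16 / \<epsilon>\<^sup>2)\<^sup>2) + Q"
  have cc: "0 < cc" using Q(1) by (simp add: cc_def add_pos_nonneg)
  show ?thesis
  proof (rule that)
    show "0 < 8 * (2 + 600 * cc) * 4608" using cc by simp
    fix n :: nat and v :: vertex and h B l :: real and S Sp Sm :: "real set"
    assume n: "2 \<le> n" and ctrl: "controlled_gradients n U (1 / 8) (1 - \<epsilon>)" and v: "v \<in> torus_V n"
      and ln_n: "(ln (real n))\<^sup>2 \<le> l1norm v" and m: "131072 \<le> l1norm v" and h: "0 < h"
      and h_small: "80 * h * (1 + ln (real n)) \<le> \<epsilon> * sqrt (l1norm v) * ln (1 + l1norm v)"
      and B: "0 < B" and l: "0 < l"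
      and meas [measurable]: "S \<in> sets borel" "Sp \<in> sets borel" "Sm \<in> sets borel"
      and SS: "\<And>x. x \<in> S \<Longrightarrow> x + h \<in> Sp \<and> x - h \<in> Sm"
    interpret log_profile "l1norm v" h by standard (use m h in auto)
    \<comment> \<open>Long enough to beat the number of starting points, short enough to stay below
      \<open>inner_radius\<close>; the latter relies on
      \<open>ln n \<le> sqrt (l1norm v)\<close>.\<close>
    define K where "K = nat \<lceil>5 * ln (real n)\<rceil> + 2"
    have ln0: "0 \<le> ln (real n)" using n by simp
    have ln_sqrt: "ln (real n) \<le> sqrt (l1norm v)" using ln_n ln0 real_le_rsqrt by blast
    have K_le: "real K \<le> 5 * ln (real n) + 3" unfolding K_def using ln0 by linarith
    have K_inner: "real K \<le> inner_radius" unfolding inner_radius_def using K_le ln_sqrt sqrt_m by linarith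
    have K2: "2 \<le> K" by (simp add: K_def)
    have slopeK: "slope u * real K \<le> \<epsilon> / 8" for u
    proof -
      have "32 * h * real K \<le> 32 * h * (5 * (1 + ln (real n)))" using K_le ln0 h by (intro mult_left_mono) auto
      also have "\<dots> = 2 * (80 * h * (1 + ln (real n)))" by simp
      also have "\<dots> \<le> 2 * (\<epsilon> * sqrt (l1norm v) * ln (1 + l1norm v))" using h_small by simp
      also have "\<dots> = \<epsilon> * inner_radius * (ln (1 + l1norm v) / 4)" by (simp add: inner_radius_def)
      also have "\<dots> \<le> \<epsilon> * inner_radius * log_ratio" using log_ratio_ge \<epsilon> inner_pos by (intro mult_left_mono) auto
      finally have "32 * h * real K \<le> \<epsilon> * inner_radius * log_ratio" .
      then have "4 * (h / log_ratio) / inner_radius * real K \<le> \<epsilon> / 8"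
        using inner_pos log_ratio_pos by (simp add: field_simps)
      moreover have "slope u * real K \<le> 4 * (h / log_ratio) / inner_radius * real K"
        using slope_le by (intro mult_right_mono) auto
      ultimately show ?thesis by linarith
    qed
    interpret random_shift U M n \<epsilon> Q profile slope K
    proof
      fix u w :: vertex and k :: nat
      assume k: "k < K" and lu: "\<bar>l1norm u - l1norm w\<bar> \<le> real k + 1"
      have "real k + 1 \<le> inner_radius" using k K_inner by linarith
      then show "profile u - profile w \<le> slope u * (real k + 1)" by (rule profile_slope[OF lu])
    next
      fix u
      have "slope u * 2 \<le> slope u * real K" using K2 slope_nonneg by (intro mult_left_mono) auto
      then show "slope u \<le> 1 / 4" using slopeK[of u] \<epsilon> by linarith
    qed (use \<epsilon> Q ctrl profile_nonneg profile_0 slope_nonneg slopeK in auto)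
    have s_v: "s \<omega> v = h" if \<omega>: "\<omega> \<subseteq> torus_E n" "small_clusters \<omega>" for \<omega>
    proof -
      have fin: "finite \<omega>" using \<omega>(1) finite_torus_E finite_subset by blast
      obtain u where u: "u \<in> cluster \<omega> v" "s \<omega> v = profile u" using cluster_min_attained[OF fin] by blast
      have "\<not> has_path (torus_E n) \<omega> K v" using \<omega>(2) v by (simp add: small_clusters_def)
      then obtain k where k: "k < K" "(v, u) \<in> adj_rel \<omega> ^^ k"
        using cluster_path[OF \<omega>(1) finite_torus_E u(1)] by blast
      have "\<bar>l1norm v - l1norm u\<bar> \<le> real k" by (rule l1norm_relpow[OF \<omega>(1) k(2)])
      then have "outer_radius \<le> l1norm u" using k(1) K_inner inner_le_outer unfolding outer_radius_def by linarith
      then show ?thesis using u(2) by (simp add: profile_outer)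
    qed
    note [measurable] = measurable_field[OF v]
    define ev where "ev S = {\<psi> \<in> space (ref_measure n). field \<psi> v \<in> S}" for S
    have ev: "ev S \<in> sets (ref_measure n)" if [measurable]: "S \<in> sets borel" for S unfolding ev_def by measurable
    have tr: "translate n t \<psi> \<in> space (ref_measure n)" for t \<psi> 
      by (simp add: translate_def ref_measure_def space_PiM)
    have "P (ev S) \<le> exp B / 2 * (l * P (ev Sp) + P (ev Sm) / l) + 4 * (real n)\<^sup>2 * (1 / 2) ^ K
      + 8 * (2 + 600 * cost_const) * (\<Sum>u\<in>torus_V n. (slope u)\<^sup>2) / B"
    proof (rule shift_inequality[OF ev[OF meas(1)] ev[OF meas(2)] ev[OF meas(3)] l B])
      fix \<omega> \<psi> assume \<omega>: "\<omega> \<subseteq> torus_E n" "small_clusters \<omega>" and \<psi>: "\<psi> \<in> ev S"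
      have fin: "finite \<omega>" using \<omega>(1) finite_torus_E finite_subset by blast
      show "translate n (s \<omega>) \<psi> \<in> ev Sp" "translate n (\<lambda>v. - s \<omega> v) \<psi> \<in> ev Sm"
        using \<psi> SS[of "field \<psi> v"] tr v s_v[OF \<omega>] s_0[OF fin] by (auto simp: ev_def field_translate)
    qed
    moreover have "4 * (real n)\<^sup>2 * (1 / 2) ^ K \<le> 1 / real n" unfolding K_def by (rule pow_half_bound[OF n])
    moreover have "8 * (2 + 600 * cost_const) * (\<Sum>u\<in>torus_V n. (slope u)\<^sup>2) / B
      \<le> 8 * (2 + 600 * cc) * 4608 * (h\<^sup>2 / ln (1 + l1norm v)) / B"
    proof (rule divide_right_mono)
      have k: "l1norm v = real (nat (\<bar>fst v\<bar> + \<bar>snd v\<bar>))" by (simp add: l1norm_def)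
      have "8 * (2 + 600 * cc) * (\<Sum>u\<in>torus_V n. (slope u)\<^sup>2) \<le> 8 * (2 + 600 * cc) * (4608 * (h\<^sup>2 / ln (1 + l1norm v)))"
        using cc by (intro mult_left_mono sum_slope[OF k]) auto
      then show "8 * (2 + 600 * cost_const) * (\<Sum>u\<in>torus_V n. (slope u)\<^sup>2) \<le> 8 * (2 + 600 * cc) * 4608 * (h\<^sup>2 / ln (1 + l1norm v))"
        by (simp only: cost_const_def cc_def[symmetric] mult.assoc)
    qed (use B in simp)
    ultimately have "P (ev S) \<le> exp B / 2 * (l * P (ev Sp) + P (ev Sm) / l) + 1 / real n
      + 8 * (2 + 600 * cc) * 4608 * (h\<^sup>2 / ln (1 + l1norm v)) / B" by linarith
    then show "prob_field n v S \<le> exp B / 2 * (l * prob_field n v Sp + prob_field n v Sm / l) + 1 / real n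
      + 8 * (2 + 600 * cc) * 4608 * (h\<^sup>2 / ln (1 + l1norm v)) / B"
      by (simp add: prob_field_def ev_def)
  qed
qed

end

section \<open>Delocalization\<close>

text \<open>\<open>shift_bound\<close> is the conclusion of the transport argument for the law \<open>\<pi>\<close> of the height
  at one vertex, with \<open>L\<close> in the role of \<open>ln (1 + l1norm v)\<close>.\<close>
definition shift_bound :: "real measure \<Rightarrow> real \<Rightarrow> real \<Rightarrow> real \<Rightarrow> real \<Rightarrow> bool" where
  "shift_bound \<pi> C L q h \<longleftrightarrow> (\<forall>B l S Sp Sm. 0 < B \<longrightarrow> 0 < l \<longrightarrow>
    S \<in> sets borel \<longrightarrow> Sp \<in> sets borel \<longrightarrow> Sm \<in> sets borel \<longrightarrow>
    (\<forall>x\<in>S. x + h \<in> Sp \<and> x - h \<in> Sm) \<longrightarrow>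
    measure \<pi> S \<le> exp B / 2 * (l * measure \<pi> Sp + measure \<pi> Sm / l) + q + C * (h\<^sup>2 / L) / B)"

lemma shift_boundD:
  assumes "shift_bound \<pi> C L q h" "0 < B" "0 < l"
    "S \<in> sets borel" "Sp \<in> sets borel" "Sm \<in> sets borel" "\<And>x. x \<in> S \<Longrightarrow> x + h \<in> Sp \<and> x - h \<in> Sm"
  shows "measure \<pi> S \<le> exp B / 2 * (l * measure \<pi> Sp + measure \<pi> Sm / l) + q + C * (h\<^sup>2 / L) / B"
  using assms unfolding shift_bound_def by blast

text \<open>The half line of mass at least 1/2 is shifted, and its downward translate is bounded
  trivially by 1. The choice of \<open>B\<close> makes the loss term 1/8, the weight
  \<open>4 * exp B\<close> makes the trivial term at most 1/8, and \<open>q\<close> is at most 1/8;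
  the remaining 1/8 bounds \<open>2 * exp (2 * B)\<close> times the tail from below.\<close>

lemma tail_lower_bound:
  assumes \<pi>: "prob_space \<pi>" and C: "0 < C" and L: "0 < L" and q: "q \<le> 1 / 8" and t: "1 \<le> t"
    and half: "1 / 2 \<le> measure \<pi> {0..}" and bound: "shift_bound \<pi> C L q (t * sqrt L)"
  shows "exp (- (16 * C * t\<^sup>2)) / 16 \<le> measure \<pi> {t * sqrt L..}"
proof -
  interpret prob_space \<pi> by fact
  define h where "h = t * sqrt L"
  define B where "B = 8 * C * t\<^sup>2"
  have h: "0 < h" using t L by (simp add: h_def)
  have B: "0 < B" using C t by (simp add: B_def)
  have "prob {0..} \<le> exp B / 2 * (4 * exp B * prob {h..} + prob UNIV / (4 * exp B)) + q + C * (h\<^sup>2 / L) / B"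
    using bound B h unfolding h_def[symmetric] by (intro shift_boundD) auto
  moreover have "h\<^sup>2 / L = t\<^sup>2" using L by (simp add: h_def power_mult_distrib)
  then have "C * (h\<^sup>2 / L) / B = 1 / 8" using C t by (simp add: B_def)
  moreover have "exp B / 2 * (4 * exp B * prob {h..} + prob UNIV / (4 * exp B)) \<le> 2 * exp (2 * B) * prob {h..} + 1 / 8"
  proof -
    have "exp B / 2 * (4 * exp B * prob {h..} + prob UNIV / (4 * exp B)) = 2 * (exp B * exp B) * prob {h..} + prob UNIV / 8"
      by (simp add: field_simps)
    moreover have "exp (2 * B) = exp B * exp B" by (simp add: exp_double power2_eq_square)
    ultimately show ?thesis using prob_le_1[of UNIV] by simp
  qed
  ultimately have "1 / 8 \<le> 2 * exp (2 * B) * prob {h..}" using half q by linarith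
  then have "exp (- (2 * B)) / 16 \<le> prob {h..}" by (simp add: exp_minus field_simps)
  then show ?thesis by (simp add: B_def h_def mult.assoc)
qed

lemma sum_measure_translates_le_1:
  assumes \<pi>: "prob_space \<pi>" "sets \<pi> = sets borel" and r: "0 < r" and c: "c = 1 \<or> c = - 1"
  shows "(\<Sum>j\<in>{1..N}. measure \<pi> {c * (3 * r * real j) - r..c * (3 * r * real j) + r}) \<le> 1"
proof -
  interpret prob_space \<pi> by fact
  let ?I = "\<lambda>j. {c * (3 * r * real j) - r..c * (3 * r * real j) + r}"
  have disj: "disjoint_family_on ?I {1..N}"
    unfolding disjoint_family_on_def
  proof (intro ballI impI)
    fix i j :: nat assume "i \<noteq> j"
    have lt: "?I i \<inter> ?I j = {}" if "i < j" for i j :: nat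
    proof -
      have "real i + 1 \<le> real j" using that by linarith
      then have "3 * r * (real i + 1) \<le> 3 * r * real j" using r by (intro mult_left_mono) auto
      then have "3 * r * real i + 3 * r \<le> 3 * r * real j" by (simp add: distrib_left)
      then show ?thesis using c r by auto
    qed
    show "?I i \<inter> ?I j = {}" using lt[of i j] lt[of j i] \<open>i \<noteq> j\<close> by (cases "i < j") auto
  qed
  have "?I ` {1..N} \<subseteq> sets \<pi>" unfolding \<pi>(2)
    by (rule image_subsetI) (rule borel_closed[OF closed_atLeastAtMost])
  then have "(\<Sum>j\<in>{1..N}. prob (?I j)) = prob (\<Union>j\<in>{1..N}. ?I j)"
    using disj by (rule finite_measure_finite_Union[symmetric, OF finite_atLeastAtMost])
  also have "\<dots> \<le> 1" by (rule prob_le_1)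
  finally show ?thesis .
qed

text \<open>The shift inequality is averaged over the heights \<open>3 * r * j\<close> with
  \<open>j = 1, ..., N\<close>, whose translated balls are disjoint. This gives a term of order
  \<open>1 / N\<close> and a loss of order \<open>(r * N)\<^sup>2 / L\<close>. They balance for
  \<open>N\<close> of order \<open>1 / y\<^sup>2\<close>, which is the origin of the exponent
  \<open>2 / 3\<close>.\<close>

lemma small_ball_bound:
  assumes \<pi>: "prob_space \<pi>" "sets \<pi> = sets borel" and C: "0 < C" and L: "1 \<le> L" and q: "q \<le> 2 / L" and r: "1 \<le> r"
    and bound: "\<And>h. 0 < h \<Longrightarrow> h \<le> sqrt L \<Longrightarrow> shift_bound \<pi> C L q h"
  shows "measure \<pi> {- r..r} \<le> (C + 20) * (r / sqrt L) powr (2 / 3)"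
proof -
  interpret prob_space \<pi> by fact
  define y where "y = (r / sqrt L) powr (1 / 3)"
  have sL: "0 < sqrt L" "1 \<le> sqrt L" using L by auto
  have rL: "0 < r / sqrt L" using r sL by simp
  have y0: "0 < y" using r L by (auto simp: y_def)
  have y3: "y ^ 3 = r / sqrt L"
  proof -
    have "y ^ 3 = y powr 3" using y0 by simp
    also have "\<dots> = (r / sqrt L) powr (1 / 3 * 3)" unfolding y_def by (rule powr_powr)
    also have "\<dots> = (r / sqrt L) powr 1" by simp
    also have "\<dots> = r / sqrt L" by (rule powr_one[OF less_imp_le[OF rL]])
    finally show ?thesis .
  qed
  have y2: "y\<^sup>2 = (r / sqrt L) powr (2 / 3)"
  proof -
    have "y\<^sup>2 = y powr 2" using y0 by simp
    also have "\<dots> = (r / sqrt L) powr (1 / 3 * 2)" unfolding y_def by (rule powr_powr)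
    finally show ?thesis by simp
  qed
  have ry: "r = sqrt L * y ^ 3" using y3 sL by simp
  show ?thesis
  proof (cases "y \<le> 1 / 4")
    case False
    \<comment> \<open>In this case the claimed bound is at least 1.\<close>
    then have "(1 / 4)\<^sup>2 \<le> y\<^sup>2" by (intro power_mono) auto
    then have "1 \<le> 16 * y\<^sup>2" by (simp add: power2_eq_square)
    also have "\<dots> \<le> (C + 20) * y\<^sup>2" using C by (intro mult_right_mono) auto
    finally show ?thesis using prob_le_1[of "{- r..r}"] unfolding y2 by linarith
  next
    case True
    \<comment> \<open>The 3 makes every shift at most
      \<open>3 * r * N \<le> r / y\<^sup>2 = sqrt L * y\<close>; rounding down loses at most a
      factor 2 because \<open>y \<le> 1 / 4\<close>.\<close>
    define N where "N = nat \<lfloor>1 / (3 * y\<^sup>2)\<rfloor>"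
    have yy: "0 < y\<^sup>2" using y0 by simp
    have "y * y \<le> 1 / 4 * (1 / 4)" using True y0 by (intro mult_mono) auto
    then have "y\<^sup>2 \<le> 1 / 16" by (simp add: power2_eq_square)
    then have big: "16 / 3 \<le> 1 / (3 * y\<^sup>2)" using yy by (simp add: field_simps)
    have N_up: "real N \<le> 1 / (3 * y\<^sup>2)" unfolding N_def using big by linarith
    have "1 / (3 * y\<^sup>2) - 1 \<le> real N" unfolding N_def using big by linarith
    moreover have "1 / (6 * y\<^sup>2) = 1 / (3 * y\<^sup>2) / 2" by simp
    ultimately have N_lo: "1 / (6 * y\<^sup>2) \<le> real N" using big by linarith
    have N0: "0 < real N" using N_lo yy by (meson divide_pos_pos less_le_trans mult_pos_pos zero_less_numeral zero_less_one)
    define Ip where "Ip j = {1 * (3 * r * real j) - r..1 * (3 * r * real j) + r}" for j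
    define Im where "Im j = {(- 1) * (3 * r * real j) - r..(- 1) * (3 * r * real j) + r}" for j
    have each: "prob {- r..r} \<le> exp 1 / 2 * (prob (Ip j) + prob (Im j)) + (q + C * y\<^sup>2)" if j: "j \<in> {1..N}" for j
    proof -
      define h where "h = 3 * r * real j"
      have h0: "0 < h" using j r by (simp add: h_def)
      have "h \<le> 3 * r * real N" unfolding h_def using j r by (intro mult_left_mono) auto
      also have "\<dots> \<le> 3 * r * (1 / (3 * y\<^sup>2))" using N_up r by (intro mult_left_mono) auto
      also have "\<dots> = sqrt L * y" unfolding ry using y0 by (simp add: power2_eq_square power3_eq_cube)
      finally have hy: "h \<le> sqrt L * y" .
      also have "\<dots> \<le> sqrt L * 1" using True sL by (intro mult_left_mono) auto
      finally have "shift_bound \<pi> C L q h" using h0 by (intro bound) auto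
      then have "prob {- r..r} \<le> exp 1 / 2 * (1 * prob (Ip j) + prob (Im j) / 1) + q + C * (h\<^sup>2 / L) / 1"
        by (rule shift_boundD) (auto simp: Ip_def Im_def h_def)
      moreover have "h\<^sup>2 \<le> (sqrt L * y)\<^sup>2" using hy h0 by (intro power_mono) auto
      then have "h\<^sup>2 / L \<le> y\<^sup>2" using L by (simp add: power_mult_distrib field_simps)
      then have "C * (h\<^sup>2 / L) \<le> C * y\<^sup>2" using C by (intro mult_left_mono) auto
      ultimately show ?thesis by simp
    qed
    have "real N * prob {- r..r} = (\<Sum>j\<in>{1..N}. prob {- r..r})" by simp
    also have "\<dots> \<le> (\<Sum>j\<in>{1..N}. exp 1 / 2 * (prob (Ip j) + prob (Im j)) + (q + C * y\<^sup>2))"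
      using each by (rule sum_mono)
    also have "\<dots> = exp 1 / 2 * ((\<Sum>j\<in>{1..N}. prob (Ip j)) + (\<Sum>j\<in>{1..N}. prob (Im j))) + real N * (q + C * y\<^sup>2)"
      by (simp only: sum.distrib sum_distrib_left[symmetric] sum_constant card_atLeastAtMost) (simp add: algebra_simps)
    also have "\<dots> \<le> exp 1 / 2 * (1 + 1) + real N * (q + C * y\<^sup>2)"
      unfolding Ip_def Im_def using r
      by (intro add_right_mono mult_left_mono add_mono sum_measure_translates_le_1[OF \<pi>]) auto
    also have "\<dots> = real N * (exp 1 / real N + (q + C * y\<^sup>2))" using N0 by (simp add: distrib_left)
    finally have "prob {- r..r} \<le> exp 1 / real N + (q + C * y\<^sup>2)" using N0 by (simp only: mult_le_cancel_left_pos)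
    moreover have "exp 1 / real N \<le> 3 * (6 * y\<^sup>2)"
    proof -
      have "1 / real N \<le> 6 * y\<^sup>2" using N_lo N0 yy by (simp add: field_simps)
      then have "exp 1 * (1 / real N) \<le> 3 * (6 * y\<^sup>2)" using exp_le N0 by (intro mult_mono) auto
      then show ?thesis by simp
    qed
    \<comment> \<open>As \<open>1 \<le> L\<close> and \<open>1 \<le> r\<close>, the number
      \<open>1 / sqrt L\<close> is at most its own cube root, which is at most
      \<open>y\<close>.\<close>
    moreover have "q \<le> 2 * y\<^sup>2"
    proof -
      have "(1 / sqrt L) ^ 3 \<le> 1 / sqrt L" using sL power_decreasing[of 1 3 "1 / sqrt L"] by simp
      also have "\<dots> \<le> y ^ 3" unfolding y3 using r sL by (intro divide_right_mono) auto
      finally have "1 / sqrt L \<le> y" using y0 power_le_imp_le_base[of "1 / sqrt L" 2 y] by (simp add: numeral_3_eq_3)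
      then have "(1 / sqrt L)\<^sup>2 \<le> y\<^sup>2" using sL by (intro power_mono) auto
      then have "1 / L \<le> y\<^sup>2" using L by (simp add: power_divide)
      then show ?thesis using q by simp
    qed
    ultimately have "prob {- r..r} \<le> (C + 20) * y\<^sup>2" by (simp add: algebra_simps)
    then show ?thesis by (simp only: y2)
  qed
qed

section \<open>Heights far from the origin and close to it\<close>

context surface_potential begin

definition law :: "nat \<Rightarrow> vertex \<Rightarrow> real measure" where
  "law n v = distr (gibbs n U) borel (\<lambda>\<psi>. field \<psi> v)"

lemma law_facts:
  assumes v: "v \<in> torus_V n"
  shows "prob_space (law n v)" "sets (law n v) = sets borel"
    "\<And>S. S \<in> sets borel \<Longrightarrow> measure (law n v) S = prob_field n v S"
proof -
  interpret prob_space "gibbs n U" by (rule prob_space_gibbs)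
  note [measurable] = measurable_field[OF v]
  show "prob_space (law n v)" unfolding law_def by (rule prob_space_distr) measurable
  show "sets (law n v) = sets borel" by (simp add: law_def)
  fix S :: "real set" assume "S \<in> sets borel"
  then show "measure (law n v) S = prob_field n v S"
    unfolding law_def prob_field_def by (subst measure_distr) (auto intro!: arg_cong[of _ _ prob])
qed

lemma large_distance:
  assumes \<epsilon>: "0 < \<epsilon>" "\<epsilon> \<le> 1 / 2"
  obtains C R where "0 < C" "1 \<le> R"
    "\<And>n v r. 2 \<le> n \<Longrightarrow> controlled_gradients n U (1 / 8) (1 - \<epsilon>) \<Longrightarrow> v \<in> torus_V n \<Longrightarrow>
      (ln (real n))\<^sup>2 \<le> l1norm v \<Longrightarrow> R \<le> l1norm v \<Longrightarrow> 1 \<le> r \<Longrightarrow>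
      prob_field n v {- r..r} \<le> C * (r / sqrt (ln (1 + l1norm v))) powr (2 / 3)"
    "\<And>n v t. 2 \<le> n \<Longrightarrow> controlled_gradients n U (1 / 8) (1 - \<epsilon>) \<Longrightarrow> v \<in> torus_V n \<Longrightarrow>
      (ln (real n))\<^sup>2 \<le> l1norm v \<Longrightarrow> R \<le> l1norm v \<Longrightarrow> 1 \<le> t \<Longrightarrow> t \<le> (1 + sqrt (l1norm v)) / (1 + ln (real n)) \<Longrightarrow>
      exp (- C * t\<^sup>2) / 16 \<le> prob_field n v {t * sqrt (ln (1 + l1norm v))..}"
proof -
  obtain C where C: "0 < C" and deloc: "\<And>n v h (B :: real) l (S :: real set) (Sp :: real set) (Sm :: real set).
      2 \<le> n \<Longrightarrow> controlled_gradients n U (1 / 8) (1 - \<epsilon>) \<Longrightarrow> v \<in> torus_V n \<Longrightarrow>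
      (ln (real n))\<^sup>2 \<le> l1norm v \<Longrightarrow> 131072 \<le> l1norm v \<Longrightarrow> 0 < h \<Longrightarrow>
      80 * h * (1 + ln (real n)) \<le> \<epsilon> * sqrt (l1norm v) * ln (1 + l1norm v) \<Longrightarrow> 0 < B \<Longrightarrow> 0 < l \<Longrightarrow>
      S \<in> sets borel \<Longrightarrow> Sp \<in> sets borel \<Longrightarrow> Sm \<in> sets borel \<Longrightarrow>
      (\<And>x. x \<in> S \<Longrightarrow> x + h \<in> Sp \<and> x - h \<in> Sm) \<Longrightarrow>
      prob_field n v S \<le> exp B / 2 * (l * prob_field n v Sp + prob_field n v Sm / l) + 1 / real n
        + C * (h\<^sup>2 / ln (1 + l1norm v)) / B"
    using delocalization_inequality[OF \<epsilon>] by blast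
  \<comment> \<open>The first entry is the requirement of \<open>log_profile\<close>. The second
    forces \<open>160 / \<epsilon> \<le> sqrt (ln (1 + l1norm v))\<close>, which absorbs the
    \<open>\<epsilon>\<close> in the condition on \<open>h\<close>; 160 is the 80 of that condition
    times the 2 in the bound on \<open>h * (1 + ln n)\<close>.\<close>
  define R where "R = max 131072 (exp ((160 / \<epsilon>)\<^sup>2))"
  \<comment> \<open>Covers \<open>16 * C\<close> from the tail and \<open>C + 20\<close> from the
    small balls.\<close>
  define C' where "C' = 16 * C + 20"
  have R1: "1 \<le> R" by (simp add: R_def)
  have C': "0 < C'" using C by (simp add: C'_def)
  have main: "shift_bound (law n v) C (ln (1 + l1norm v)) (1 / real n) h \<and> 1 \<le> ln (1 + l1norm v) \<and> 1 / real n \<le> 2 / ln (1 + l1norm v) \<and> 8 \<le> n"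
    if n: "2 \<le> n" and ctrl: "controlled_gradients n U (1 / 8) (1 - \<epsilon>)" and v: "v \<in> torus_V n"
      and ln_n: "(ln (real n))\<^sup>2 \<le> l1norm v" and m: "R \<le> l1norm v" and h: "0 < h"
      and hm: "h * (1 + ln (real n)) \<le> 2 * sqrt (l1norm v) * sqrt (ln (1 + l1norm v))" for n v h
  proof -
    define L where "L = ln (1 + l1norm v)"
    have m1: "131072 \<le> l1norm v" "exp ((160 / \<epsilon>)\<^sup>2) \<le> l1norm v" using m by (auto simp: R_def)
    have n8: "131072 \<le> 2 * real n" using l1norm_le[OF v] m1 by linarith
    have "(160 / \<epsilon>)\<^sup>2 \<le> L" unfolding L_def using m1 by (subst ln_ge_iff) auto
    then have "sqrt ((160 / \<epsilon>)\<^sup>2) \<le> sqrt L" by (rule real_sqrt_le_mono)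
    then have e: "160 / \<epsilon> \<le> sqrt L" using \<epsilon> by simp
    have "1 \<le> 160 / \<epsilon>" using \<epsilon> by simp
    then have sL: "1 \<le> sqrt L" using e by linarith
    then have L1: "1 \<le> L" by simp
    have "160 \<le> \<epsilon> * sqrt L" using e \<epsilon> by (simp add: field_simps)
    then have "160 * (sqrt (l1norm v) * sqrt L) \<le> \<epsilon> * sqrt L * (sqrt (l1norm v) * sqrt L)"
      using m1 L1 by (intro mult_right_mono) auto
    also have "\<dots> = \<epsilon> * sqrt (l1norm v) * (sqrt L * sqrt L)" by (simp only: mult_ac)
    also have "\<dots> = \<epsilon> * sqrt (l1norm v) * L" using L1 by simp
    finally have "80 * h * (1 + ln (real n)) \<le> \<epsilon> * sqrt (l1norm v) * L"
      using hm unfolding L_def[symmetric] by linarith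
    then have sb: "shift_bound (law n v) C L (1 / real n) h"
      unfolding shift_bound_def L_def
      using deloc[OF n ctrl v ln_n m1(1) h] by (simp add: law_facts[OF v])
    have "L \<le> l1norm v" unfolding L_def using m1 ln_add_one_self_le_self by simp
    then have "L \<le> 2 * real n" using l1norm_le[OF v] by linarith
    then have "1 / real n \<le> 2 / L" using L1 n by (simp add: field_simps)
    then show ?thesis using sb L1 n8 by (simp add: L_def)
  qed
  show ?thesis
  proof (rule that[OF C' R1])
    fix n :: nat and v :: vertex and r :: real
    assume a: "2 \<le> n" "controlled_gradients n U (1 / 8) (1 - \<epsilon>)" "v \<in> torus_V n"
      "(ln (real n))\<^sup>2 \<le> l1norm v" "R \<le> l1norm v" and r: "1 \<le> r"
    define L where "L = ln (1 + l1norm v)"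
    have m1: "1 \<le> sqrt (l1norm v)" using a(5) R1 by simp
    have L0: "0 < L" using a(5) R1 by (simp add: L_def)
    have "ln (real n) \<le> sqrt (l1norm v)" using a(1,4) real_le_rsqrt by simp
    then have ln2: "0 \<le> 1 + ln (real n)" "1 + ln (real n) \<le> 2 * sqrt (l1norm v)"
      using m1 a(1) by (simp, linarith)
    have hm: "h * (1 + ln (real n)) \<le> 2 * sqrt (l1norm v) * sqrt L" if "0 < h" "h \<le> sqrt L" for h
      using mult_mono[OF that(2) ln2(2)] L0 ln2(1) by (simp add: mult_ac)
    have 1: "shift_bound (law n v) C L (1 / real n) h \<and> 1 \<le> L \<and> 1 / real n \<le> 2 / L \<and> 8 \<le> n" if "0 < h" "h \<le> sqrt L" for h
      using main[OF a that(1) hm[OF that, unfolded L_def]] by (simp add: L_def)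
    have "1 \<le> L \<and> 1 / real n \<le> 2 / L" using 1[of "sqrt L"] L0 by simp
    then have "measure (law n v) {- r..r} \<le> (C + 20) * (r / sqrt L) powr (2 / 3)"
      using C r 1 by (intro small_ball_bound[of _ C L "1 / real n"] law_facts[OF a(3)]) auto
    also have "\<dots> \<le> C' * (r / sqrt L) powr (2 / 3)" using C by (intro mult_right_mono) (auto simp: C'_def)
    finally show "prob_field n v {- r..r} \<le> C' * (r / sqrt (ln (1 + l1norm v))) powr (2 / 3)"
      by (simp add: law_facts[OF a(3)] L_def)
  next
    fix n :: nat and v :: vertex and t :: real
    assume a: "2 \<le> n" "controlled_gradients n U (1 / 8) (1 - \<epsilon>)" "v \<in> torus_V n"
      "(ln (real n))\<^sup>2 \<le> l1norm v" "R \<le> l1norm v"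
      and t: "1 \<le> t" "t \<le> (1 + sqrt (l1norm v)) / (1 + ln (real n))"
    define L where "L = ln (1 + l1norm v)"
    have m1: "1 \<le> sqrt (l1norm v)" using a(5) R1 by simp
    have L0: "0 < L" using a(5) R1 by (simp add: L_def)
    have "0 < 1 + ln (real n)" using a(1) by (simp add: add_pos_nonneg)
    then have "t * (1 + ln (real n)) \<le> 1 + sqrt (l1norm v)" using t(2) by (simp add: le_divide_eq)
    then have "t * (1 + ln (real n)) \<le> 2 * sqrt (l1norm v)" using m1 by linarith
    then have "t * (1 + ln (real n)) * sqrt L \<le> (2 * sqrt (l1norm v)) * sqrt L"
      using L0 by (intro mult_right_mono) auto
    then have hm: "t * sqrt L * (1 + ln (real n)) \<le> 2 * sqrt (l1norm v) * sqrt L" by (simp add: mult_ac)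
    have "0 < t * sqrt L" using t L0 by simp
    from main[OF a this[unfolded L_def] hm[unfolded L_def]]
    have 1: "shift_bound (law n v) C L (1 / real n) (t * sqrt L)" "8 \<le> n" by (auto simp: L_def)
    have "exp (- C' * t\<^sup>2) / 16 \<le> exp (- (16 * C * t\<^sup>2)) / 16"
      unfolding C'_def by (simp add: algebra_simps)
    also have "\<dots> \<le> measure (law n v) {t * sqrt L..}"
    proof (rule tail_lower_bound[OF law_facts(1)[OF a(3)] C L0 _ t(1) _ 1(1)])
      show "1 / real n \<le> 1 / 8" using 1(2) by simp
      show "1 / 2 \<le> measure (law n v) {0..}"
        using gibbs_half[OF a(3)] by (simp add: law_facts[OF a(3)] prob_field_def)
    qed
    finally show "exp (- C' * t\<^sup>2) / 16 \<le> prob_field n v {t * sqrt (ln (1 + l1norm v))..}"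
      by (simp add: law_facts[OF a(3)] L_def)
  qed
qed

text \<open>The bound \<open>(ln n)\<^sup>2 \<le> l1norm v < R\<close> leaves finitely many pairs
  \<open>(n, v)\<close>, so a positive minimum suffices. Positivity needs care: the potential may be
  infinite outside \<open>[-1, 1]\<close>, which confines the height at \<open>v\<close>, so the
  threshold has to stay below a fixed fraction \<open>\<rho> < 1\<close> of
  \<open>l1norm v\<close>.\<close>

lemma bounded_distance:
  fixes R :: real
  obtains c where "0 < c"
    "\<And>n v t. 2 \<le> n \<Longrightarrow> v \<in> torus_V n \<Longrightarrow> (ln (real n))\<^sup>2 \<le> l1norm v \<Longrightarrow> l1norm v < R \<Longrightarrow>
      1 \<le> t \<Longrightarrow> t \<le> (1 + sqrt (l1norm v)) / (1 + ln (real n)) \<Longrightarrow>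
      c \<le> prob_field n v {t * sqrt (ln (1 + l1norm v))..}"
proof -
  \<comment> \<open>The estimates \<open>ln (1 + k) \<le> k * ln 2\<close> for integers
    \<open>k\<close> and \<open>ln 2 \<le> ln n\<close> bound the threshold by
    \<open>\<rho> * l1norm v\<close>; that \<open>\<rho> < 1\<close> is the strict inequality of
    arithmetic and geometric means for 1 and \<open>ln 2\<close>.\<close>
  define \<rho> :: real where "\<rho> = 2 * sqrt (ln 2) / (1 + ln 2)"
  have ln2: "0 < ln (2::real)" "ln (2::real) < 1" using ln_2_less_1 by auto
  have \<rho>0: "0 \<le> \<rho>" using ln2 by (simp add: \<rho>_def)
  have \<rho>1: "\<rho> < 1"
  proof -
    have "sqrt (ln 2) < 1" using ln2 by simp
    then have "0 < (1 - sqrt (ln 2))\<^sup>2" by simp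
    then have "2 * sqrt (ln 2) < 1 + ln 2" using ln2 by (simp add: power2_diff)
    then show ?thesis unfolding \<rho>_def using ln2 by (subst divide_less_eq_1_pos) linarith+
  qed
  define N where "N = nat \<lceil>exp (sqrt R)\<rceil>"
  \<comment> \<open>The inserted pair makes it immediate that the minimum is taken over a nonempty
    set.\<close>
  define F where "F = insert (1, (0, 0)) (SIGMA n:{..N}. torus_V n)"
  define p where "p = (\<lambda>(n, v). prob_field n v {\<rho> * l1norm v..})"
  have finF: "finite F" using finite_torus_V by (simp add: F_def)
  have pos: "0 < p x" if "x \<in> F" for x
  proof -
    obtain n v where x: "x = (n, v)" by (cases x)
    have "v \<in> torus_V n" using that by (auto simp: F_def x torus_V_def)
    then show ?thesis using steep_event_positive[OF \<rho>0 \<rho>1] by (simp add: p_def x prob_field_def)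
  qed
  define c where "c = Min (p ` F)"
  have c_in: "c \<in> p ` F" unfolding c_def using finF by (intro Min_in) (auto simp: F_def)
  then have "0 < c" using pos by auto
  then show ?thesis
  proof (rule that)
    fix n :: nat and v :: vertex and t :: real
    assume n: "2 \<le> n" and v: "v \<in> torus_V n" and ln_n: "(ln (real n))\<^sup>2 \<le> l1norm v" and m: "l1norm v < R"
      and t: "1 \<le> t" "t \<le> (1 + sqrt (l1norm v)) / (1 + ln (real n))"
    interpret prob_space "gibbs n U" by (rule prob_space_gibbs)
    note [measurable] = measurable_field[OF v]
    have "ln (real n) \<le> sqrt (l1norm v)" using n ln_n real_le_rsqrt by simp
    also have "\<dots> \<le> sqrt R" using m by (intro real_sqrt_le_mono) auto
    finally have "exp (ln (real n)) \<le> exp (sqrt R)" by simp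
    then have "real n \<le> exp (sqrt R)" using n by simp
    then have "n \<le> N" unfolding N_def by linarith
    then have "(n, v) \<in> F" using v by (simp add: F_def)
    then have "c \<le> p (n, v)" unfolding c_def using finF by simp
    also have "\<dots> = prob_field n v {\<rho> * l1norm v..}" by (simp add: p_def)
    also have "\<dots> \<le> prob_field n v {t * sqrt (ln (1 + l1norm v))..}"
    proof -
      define k where "k = nat (\<bar>fst v\<bar> + \<bar>snd v\<bar>)"
      have k: "l1norm v = real k" by (simp add: k_def l1norm_def)
      have "0 < (ln (real n))\<^sup>2" using n by simp
      then have "0 < real k" using ln_n k by linarith
      then have m1: "1 \<le> l1norm v" using k by simp
      have "1 + real k \<le> 2 ^ k" using Bernoulli_inequality[of 1 k] by simp
      then have "ln (1 + real k) \<le> ln (2 ^ k)" by (subst ln_le_cancel_iff) auto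
      also have "\<dots> = real k * ln 2" by (simp add: ln_realpow)
      finally have "sqrt (ln (1 + l1norm v)) \<le> sqrt (l1norm v * ln 2)" unfolding k by (rule real_sqrt_le_mono)
      then have l: "sqrt (ln (1 + l1norm v)) \<le> sqrt (l1norm v) * sqrt (ln 2)" by (simp only: real_sqrt_mult)
      have sm: "1 \<le> sqrt (l1norm v)" using m1 by simp
      have ln2n: "ln 2 \<le> ln (real n)" using n by simp
      have "0 < 1 + ln (2::real)" "0 < 1 + ln (real n)" using ln2 ln2n by linarith+
      then have "t \<le> (1 + sqrt (l1norm v)) / (1 + ln 2)"
        using ln2n sm by (intro order_trans[OF t(2)] divide_left_mono mult_pos_pos) auto
      also have "\<dots> \<le> (2 * sqrt (l1norm v)) / (1 + ln 2)" using sm ln2 by (intro divide_right_mono) auto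
      finally have "t * sqrt (ln (1 + l1norm v)) \<le> (2 * sqrt (l1norm v)) / (1 + ln 2) * (sqrt (l1norm v) * sqrt (ln 2))"
        using l t m1 ln2 by (intro mult_mono) auto
      also have "\<dots> = \<rho> * (sqrt (l1norm v) * sqrt (l1norm v))" by (simp add: \<rho>_def)
      also have "\<dots> = \<rho> * l1norm v" using m1 by simp
      finally have "t * sqrt (ln (1 + l1norm v)) \<le> \<rho> * l1norm v" .
      then show ?thesis unfolding prob_field_def by (intro finite_measure_mono) auto
    qed
    finally show "c \<le> prob_field n v {t * sqrt (ln (1 + l1norm v))..}" .
  qed
qed

end

theorem theorem4p1:
  fixes U :: "real \<Rightarrow> ereal" and \<epsilon> :: real
  assumes "U \<in> borel_measurable borel"
    and "\<forall>x. U x = U (- x)"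
    and "\<exists>M::real. \<forall>x. ereal M \<le> U x"
    and "0 < (\<integral>\<^sup>+ x. boltz U x \<partial>lborel)" and "(\<integral>\<^sup>+ x. boltz U x \<partial>lborel) < \<infinity>"
    and "C2_on_unit U"
    and "0 < \<epsilon>" and "\<epsilon> \<le> 1/2"
  shows "\<exists>C c. C > 0 \<and> c > 0 \<and>
    (\<forall>n::nat. n \<ge> 2 \<longrightarrow> controlled_gradients n U (1/8) (1 - \<epsilon>) \<longrightarrow>
      (\<forall>v\<in>torus_V n. l1norm v \<ge> (ln (real n))\<^sup>2 \<longrightarrow>
         ext_variance (gibbs n U) (\<lambda>\<psi>. field \<psi> v) \<ge> ennreal (c * ln (1 + l1norm v)) \<and>
         (\<forall>r::real. r \<ge> 1 \<longrightarrow>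
            measure (gibbs n U) {\<psi> \<in> space (gibbs n U). \<bar>field \<psi> v\<bar> \<le> r}
              \<le> C * (r / sqrt (ln (1 + l1norm v))) powr (2/3)) \<and>
         (\<forall>t::real. 1 \<le> t \<and> t \<le> (1 + sqrt (l1norm v)) / (1 + ln (real n)) \<longrightarrow>
            measure (gibbs n U) {\<psi> \<in> space (gibbs n U). \<bar>field \<psi> v\<bar> \<ge> t * sqrt (ln (1 + l1norm v))}
              \<ge> c * exp (- C * t\<^sup>2))))"
proof -
  obtain M where M: "\<And>x. ereal M \<le> U x" using assms(3) by blast
  interpret surface_potential U M
    using assms(1,2,5,6) M by unfold_locales auto
  obtain C1 R where C1: "0 < C1" and R: "1 \<le> R"
    and ball: "\<And>n v r. 2 \<le> n \<Longrightarrow> controlled_gradients n U (1 / 8) (1 - \<epsilon>) \<Longrightarrow> v \<in> torus_V n \<Longrightarrow>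
      (ln (real n))\<^sup>2 \<le> l1norm v \<Longrightarrow> R \<le> l1norm v \<Longrightarrow> 1 \<le> r \<Longrightarrow>
      prob_field n v {- r..r} \<le> C1 * (r / sqrt (ln (1 + l1norm v))) powr (2 / 3)"
    and tail: "\<And>n v t. 2 \<le> n \<Longrightarrow> controlled_gradients n U (1 / 8) (1 - \<epsilon>) \<Longrightarrow> v \<in> torus_V n \<Longrightarrow>
      (ln (real n))\<^sup>2 \<le> l1norm v \<Longrightarrow> R \<le> l1norm v \<Longrightarrow> 1 \<le> t \<Longrightarrow> t \<le> (1 + sqrt (l1norm v)) / (1 + ln (real n)) \<Longrightarrow>
      exp (- C1 * t\<^sup>2) / 16 \<le> prob_field n v {t * sqrt (ln (1 + l1norm v))..}"
    using large_distance[OF assms(7,8)] by blast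
  obtain c1 where c1: "0 < c1" and near: "\<And>n v t. 2 \<le> n \<Longrightarrow> v \<in> torus_V n \<Longrightarrow> (ln (real n))\<^sup>2 \<le> l1norm v \<Longrightarrow> l1norm v < R \<Longrightarrow>
      1 \<le> t \<Longrightarrow> t \<le> (1 + sqrt (l1norm v)) / (1 + ln (real n)) \<Longrightarrow>
      c1 \<le> prob_field n v {t * sqrt (ln (1 + l1norm v))..}"
    using bounded_distance[of R] by blast
  \<comment> \<open>For \<open>l1norm v < R\<close> the small ball bound is made trivial: there
    \<open>sqrt L \<le> D\<close>, so adding \<open>D powr (2 / 3)\<close> to the constant lifts the
    right-hand side to at least 1.\<close>
  define D where "D = sqrt (ln (1 + R))"
  define C where "C = C1 + D powr (2 / 3)"
  define c0 where "c0 = min c1 (1 / 16)"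
  \<comment> \<open>The variance is bounded through the tail at \<open>t = 1\<close>, which costs
    the factor \<open>exp (- C)\<close>.\<close>
  define c where "c = c0 * exp (- C)"
  have D0: "0 < D" using R by (simp add: D_def)
  have C0: "0 < C" using C1 by (simp add: C_def add_pos_nonneg)
  have c0: "0 < c0" using c1 by (simp add: c0_def)
  have c: "0 < c" "c \<le> c0" using c0 C0 by (auto simp: c_def mult_left_le)
  show ?thesis
  proof (rule exI[of _ C], rule exI[of _ c], intro conjI allI impI ballI)
    fix n :: nat and v :: vertex
    assume n: "2 \<le> n" and ctrl: "controlled_gradients n U (1/8) (1 - \<epsilon>)" and v: "v \<in> torus_V n"
      and ln_n: "(ln (real n))\<^sup>2 \<le> l1norm v"
    interpret prob_space "gibbs n U" by (rule prob_space_gibbs)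
    note [measurable] = measurable_field[OF v]
    define L where "L = ln (1 + l1norm v)"
    have "0 < (ln (real n))\<^sup>2" using n by simp
    then have m0: "0 < l1norm v" using ln_n by linarith
    then have L0: "0 < L" by (simp add: L_def)
    have abs_tail: "c0 * exp (- C * t\<^sup>2) \<le> prob {\<psi> \<in> space (gibbs n U). t * sqrt L \<le> \<bar>field \<psi> v\<bar>}"
      if t: "1 \<le> t" "t \<le> (1 + sqrt (l1norm v)) / (1 + ln (real n))" for t
    proof -
      have "c0 * exp (- C * t\<^sup>2) \<le> prob_field n v {t * sqrt L..}"
      proof (cases "R \<le> l1norm v")
        case True
        have "C1 * t\<^sup>2 \<le> C * t\<^sup>2" by (intro mult_right_mono) (auto simp: C_def)
        then have "exp (- C * t\<^sup>2) \<le> exp (- C1 * t\<^sup>2)" by simp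
        then have "c0 * exp (- C * t\<^sup>2) \<le> 1 / 16 * exp (- C1 * t\<^sup>2)" using c0 by (intro mult_mono) (auto simp: c0_def)
        then show ?thesis using tail[OF n ctrl v ln_n True t] by (simp add: L_def)
      next
        case False
        have "c0 * exp (- C * t\<^sup>2) \<le> c1 * 1" using c0 C0 by (intro mult_mono) (auto simp: c0_def)
        also have "\<dots> \<le> prob_field n v {t * sqrt L..}" using near[OF n v ln_n _ t] False by (simp add: L_def)
        finally show ?thesis .
      qed
      also have "\<dots> \<le> prob {\<psi> \<in> space (gibbs n U). t * sqrt L \<le> \<bar>field \<psi> v\<bar>}"
        unfolding prob_field_def by (intro finite_measure_mono) auto
      finally show ?thesis .
    qed
    {
      fix t :: real assume t: "1 \<le> t \<and> t \<le> (1 + sqrt (l1norm v)) / (1 + ln (real n))"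
      have "c * exp (- C * t\<^sup>2) \<le> c0 * exp (- C * t\<^sup>2)" using c by (intro mult_right_mono) auto
      also have "\<dots> \<le> prob {\<psi> \<in> space (gibbs n U). t * sqrt L \<le> \<bar>field \<psi> v\<bar>}" using t abs_tail by blast
      finally show "c * exp (- C * t\<^sup>2) \<le> prob {\<psi> \<in> space (gibbs n U). t * sqrt (ln (1 + l1norm v)) \<le> \<bar>field \<psi> v\<bar>}"
        by (simp add: L_def)
    }
    {
      \<comment> \<open>This makes \<open>t = 1\<close> admissible in the tail bound.\<close>
      have "ln (real n) \<le> sqrt (l1norm v)" using n ln_n real_le_rsqrt by simp
      moreover have "0 < 1 + ln (real n)" using n by (simp add: add_pos_nonneg)
      ultimately have "1 \<le> (1 + sqrt (l1norm v)) / (1 + ln (real n))" by (simp add: le_divide_eq)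
      then have "c \<le> prob {\<psi> \<in> space (gibbs n U). sqrt L \<le> \<bar>field \<psi> v\<bar>}" using abs_tail[of 1] by (simp add: c_def)
      then have "c * L \<le> (sqrt L)\<^sup>2 * prob {\<psi> \<in> space (gibbs n U). sqrt L \<le> \<bar>field \<psi> v\<bar>}"
        using L0 by (simp add: mult.commute)
      then have "ennreal (c * L) \<le> ennreal ((sqrt L)\<^sup>2 * prob {\<psi> \<in> space (gibbs n U). sqrt L \<le> \<bar>field \<psi> v\<bar>})" by (rule ennreal_leI)
      also have "\<dots> \<le> ext_variance (gibbs n U) (\<lambda>\<psi>. field \<psi> v)" using L0 by (intro ext_variance_ge[OF v]) simp
      finally show "ennreal (c * ln (1 + l1norm v)) \<le> ext_variance (gibbs n U) (\<lambda>\<psi>. field \<psi> v)" by (simp add: L_def)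
    }
    {
      fix r :: real assume r: "1 \<le> r"
      have eq: "prob {\<psi> \<in> space (gibbs n U). \<bar>field \<psi> v\<bar> \<le> r} = prob_field n v {- r..r}"
        unfolding prob_field_def by (intro arg_cong[of _ _ prob]) auto
      have "prob_field n v {- r..r} \<le> C * (r / sqrt L) powr (2 / 3)"
      proof (cases "R \<le> l1norm v")
        case True
        have "prob_field n v {- r..r} \<le> C1 * (r / sqrt L) powr (2 / 3)" using ball[OF n ctrl v ln_n True r] by (simp add: L_def)
        also have "\<dots> \<le> C * (r / sqrt L) powr (2 / 3)" by (intro mult_right_mono) (auto simp: C_def)
        finally show ?thesis .
      next
        case False
        have "L \<le> ln (1 + R)" unfolding L_def using False m0 by (subst ln_le_cancel_iff) auto
        then have "sqrt L \<le> D" unfolding D_def by (rule real_sqrt_le_mono)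
        then have "1 / D \<le> r / sqrt L" using r L0 D0 by (intro frac_le) auto
        then have "(1 / D) powr (2 / 3) \<le> (r / sqrt L) powr (2 / 3)" using D0 by (intro powr_mono2) auto
        then have "D powr (2 / 3) * (1 / D) powr (2 / 3) \<le> C * (r / sqrt L) powr (2 / 3)"
          using C1 C0 by (intro mult_mono) (auto simp: C_def)
        moreover have "D powr (2 / 3) * (1 / D) powr (2 / 3) = 1" using D0 by (simp add: powr_mult[symmetric])
        moreover have "prob_field n v {- r..r} \<le> 1" unfolding prob_field_def by (rule prob_le_1)
        ultimately show ?thesis by linarith
      qed
      then show "prob {\<psi> \<in> space (gibbs n U). \<bar>field \<psi> v\<bar> \<le> r} \<le> C * (r / sqrt (ln (1 + l1norm v))) powr (2/3)"
        unfolding eq L_def .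
    }
  qed (use C0 c in auto)
qed

end
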